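(* Let $\Omega\subseteq\mathbb{R}^n$ be open and let $P$ be a partial differential operator of order $m$ with coefficients $a_\alpha=[(a_\alpha^\varepsilon)_\varepsilon]\in\mathcal{G}(\Omega)$, $|\alpha|\le m$, with symbols $P_\varepsilon(x,\xi)=\sum_{|\alpha|\le m}a_\alpha^\varepsilon(x)\xi^\alpha$ and principal symbols $P_{\varepsilon,m}(x,\xi)=\sum_{|\alpha|=m}a_\alpha^\varepsilon(x)\xi^\alpha$. Let $(x_0,\xi_0)\in\Omega\times(\mathbb{R}^n\setminus\{0\})$ with an open conic neighborhood $U\times\Gamma$ ($U\ni x_0$ open in $\Omega$, $\Gamma\ni\xi_0$ an open cone in $\mathbb{R}^n\setminus\{0\}$). Assume that $\sum_{|\alpha|=m}|a_\alpha|^2$ is invertible in $\mathcal{G}(U)$ and that for all compact $K\subset U$: (a) there exist slow scale nets $s_\varepsilon,r_\varepsilon>0$ and $\varepsilon_0>0$ such that $|P_{\varepsilon,m}(x,\xi)|\ge\frac{1}{s_\varepsilon}\sum_{|\alpha|=m}|a_\alpha^\varepsilon(x)|\cdot(1+|\xi|)^m$ when $(x,\xi)\in K\times\Gamma$, $|\xi|\ge r_\varepsilon$, $0<\varepsilon<\varepsilon_0$; (b) for every $\gamma\in\mathbb{N}_0^n$ there exist slow scale nets $s_\varepsilon^\gamma,r_\varepsilon^\gamma>0$ and $\varepsilon_\gamma>0$ such that for all $\beta\in\mathbb{N}_0^n$ with $0\le|\beta|\le m$, $|\partial_x^\gamma a_\beta^\varepsilon(x)|\le s_\varepsilon^\gamma\sum_{|\alpha|=m}|a_\alpha^\varepsilon(x)|$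 when $(x,\xi)\in K\times\Gamma$, $|\xi|\ge r_\varepsilon^\gamma$, $0<\varepsilon<\varepsilon_\gamma$. Then there are $m_0\in\mathbb{R}$ and $0\le\delta<\rho\le1$ such that for every compact $K\subset U$: (1) there exist $q>0$, a slow scale net $r_\varepsilon>0$ and $\varepsilon_0>0$ such that $|P_\varepsilon(x,\xi)|\ge\varepsilon^q(1+|\xi|)^{m_0}$ for all $(x,\xi)\in K\times\Gamma$, $|\xi|\ge r_\varepsilon$, $0<\varepsilon<\varepsilon_0$; (2) for every $\alpha\in\mathbb{N}_0^n$ there exist slow scale nets $s_\varepsilon^\alpha,r_\varepsilon^\alpha>0$ and $\varepsilon_\alpha>0$ such that for all $\beta\in\mathbb{N}_0^n$ with $0\le|\beta|\le m$, $|\partial_x^\alpha\partial_\xi^\beta P_\varepsilon(x,\xi)|\le s_\varepsilon^\alpha|P_\varepsilon(x,\xi)|(1+|\xi|)^{\delta|\alpha|-\rho|\beta|}$ for all $(x,\xi)\in K\times\Gamma$, $|\xi|\ge r_\varepsilon^\alpha$, $0<\varepsilon<\varepsilon_\alpha$. In particular, with $\Lambda=U\times\Gamma$, for each $u\in\mathcal{G}(\Omega)$ $$\Lambda\cap\mathrm{WF}_g(u)=\Lambda\cap\mathrm{WF}_g(Pu).$$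
   Context: Colombeau algebra: $\mathcal{E}_M(\Omega)$ is the set of families $(u_\varepsilon)_{\varepsilon\in(0,1]}$ of functions $u_\varepsilon\in C^\infty(\Omega)$ such that for all compact $K\subset\Omega$ and all $\alpha\in\mathbb{N}_0^n$ there is $p\ge0$ with $\sup_{x\in K}|\partial^\alpha u_\varepsilon(x)|=O(\varepsilon^{-p})$ as $\varepsilon\to0$. $\mathcal{N}(\Omega)$ is the set of families such that for all compact $K\subset\Omega$, all $\alpha$ and all $q\ge0$, $\sup_{x\in K}|\partial^\alpha u_\varepsilon(x)|=O(\varepsilon^q)$. $\mathcal{G}(\Omega)=\mathcal{E}_M(\Omega)/\mathcal{N}(\Omega)$; classes are written $[(u_\varepsilon)_\varepsilon]$. Restriction to open subsets is defined on representatives. "Invertible in $\mathcal{G}(U)$" means possessing a multiplicative inverse in the algebra $\mathcal{G}(U)$ (applied to the restriction to $U$); equivalently, there is a representative $(v_\varepsilon)_\varepsilon$ such that for each compact $K\subset U$ there is $p\in\mathbb{N}$ with $\inf_{x\in K}|v_\varepsilon(x)|\ge\varepsilon^p$ for small $\varepsilon>0$. Operators: with $D=(-i\partial_1,\dots,-i\partial_n)$, $P=\sum_{|\alpha|\le m}a_\alpha D^\alpha$ acts by $Pu=[(P_\varepsilon(x,D)u_\varepsilon)_\varepsilon]$, $P_\varepsilon(x,D)=\sum_{|\alpha|\le m}a_\alpha^\varepsilon(x)D^\alpha$. Slow scale: a net $(r_\varepsilon)_{\varepsilon\in(0,1]}$ of complex numbers with $|r_\varepsilon|=O(\varepsilon^{-p})$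 for some $p$ is a slow scale net if for all $t\ge0$ there is $\varepsilon_t>0$ with $|r_\varepsilon|^t\le\varepsilon^{-1}$ for all $\varepsilon\in(0,\varepsilon_t)$. Generalized wave front set: $u=[(u_\varepsilon)_\varepsilon]\in\mathcal{G}(\Omega)$ is microlocally regular at $(x_0,\xi_0)\in\Omega\times(\mathbb{R}^n\setminus\{0\})$ if there are an open neighborhood $U$ of $x_0$ and a conic neighborhood $\Gamma$ of $\xi_0$ such that for all $\varphi\in\mathcal{D}(U)=C_c^\infty(U)$: there is $N\in\mathbb{R}$ such that for all $l\in\mathbb{N}_0$ there are $C>0$, $\varepsilon_0>0$ with $|\widehat{\varphi u_\varepsilon}(\xi)|\le C\varepsilon^{-N}(1+|\xi|)^{-l}$ for all $\xi\in\Gamma$, $\varepsilon\in(0,\varepsilon_0)$, where $\widehat{v}(\xi)=\int v(x)e^{-i\xi x}dx$. $\mathrm{WF}_g(u)$ is the complement in $\Omega\times(\mathbb{R}^n\setminus\{0\})$ of the set of points where $u$ is microlocally regular. *)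

theory Defs
  imports
    "HOL-Analysis.Analysis"
    "HOL-Algebra.QuotRing"
    "HOL-Library.Landau_Symbols"
begin

section \<open>Multi-indices and smooth functions\<close>

text \<open>
  Euclidean space of dimension \<open>n\<close> is \<^typ>\<open>real^'n\<close>, and a multi-index is a function
  \<^typ>\<open>'n \<Rightarrow> nat\<close>. A function on an open set \<open>\<Omega>\<close> is represented by a total function whose values
  outside \<open>\<Omega>\<close> are irrelevant.
\<close>

type_synonym 'n multi_index = "'n \<Rightarrow> nat"

type_synonym 'n net = "real \<Rightarrow> real^'n \<Rightarrow> complex"

definition mi_abs :: "'n::finite multi_index \<Rightarrow> nat" where
  "mi_abs \<alpha> = (\<Sum>i\<in>UNIV. \<alpha> i)"

definition mi_power :: "real^'n \<Rightarrow> 'n::finite multi_index \<Rightarrow> real" where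
  "mi_power \<xi> \<alpha> = (\<Prod>i\<in>UNIV. (\<xi> $ i) ^ \<alpha> i)"

definition partial_deriv :: "'n::finite \<Rightarrow> (real^'n \<Rightarrow> complex) \<Rightarrow> real^'n \<Rightarrow> complex" where
  "partial_deriv i f x = frechet_derivative f (at x) (axis i 1)"

text \<open>
  The index type carries no order, so an arbitrary fixed enumeration of it determines the order in
  which the partial derivatives are applied; for smooth functions that order does not matter.
\<close>

definition coords :: "'n::finite list" where
  "coords = (SOME is. distinct is \<and> set is = UNIV)"

definition mi_deriv :: "'n::finite multi_index \<Rightarrow> (real^'n \<Rightarrow> complex) \<Rightarrow> real^'n \<Rightarrow> complex" where
  "mi_deriv \<alpha> f = foldr (\<lambda>i. partial_deriv i ^^ \<alpha> i) coords f"

primrec Ck_on :: "nat \<Rightarrow> (real^'n::finite) set \<Rightarrow> (real^'n \<Rightarrow> complex) \<Rightarrow> bool" where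
  "Ck_on 0 S f \<longleftrightarrow> continuous_on S f"
| "Ck_on (Suc k) S f \<longleftrightarrow> f differentiable_on S \<and> (\<forall>i. Ck_on k S (partial_deriv i f))"

text \<open>Only used for open \<open>S\<close>.\<close>

definition smooth_on :: "(real^'n::finite) set \<Rightarrow> (real^'n \<Rightarrow> complex) \<Rightarrow> bool" where
  "smooth_on S f \<longleftrightarrow> (\<forall>k. Ck_on k S f)"

text \<open>Elements of \<open>C\<^sub>c\<^sup>\<infinity>(U)\<close>, extended by zero to the whole space.\<close>

definition test_fun :: "(real^'n::finite) set \<Rightarrow> (real^'n \<Rightarrow> complex) \<Rightarrow> bool" where
  "test_fun U \<phi> \<longleftrightarrow> smooth_on UNIV \<phi> \<and> compact (closure {x. \<phi> x \<noteq> 0}) \<and> closure {x. \<phi> x \<noteq> 0} \<subseteq> U"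


section \<open>The Colombeau algebra\<close>

text \<open>
  Only the members with index in \<open>(0,1]\<close>, and only their values on \<open>\<Omega>\<close>, are constrained. Two nets
  which agree there differ by a negligible net, so they define the same element of the quotient.
  The restriction to nonempty \<open>K\<close> is needed because the supremum of the empty set of reals is
  unspecified.
\<close>

definition moderate :: "(real^'n::finite) set \<Rightarrow> 'n net set" where
  "moderate \<Omega> = {u. (\<forall>\<epsilon>\<in>{0<..1}. smooth_on \<Omega> (u \<epsilon>)) \<and>
     (\<forall>K \<alpha>. compact K \<and> K \<noteq> {} \<and> K \<subseteq> \<Omega> \<longrightarrow>
       (\<exists>p\<ge>0. (\<lambda>\<epsilon>. SUP x\<in>K. norm (mi_deriv \<alpha> (u \<epsilon>) x)) \<in> O[at_right 0](\<lambda>\<epsilon>. \<epsilon> powr (-p))))}"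

definition negligible_nets :: "(real^'n::finite) set \<Rightarrow> 'n net set" where
  "negligible_nets \<Omega> = {u. (\<forall>\<epsilon>\<in>{0<..1}. smooth_on \<Omega> (u \<epsilon>)) \<and>
     (\<forall>K \<alpha>. compact K \<and> K \<noteq> {} \<and> K \<subseteq> \<Omega> \<longrightarrow>
       (\<forall>q\<ge>0. (\<lambda>\<epsilon>. SUP x\<in>K. norm (mi_deriv \<alpha> (u \<epsilon>) x)) \<in> O[at_right 0](\<lambda>\<epsilon>. \<epsilon> powr q)))}"

definition moderate_ring :: "(real^'n::finite) set \<Rightarrow> 'n net ring" where
  "moderate_ring \<Omega> =
     \<lparr>carrier = moderate \<Omega>, monoid.mult = (\<lambda>u v \<epsilon> x. u \<epsilon> x * v \<epsilon> x), one = (\<lambda>\<epsilon> x. 1),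
      zero = (\<lambda>\<epsilon> x. 0), add = (\<lambda>u v \<epsilon> x. u \<epsilon> x + v \<epsilon> x)\<rparr>"

definition colombeau :: "(real^'n::finite) set \<Rightarrow> 'n net set ring" where
  "colombeau \<Omega> = moderate_ring \<Omega> Quot negligible_nets \<Omega>"

text \<open>
  The class of a net. For open \<open>U \<subseteq> \<Omega>\<close>, the restriction to \<open>U\<close> of \<open>colombeau_class \<Omega> u\<close> is
  \<open>colombeau_class U u\<close>.
\<close>

definition colombeau_class :: "(real^'n::finite) set \<Rightarrow> 'n net \<Rightarrow> 'n net set" where
  "colombeau_class \<Omega> u = negligible_nets \<Omega> +>\<^bsub>moderate_ring \<Omega>\<^esub> u"


section \<open>Differential operators and symbols\<close>

text \<open>\<open>D\<^sup>\<alpha>\<close> for \<open>D = (-i\<partial>\<^sub>1, \<dots>, -i\<partial>\<^sub>n)\<close>.\<close>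

definition D_deriv :: "'n::finite multi_index \<Rightarrow> (real^'n \<Rightarrow> complex) \<Rightarrow> real^'n \<Rightarrow> complex" where
  "D_deriv \<alpha> f x = (-\<i>) ^ mi_abs \<alpha> * mi_deriv \<alpha> f x"

definition diff_op_net ::
  "nat \<Rightarrow> ('n::finite multi_index \<Rightarrow> 'n net) \<Rightarrow> 'n net \<Rightarrow> 'n net" where
  "diff_op_net m a u \<epsilon> x = (\<Sum>\<alpha> | mi_abs \<alpha> \<le> m. a \<alpha> \<epsilon> x * D_deriv \<alpha> (u \<epsilon>) x)"

text \<open>
  The classes in the union all coincide, since applying a differential operator with moderate
  coefficients maps negligible nets to negligible nets.
\<close>

definition diff_op ::
  "(real^'n::finite) set \<Rightarrow> nat \<Rightarrow> ('n multi_index \<Rightarrow> 'n net) \<Rightarrow> 'n net set \<Rightarrow> 'n net set" where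
  "diff_op \<Omega> m a u = (\<Union>v\<in>u. colombeau_class \<Omega> (diff_op_net m a v))"

definition symb ::
  "nat \<Rightarrow> ('n::finite multi_index \<Rightarrow> 'n net) \<Rightarrow> real \<Rightarrow> real^'n \<Rightarrow> real^'n \<Rightarrow> complex" where
  "symb m a \<epsilon> x \<xi> = (\<Sum>\<alpha> | mi_abs \<alpha> \<le> m. a \<alpha> \<epsilon> x * complex_of_real (mi_power \<xi> \<alpha>))"

definition principal_symb ::
  "nat \<Rightarrow> ('n::finite multi_index \<Rightarrow> 'n net) \<Rightarrow> real \<Rightarrow> real^'n \<Rightarrow> real^'n \<Rightarrow> complex" where
  "principal_symb m a \<epsilon> x \<xi> = (\<Sum>\<alpha> | mi_abs \<alpha> = m. a \<alpha> \<epsilon> x * complex_of_real (mi_power \<xi> \<alpha>))"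

text \<open>\<open>\<partial>\<^sub>x\<^sup>\<alpha> \<partial>\<^sub>\<xi>\<^sup>\<beta> p(x,\<xi>)\<close>\<close>

definition symb_deriv ::
  "'n::finite multi_index \<Rightarrow> 'n multi_index \<Rightarrow> (real^'n \<Rightarrow> real^'n \<Rightarrow> complex) \<Rightarrow>
    real^'n \<Rightarrow> real^'n \<Rightarrow> complex" where
  "symb_deriv \<alpha> \<beta> p x \<xi> = mi_deriv \<alpha> (\<lambda>y. mi_deriv \<beta> (\<lambda>\<eta>. p y \<eta>) \<xi>) x"


section \<open>Slow scale nets\<close>

definition slow_scale :: "(real \<Rightarrow> complex) \<Rightarrow> bool" where
  "slow_scale r \<longleftrightarrow>
     (\<exists>p. (\<lambda>\<epsilon>. norm (r \<epsilon>)) \<in> O[at_right 0](\<lambda>\<epsilon>. \<epsilon> powr (-p))) \<and>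
     (\<forall>t\<ge>0. \<exists>\<epsilon>\<^sub>t\<in>{0<..1}. \<forall>\<epsilon>\<in>{0<..<\<epsilon>\<^sub>t}. norm (r \<epsilon>) powr t \<le> 1 / \<epsilon>)"

definition pos_slow_scale :: "(real \<Rightarrow> real) \<Rightarrow> bool" where
  "pos_slow_scale r \<longleftrightarrow> slow_scale (\<lambda>\<epsilon>. complex_of_real (r \<epsilon>)) \<and> (\<forall>\<epsilon>\<in>{0<..1}. 0 < r \<epsilon>)"


section \<open>The generalized wave front set\<close>

text \<open>
  The library predicates for cones require closure under multiplication by zero, and do not fit
  cones in the punctured space.
\<close>

definition open_cone :: "(real^'n::finite) set \<Rightarrow> bool" where
  "open_cone \<Gamma> \<longleftrightarrow> open \<Gamma> \<and> 0 \<notin> \<Gamma> \<and> (\<forall>\<xi>\<in>\<Gamma>. \<forall>t>0. t *\<^sub>R \<xi> \<in> \<Gamma>)"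

definition fourier :: "(real^'n::finite \<Rightarrow> complex) \<Rightarrow> real^'n \<Rightarrow> complex" where
  "fourier v \<xi> = (LINT x|lborel. v x * exp (- \<i> * complex_of_real (\<xi> \<bullet> x)))"

definition micro_regular_net ::
  "(real^'n::finite) set \<Rightarrow> 'n net \<Rightarrow> real^'n \<Rightarrow> real^'n \<Rightarrow> bool" where
  "micro_regular_net \<Omega> u x\<^sub>0 \<xi>\<^sub>0 \<longleftrightarrow>
     (\<exists>U \<Gamma>. open U \<and> x\<^sub>0 \<in> U \<and> U \<subseteq> \<Omega> \<and> open_cone \<Gamma> \<and> \<xi>\<^sub>0 \<in> \<Gamma> \<and>
       (\<forall>\<phi>. test_fun U \<phi> \<longrightarrow>
         (\<exists>N::real. \<forall>l::nat. \<exists>C>0. \<exists>\<epsilon>\<^sub>0\<in>{0<..1}. \<forall>\<xi>\<in>\<Gamma>. \<forall>\<epsilon>\<in>{0<..<\<epsilon>\<^sub>0}.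
           norm (fourier (\<lambda>x. \<phi> x * u \<epsilon> x) \<xi>) \<le> C * \<epsilon> powr (-N) * (1 + norm \<xi>) powr (- real l))))"

text \<open>Regularity does not depend on the representative of the class.\<close>

definition micro_regular ::
  "(real^'n::finite) set \<Rightarrow> 'n net set \<Rightarrow> real^'n \<Rightarrow> real^'n \<Rightarrow> bool" where
  "micro_regular \<Omega> u x\<^sub>0 \<xi>\<^sub>0 \<longleftrightarrow> (\<exists>v\<in>u. micro_regular_net \<Omega> v x\<^sub>0 \<xi>\<^sub>0)"

definition WF_g :: "(real^'n::finite) set \<Rightarrow> 'n net set \<Rightarrow> ((real^'n) \<times> (real^'n)) set" where
  "WF_g \<Omega> u = {(x, \<xi>). x \<in> \<Omega> \<and> \<xi> \<noteq> 0 \<and> \<not> micro_regular \<Omega> u x \<xi>}"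

end

theory Submission
  imports Defs "HOL-Probability.Characteristic_Functions" "HOL-Probability.Sinc_Integral"
begin

text \<open>
  With \<open>m\<^sub>0 = m\<close>, \<open>\<delta> = 0\<close> and \<open>\<rho> = 1\<close> the two symbol estimates are elementary: at a point of \<open>K \<times> \<Gamma>\<close>
  the terms of order less than \<open>m\<close> are a slow scale factor times \<open>1 / (1 + |\<xi>|)\<close> times the principal
  symbol, hence absorbed by it once \<open>|\<xi>|\<close> exceeds a slow scale net (\<open>symb_lower\<close>); every derivative
  of the symbol is bounded by the size \<open>A\<close> of the leading coefficients, and \<open>A\<close> is bounded below by
  a power of \<open>\<epsilon>\<close> because the sum of squares is invertible.

  For the wave front sets let \<open>e\<^sub>\<xi>(x) = exp(-i \<xi> \<bullet> x)\<close>. Integration by parts gives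
  \<open>\<integral> (P u) h e\<^sub>\<xi> = \<integral> u (L h) e\<^sub>\<xi>\<close> with \<open>L h = \<Sum>\<alpha>. (\<xi> - D)\<^sup>\<alpha> (a\<^sub>\<alpha> h)\<close>, and the only term of \<open>L h\<close>
  in which \<open>a\<^sub>\<alpha> h\<close> is not differentiated is \<open>P(x, \<xi>) h\<close>. So \<open>R h = h - L (h / P)\<close> has one order in
  \<open>\<xi>\<close> less than \<open>h\<close> (\<open>symbol_rem\<close>), and
  \<open>\<integral> u h e\<^sub>\<xi> = \<integral> (P u) (h / P) e\<^sub>\<xi> + \<integral> u (R h) e\<^sub>\<xi>\<close> (\<open>parametrix_step\<close>).
  Starting from \<open>h = \<phi>\<close>, where the left-hand side is the Fourier transform of \<open>\<phi> u\<close>, and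
  repeating the step for the last term, any rate of decay of that term is reached with nothing but a
  supremum bound for \<open>u\<close>; therefore the power of \<open>\<epsilon>\<close> does not depend on the rate. The other
  terms are integrals of \<open>P u\<close> against a symbol and a plane wave. They decay in a smaller cone when
  the Fourier transforms of the cut-off \<open>P u\<close> decay in a cone, since these are convolved with the
  rapidly decreasing Fourier transform of the symbol in \<open>x\<close> (\<open>multiplier\<close>, from Fourier inversion).
  Conversely, the Fourier transform of \<open>\<phi> P u\<close> is \<open>\<integral> u (L \<phi>) e\<^sub>\<xi>\<close>, and \<open>L \<phi>\<close> is a symbol as well:
  the assumed bounds on the coefficients control all their derivatives by one and the same power of
  \<open>\<epsilon>\<close>.

  Slow scale nets are handled by the filter \<open>high_freq \<Gamma>\<close> on the pairs \<open>(\<epsilon>, \<xi>)\<close>: a property holds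
  eventually if it holds for small \<open>\<epsilon>\<close> and all \<open>\<xi> \<in> \<Gamma>\<close> with \<open>|\<xi>| \<ge> r\<^sub>\<epsilon>\<close> for some slow scale
  net \<open>r\<close>. There every slow scale net is dominated by every positive power of \<open>1 + |\<xi>|\<close>, so that
  symbol classes may be defined with an arbitrarily small loss in that power, and they are closed
  under sums, products, derivatives and inverses. The remaining frequencies are harmless: if
  \<open>|\<xi>| < r\<^sub>\<epsilon>\<close>, then \<open>(1 + |\<xi>|)\<^sup>l\<close> is at most \<open>1 / \<epsilon>\<close> (\<open>low_frequencies\<close>).
\<close>

section \<open>Calculus of smooth functions\<close>

lemma partial_deriv_eqI:
  assumes "(f has_derivative f') (at x)"
  shows "partial_deriv i f x = f' (axis i 1)"
  using frechet_derivative_at[OF assms] by (simp add: partial_deriv_def)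

text \<open>
  Agreement near the point suffices; neither function has to be differentiable there.
\<close>

lemma partial_deriv_cong:
  assumes "open S" "x \<in> S" "\<And>y. y \<in> S \<Longrightarrow> f y = g y"
  shows "partial_deriv i f x = partial_deriv i g x"
proof -
  have "(f has_derivative D) (at x) \<longleftrightarrow> (g has_derivative D) (at x)" for D
    using assms has_derivative_transform_within_open[of f D x UNIV S g]
      has_derivative_transform_within_open[of g D x UNIV S f] by auto
  thus ?thesis by (simp add: partial_deriv_def frechet_derivative_def)
qed

lemma partial_deriv_zero:
  assumes "open S" "x \<in> S" "\<And>y. y \<in> S \<Longrightarrow> f y = 0"
  shows "partial_deriv i f x = 0"
proof -
  have "partial_deriv i f x = partial_deriv i (\<lambda>_. 0) x"
    by (rule partial_deriv_cong[OF assms(1,2)]) (simp add: assms)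
  also have "\<dots> = 0" by (rule partial_deriv_eqI[of _ "\<lambda>_. 0"]) auto
  finally show ?thesis .
qed

lemma partial_deriv_add:
  assumes "f differentiable (at x)" "g differentiable (at x)"
  shows "partial_deriv i (\<lambda>y. f y + g y) x = partial_deriv i f x + partial_deriv i g x"
  by (rule partial_deriv_eqI[THEN trans],
      rule has_derivative_add[OF assms[unfolded frechet_derivative_works]])
     (simp add: partial_deriv_def)

lemma partial_deriv_mult:
  assumes "f differentiable (at x)" "g differentiable (at x)"
  shows "partial_deriv i (\<lambda>y. f y * g y) x = partial_deriv i f x * g x + f x * partial_deriv i g x"
  by (rule partial_deriv_eqI[THEN trans],
      rule has_derivative_mult[OF assms(1)[unfolded frechet_derivative_works] assms(2)[unfolded frechet_derivative_works]])
     (simp add: partial_deriv_def)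

lemma partial_deriv_inverse:
  assumes "f differentiable (at x)" "f x \<noteq> 0"
  shows "partial_deriv i (\<lambda>y. inverse (f y)) x = - (inverse (f x) * inverse (f x) * partial_deriv i f x)"
  by (rule partial_deriv_eqI[THEN trans],
      rule Deriv.has_derivative_inverse[OF assms(2) assms(1)[unfolded frechet_derivative_works]])
     (simp add: partial_deriv_def)

lemma partial_deriv_linear:
  assumes "f differentiable (at x)" "bounded_linear h"
  shows "partial_deriv i (\<lambda>y. h (f y)) x = h (partial_deriv i f x)"
  by (rule partial_deriv_eqI[THEN trans],
      rule bounded_linear.has_derivative[OF assms(2) assms(1)[unfolded frechet_derivative_works]])
     (simp add: partial_deriv_def)

lemma partial_deriv_const [simp]: "partial_deriv i (\<lambda>_. c) = (\<lambda>_. 0)"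
  by (rule ext, rule partial_deriv_eqI[of _ "\<lambda>_. 0"]) auto

lemma partial_deriv_affine:
  assumes "f differentiable (at (c + r *\<^sub>R x))"
  shows "partial_deriv i (\<lambda>y. f (c + r *\<^sub>R y)) x = of_real r * partial_deriv i f (c + r *\<^sub>R x)"
proof -
  let ?D = "frechet_derivative f (at (c + r *\<^sub>R x))"
  have D: "(f has_derivative ?D) (at (c + r *\<^sub>R x))"
    using assms by (simp add: frechet_derivative_works)
  have "((\<lambda>y. f (c + r *\<^sub>R y)) has_derivative (\<lambda>v. ?D (r *\<^sub>R v))) (at x)"
    by (rule has_derivative_compose[where g = f and f = "\<lambda>y. c + r *\<^sub>R y", OF _ D])
       (auto intro!: derivative_eq_intros)
  from partial_deriv_eqI[OF this, of i] show ?thesis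
    using D by (simp add: has_derivative_def linear_simps partial_deriv_def scaleR_conv_of_real[where 'a = complex])
qed

lemma Ck_on_cong:
  assumes "open S" "\<And>x. x \<in> S \<Longrightarrow> f x = g x" "Ck_on k S f"
  shows "Ck_on k S g"
  using assms(2,3)
proof (induction k arbitrary: f g)
  case 0 thus ?case using continuous_on_cong[of S S f g] by simp
next
  case (Suc k)
  have "g differentiable_on S"
    unfolding differentiable_on_eq_differentiable_at[OF assms(1)]
  proof
    fix x assume "x \<in> S"
    moreover from this have "f differentiable (at x)"
      using Suc.prems(2) assms(1) by (auto simp: differentiable_on_eq_differentiable_at)
    ultimately show "g differentiable (at x)"
      unfolding differentiable_def
      using has_derivative_transform_within_open[OF _ assms(1)] Suc.prems(1) by blast
  qed
  moreover have "Ck_on k S (partial_deriv i g)" for i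
    by (rule Suc.IH[of "partial_deriv i f"])
       (use Suc.prems assms(1) partial_deriv_cong[of S _ f g] in auto)
  ultimately show ?case by simp
qed

lemma Ck_on_subset: "Ck_on k S f \<Longrightarrow> T \<subseteq> S \<Longrightarrow> Ck_on k T f"
  by (induction k arbitrary: f) (auto intro: continuous_on_subset differentiable_on_subset)

lemma Ck_on_SucD: "Ck_on (Suc k) S f \<Longrightarrow> Ck_on k S f"
  by (induction k arbitrary: f) (auto intro: differentiable_imp_continuous_on)

lemma Ck_on_Un:
  assumes "open S" "open T" "Ck_on k S f" "Ck_on k T f"
  shows "Ck_on k (S \<union> T) f"
  using assms(3,4)
  by (induction k arbitrary: f)
     (use assms(1,2) in \<open>auto intro: continuous_on_open_Un simp: differentiable_on_eq_differentiable_at open_Un\<close>)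

lemma Ck_on_add:
  assumes "open S" "Ck_on k S f" "Ck_on k S g"
  shows "Ck_on k S (\<lambda>x. f x + g x)"
  using assms(2,3)
proof (induction k arbitrary: f g)
  case (Suc k)
  have "Ck_on k S (partial_deriv i (\<lambda>x. f x + g x))" for i
    by (rule Ck_on_cong[OF assms(1) _ Suc.IH[of "partial_deriv i f" "partial_deriv i g"]])
       (use Suc.prems assms(1) in \<open>auto simp: partial_deriv_add differentiable_on_eq_differentiable_at\<close>)
  thus ?case using Suc.prems by auto
qed (auto intro: continuous_intros)

lemma Ck_on_mult:
  assumes "open S" "Ck_on k S f" "Ck_on k S g"
  shows "Ck_on k S (\<lambda>x. f x * g x)"
  using assms(2,3)
proof (induction k arbitrary: f g)
  case (Suc k)
  have d: "f differentiable at x" "g differentiable at x" if "x \<in> S" for x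
    using Suc.prems assms(1) that by (auto simp: differentiable_on_eq_differentiable_at)
  have "Ck_on k S (partial_deriv i (\<lambda>x. f x * g x))" for i
  proof (rule Ck_on_cong[OF assms(1)])
    show "Ck_on k S (\<lambda>x. partial_deriv i f x * g x + f x * partial_deriv i g x)"
      using Suc.prems Ck_on_SucD[OF Suc.prems(1)] Ck_on_SucD[OF Suc.prems(2)]
      by (intro Ck_on_add[OF assms(1)] Suc.IH) auto
  qed (simp add: d partial_deriv_mult)
  moreover have "(\<lambda>x. f x * g x) differentiable_on S"
    using d assms(1) by (auto simp: differentiable_on_eq_differentiable_at)
  ultimately show ?case by auto
qed (auto intro: continuous_intros)

lemma Ck_on_const: "Ck_on k S (\<lambda>_. c)"
  by (induction k arbitrary: c) auto

lemma Ck_on_inverse: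
  assumes "open S" "Ck_on k S f" "\<And>x. x \<in> S \<Longrightarrow> f x \<noteq> 0"
  shows "Ck_on k S (\<lambda>x. inverse (f x))"
  using assms(2)
proof (induction k)
  case (Suc k)
  have d: "f differentiable at x" if "x \<in> S" for x
    using Suc.prems assms(1) that by (auto simp: differentiable_on_eq_differentiable_at)
  have "Ck_on k S (partial_deriv i (\<lambda>x. inverse (f x)))" for i
  proof (rule Ck_on_cong[OF assms(1)])
    show "Ck_on k S (\<lambda>x. (- 1) * (inverse (f x) * inverse (f x) * partial_deriv i f x))"
      using Suc.prems Ck_on_SucD[OF Suc.prems(1)]
      by (intro Ck_on_mult[OF assms(1)] Suc.IH Ck_on_const) auto
  qed (simp add: d partial_deriv_inverse assms(3))
  moreover have "(\<lambda>x. inverse (f x)) differentiable_on S"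
    using d assms(1,3) by (auto simp: differentiable_on_eq_differentiable_at)
  ultimately show ?case by auto
qed (use assms(3) in \<open>auto intro: continuous_intros\<close>)

lemma Ck_on_linear:
  assumes "open S" "Ck_on k S f" "bounded_linear h"
  shows "Ck_on k S (\<lambda>x. h (f x))"
  using assms(2)
proof (induction k arbitrary: f)
  case 0
  thus ?case using bounded_linear.continuous_on[OF assms(3)] by auto
next
  case (Suc k)
  have d: "f differentiable at x" if "x \<in> S" for x
    using Suc.prems assms(1) that by (auto simp: differentiable_on_eq_differentiable_at)
  have "Ck_on k S (partial_deriv i (\<lambda>x. h (f x)))" for i
    by (rule Ck_on_cong[OF assms(1) _ Suc.IH[of "partial_deriv i f"]])
       (use Suc.prems in \<open>simp_all add: d partial_deriv_linear assms(3)\<close>)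
  moreover have "(\<lambda>x. h (f x)) differentiable_on S"
    unfolding differentiable_on_eq_differentiable_at[OF assms(1)]
    using d bounded_linear.has_derivative[OF assms(3)] unfolding differentiable_def by blast
  ultimately show ?case by auto
qed

lemma Ck_on_affine:
  assumes "Ck_on k UNIV f"
  shows "Ck_on k UNIV (\<lambda>x. f (c + r *\<^sub>R x))"
  using assms
proof (induction k arbitrary: f)
  case 0
  thus ?case by (auto intro!: continuous_on_compose2[of UNIV f] continuous_intros)
next
  case (Suc k)
  have d: "f differentiable at x" for x
    using Suc.prems by (auto simp: differentiable_on_eq_differentiable_at)
  have "Ck_on k UNIV (partial_deriv i (\<lambda>x. f (c + r *\<^sub>R x)))" for i
    by (rule Ck_on_cong[OF open_UNIV _ Ck_on_mult[OF open_UNIV Ck_on_const[of _ _ "of_real r"] Suc.IH[of "partial_deriv i f"]]])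
       (use Suc.prems in \<open>simp_all add: d partial_deriv_affine\<close>)
  moreover have "(\<lambda>x. f (c + r *\<^sub>R x)) differentiable_on UNIV"
    by (auto simp: differentiable_on_eq_differentiable_at
        intro!: differentiable_compose[of f] d derivative_intros)
  ultimately show ?case by auto
qed

text \<open>
  Coinduction: a property that implies differentiability and is inherited by partial derivatives
  implies smoothness.
\<close>

lemma smooth_onI:
  assumes "Q f" "\<And>f. Q f \<Longrightarrow> f differentiable_on S" "\<And>f i. Q f \<Longrightarrow> Q (partial_deriv i f)"
  shows "smooth_on S f"
proof -
  have "Ck_on k S g" if "Q g" for k g
    using that by (induction k arbitrary: g) (auto simp: assms differentiable_imp_continuous_on)
  thus ?thesis using assms(1) by (simp add: smooth_on_def)
qed

lemma smooth_on_partial_deriv: "smooth_on S f \<Longrightarrow> smooth_on S (partial_deriv i f)"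
  using Ck_on.simps(2) unfolding smooth_on_def by blast

lemma smooth_on_differentiable_on: "smooth_on S f \<Longrightarrow> f differentiable_on S"
  using Ck_on.simps(2)[of 0] unfolding smooth_on_def by blast

lemma smooth_on_differentiable: "smooth_on S f \<Longrightarrow> open S \<Longrightarrow> x \<in> S \<Longrightarrow> f differentiable (at x)"
  using smooth_on_differentiable_on differentiable_on_eq_differentiable_at by blast

lemma smooth_on_continuous_on: "smooth_on S f \<Longrightarrow> continuous_on S f"
  by (simp add: smooth_on_differentiable_on differentiable_imp_continuous_on)

lemma smooth_on_cong: "open S \<Longrightarrow> (\<And>x. x \<in> S \<Longrightarrow> f x = g x) \<Longrightarrow> smooth_on S f \<Longrightarrow> smooth_on S g"
  using Ck_on_cong unfolding smooth_on_def by blast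

lemma smooth_on_subset: "smooth_on S f \<Longrightarrow> T \<subseteq> S \<Longrightarrow> smooth_on T f"
  using Ck_on_subset unfolding smooth_on_def by blast

lemma smooth_on_Un: "open S \<Longrightarrow> open T \<Longrightarrow> smooth_on S f \<Longrightarrow> smooth_on T f \<Longrightarrow> smooth_on (S \<union> T) f"
  using Ck_on_Un unfolding smooth_on_def by blast

lemma smooth_on_const: "smooth_on S (\<lambda>_. c)"
  using Ck_on_const unfolding smooth_on_def by blast

lemma smooth_on_add: "open S \<Longrightarrow> smooth_on S f \<Longrightarrow> smooth_on S g \<Longrightarrow> smooth_on S (\<lambda>x. f x + g x)"
  using Ck_on_add unfolding smooth_on_def by blast

lemma smooth_on_mult: "open S \<Longrightarrow> smooth_on S f \<Longrightarrow> smooth_on S g \<Longrightarrow> smooth_on S (\<lambda>x. f x * g x)"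
  using Ck_on_mult unfolding smooth_on_def by blast

lemma smooth_on_sum:
  assumes "open S" "\<And>i. i \<in> I \<Longrightarrow> smooth_on S (f i)"
  shows "smooth_on S (\<lambda>x. \<Sum>i\<in>I. f i x)"
  using assms(2)
  by (induction I rule: infinite_finite_induct) (auto intro!: smooth_on_const smooth_on_add[OF assms(1)])

lemma smooth_on_inverse:
  "open S \<Longrightarrow> smooth_on S f \<Longrightarrow> (\<And>x. x \<in> S \<Longrightarrow> f x \<noteq> 0) \<Longrightarrow> smooth_on S (\<lambda>x. inverse (f x))"
  using Ck_on_inverse unfolding smooth_on_def by blast

lemma smooth_on_linear: "open S \<Longrightarrow> smooth_on S f \<Longrightarrow> bounded_linear h \<Longrightarrow> smooth_on S (\<lambda>x. h (f x))"
  using Ck_on_linear unfolding smooth_on_def by blast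

lemma smooth_on_affine: "smooth_on UNIV f \<Longrightarrow> smooth_on UNIV (\<lambda>x. f (c + r *\<^sub>R x))"
  using Ck_on_affine unfolding smooth_on_def by blast

text \<open>
  Restriction to a coordinate line turns statements about partial derivatives into statements about
  functions of one real variable.
\<close>

lemma partial_deriv_line:
  assumes "f differentiable (at (y + t *\<^sub>R axis i 1))"
  shows "((\<lambda>t. f (y + t *\<^sub>R axis i 1)) has_vector_derivative partial_deriv i f (y + t *\<^sub>R axis i 1)) (at t)"
proof -
  let ?D = "frechet_derivative f (at (y + t *\<^sub>R axis i 1))"
  have D: "(f has_derivative ?D) (at (y + t *\<^sub>R axis i 1))"
    using assms by (simp add: frechet_derivative_works)
  have "((\<lambda>t. f (y + t *\<^sub>R axis i 1)) has_derivative (\<lambda>v. ?D (v *\<^sub>R axis i 1))) (at t)"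
    by (rule has_derivative_compose[where g = f and f = "\<lambda>t. y + t *\<^sub>R axis i 1", OF _ D])
       (auto intro!: derivative_eq_intros)
  thus ?thesis
    using D by (simp add: has_derivative_def linear_simps partial_deriv_def has_vector_derivative_def)
qed

text \<open>
  Two applications of the mean value theorem, along the two coordinate directions. The left-hand side
  is symmetric in \<open>i\<close> and \<open>j\<close>, which gives the equality of the mixed derivatives below. Only real parts
  are considered because the mean value theorem fails for complex functions.
\<close>

lemma second_difference_mvt:
  assumes "h > 0" 
    and d: "\<And>s t. 0 \<le> s \<Longrightarrow> s \<le> h \<Longrightarrow> 0 \<le> t \<Longrightarrow> t \<le> h \<Longrightarrow>
      f differentiable (at (x + s *\<^sub>R axis i 1 + t *\<^sub>R axis j 1)) \<and>
      partial_deriv j f differentiable (at (x + s *\<^sub>R axis i 1 + t *\<^sub>R axis j 1))"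
  obtains s t where "0 < s" "s < h" "0 < t" "t < h"
    "Re (f (x + h *\<^sub>R axis i 1 + h *\<^sub>R axis j 1) - f (x + h *\<^sub>R axis j 1) - f (x + h *\<^sub>R axis i 1) + f x)
      = h\<^sup>2 * Re (partial_deriv i (partial_deriv j f) (x + s *\<^sub>R axis i 1 + t *\<^sub>R axis j 1))"
proof -
  note r = bounded_linear.has_vector_derivative[OF bounded_linear_Re, unfolded has_real_derivative_iff_has_vector_derivative[symmetric]]
  define g where "g = (\<lambda>t. Re (f (x + h *\<^sub>R axis i 1 + t *\<^sub>R axis j 1)) - Re (f (x + t *\<^sub>R axis j 1)))"
  have "(g has_real_derivative Re (partial_deriv j f (x + h *\<^sub>R axis i 1 + t *\<^sub>R axis j 1)) - Re (partial_deriv j f (x + t *\<^sub>R axis j 1))) (at t)"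
    if "0 \<le> t" "t \<le> h" for t
    unfolding g_def using d[of h t] d[of 0 t] that \<open>h > 0\<close>
    by (intro DERIV_diff r partial_deriv_line) auto
  from MVT2[OF \<open>h > 0\<close> this] obtain t where t: "0 < t" "t < h"
    "g h - g 0 = h * (Re (partial_deriv j f (x + h *\<^sub>R axis i 1 + t *\<^sub>R axis j 1)) - Re (partial_deriv j f (x + t *\<^sub>R axis j 1)))"
    by auto
  define k where "k = (\<lambda>s. Re (partial_deriv j f ((x + t *\<^sub>R axis j 1) + s *\<^sub>R axis i 1)))"
  have "(k has_real_derivative Re (partial_deriv i (partial_deriv j f) ((x + t *\<^sub>R axis j 1) + s *\<^sub>R axis i 1))) (at s)"
    if "0 \<le> s" "s \<le> h" for s
    unfolding k_def using d[of s t] that \<open>h > 0\<close> t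
    by (intro r partial_deriv_line) (auto simp: add_ac)
  from MVT2[OF \<open>h > 0\<close> this] obtain s where s: "0 < s" "s < h"
    "k h - k 0 = h * Re (partial_deriv i (partial_deriv j f) ((x + t *\<^sub>R axis j 1) + s *\<^sub>R axis i 1))" by auto
  show ?thesis
  proof (rule that[OF s(1,2) t(1,2)])
    show "Re (f (x + h *\<^sub>R axis i 1 + h *\<^sub>R axis j 1) - f (x + h *\<^sub>R axis j 1) - f (x + h *\<^sub>R axis i 1) + f x)
      = h\<^sup>2 * Re (partial_deriv i (partial_deriv j f) (x + s *\<^sub>R axis i 1 + t *\<^sub>R axis j 1))"
      using t(3) s(3) by (simp add: g_def k_def power2_eq_square add_ac algebra_simps)
  qed
qed

text \<open>
  Both mixed derivatives are limits of the same second difference quotient. The argument for real parts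
  applies to \<open>-i f\<close> as well, which settles the imaginary parts.
\<close>

lemma partial_deriv_commute:
  assumes "open S" "smooth_on S f" "x \<in> S"
  shows "partial_deriv i (partial_deriv j f) x = partial_deriv j (partial_deriv i f) x"
proof -
  have Re: "Re (partial_deriv i (partial_deriv j f) x) = Re (partial_deriv j (partial_deriv i f) x)"
    if f: "smooth_on S f" for f
  proof -
    define A where "A = (\<lambda>i j x. Re (partial_deriv i (partial_deriv j f) x))"
    have "\<bar>A i j x - A j i x\<bar> \<le> 0 + e" if "e > 0" for e
    proof -
      have cont: "isCont (A i j) x" for i j
        unfolding A_def
        by (rule isCont_Re[OF differentiable_imp_continuous_within[OF
            smooth_on_differentiable[OF smooth_on_partial_deriv[OF smooth_on_partial_deriv[OF f]] assms(1,3)]]])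
      have "\<exists>d>0. \<forall>y. dist y x < d \<longrightarrow> dist (A i j y) (A i j x) < e / 2" for i j
        using cont[of i j, unfolded continuous_at_eps_delta, rule_format, of "e / 2"] \<open>e > 0\<close>
        unfolding dist_norm real_norm_def by simp
      then obtain d1 d2 where d12: "d1 > 0" "d2 > 0"
        "\<And>y. dist y x < d1 \<Longrightarrow> dist (A i j y) (A i j x) < e / 2"
        "\<And>y. dist y x < d2 \<Longrightarrow> dist (A j i y) (A j i x) < e / 2" by meson
      obtain d3 where d3: "d3 > 0" "\<And>y. dist y x < d3 \<Longrightarrow> y \<in> S"
        using assms(1,3) unfolding open_dist by blast
      define h where "h = min d1 (min d2 d3) / 3"
      have h: "h > 0" "2 * h < d1" "2 * h < d2" "2 * h < d3" using d12 d3 by (auto simp: h_def)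
      have near: "dist (x + s *\<^sub>R axis k 1 + t *\<^sub>R axis l 1) x \<le> 2 * h"
        if "0 \<le> s" "s \<le> h" "0 \<le> t" "t \<le> h" for s t and k l :: 'a
      proof -
        have "norm (s *\<^sub>R axis k 1 + t *\<^sub>R axis l (1::real)) \<le> \<bar>s\<bar> * 1 + \<bar>t\<bar> * 1"
          by (rule norm_triangle_le) (simp add: norm_axis_1)
        thus ?thesis using that by (simp add: dist_norm add.assoc)
      qed
      have dd: "f differentiable (at (x + s *\<^sub>R axis k 1 + t *\<^sub>R axis l 1)) \<and>
          partial_deriv l f differentiable (at (x + s *\<^sub>R axis k 1 + t *\<^sub>R axis l 1))"
        if "0 \<le> s" "s \<le> h" "0 \<le> t" "t \<le> h" for s t k l
        using near[OF that, of k l] h d3(2) assms(1) f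
        by (meson le_less_trans smooth_on_differentiable smooth_on_partial_deriv)
      obtain s t where st: "0 < s" "s < h" "0 < t" "t < h"
        "Re (f (x + h *\<^sub>R axis i 1 + h *\<^sub>R axis j 1) - f (x + h *\<^sub>R axis j 1) - f (x + h *\<^sub>R axis i 1) + f x)
          = h\<^sup>2 * Re (partial_deriv i (partial_deriv j f) (x + s *\<^sub>R axis i 1 + t *\<^sub>R axis j 1))"
        by (rule second_difference_mvt[OF h(1) dd])
      obtain s' t' where st': "0 < s'" "s' < h" "0 < t'" "t' < h"
        "Re (f (x + h *\<^sub>R axis j 1 + h *\<^sub>R axis i 1) - f (x + h *\<^sub>R axis i 1) - f (x + h *\<^sub>R axis j 1) + f x)
          = h\<^sup>2 * Re (partial_deriv j (partial_deriv i f) (x + s' *\<^sub>R axis j 1 + t' *\<^sub>R axis i 1))"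
        by (rule second_difference_mvt[OF h(1) dd])
      have "h\<^sup>2 * A i j (x + s *\<^sub>R axis i 1 + t *\<^sub>R axis j 1) = h\<^sup>2 * A j i (x + s' *\<^sub>R axis j 1 + t' *\<^sub>R axis i 1)"
        using st(5) st'(5) add.commute[of "x + h *\<^sub>R axis j 1" "h *\<^sub>R axis i 1"]
        by (simp add: A_def add_ac) (simp add: algebra_simps)
      hence "A i j (x + s *\<^sub>R axis i 1 + t *\<^sub>R axis j 1) = A j i (x + s' *\<^sub>R axis j 1 + t' *\<^sub>R axis i 1)"
        using h(1) by simp
      moreover have "dist (A i j (x + s *\<^sub>R axis i 1 + t *\<^sub>R axis j 1)) (A i j x) < e / 2"
        using near[of s t i j] st h by (intro d12) auto
      moreover have "dist (A j i (x + s' *\<^sub>R axis j 1 + t' *\<^sub>R axis i 1)) (A j i x) < e / 2"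
        using near[of s' t' j i] st' h by (intro d12) auto
      ultimately show ?thesis unfolding dist_real_def by linarith
    qed
    hence "\<bar>A i j x - A j i x\<bar> \<le> 0" by (rule field_le_epsilon)
    thus ?thesis by (simp add: A_def)
  qed
  have lin: "partial_deriv i (partial_deriv j (\<lambda>y. - \<i> * f y)) x = - \<i> * partial_deriv i (partial_deriv j f) x" for i j
  proof -
    have "partial_deriv i (partial_deriv j (\<lambda>y. - \<i> * f y)) x = partial_deriv i (\<lambda>y. - \<i> * partial_deriv j f y) x"
      by (rule partial_deriv_cong[OF assms(1,3)])
         (use assms(1,2) smooth_on_differentiable in \<open>blast intro!: partial_deriv_linear bounded_linear_mult_right\<close>)
    also have "\<dots> = - \<i> * partial_deriv i (partial_deriv j f) x"
      by (rule partial_deriv_linear[OF smooth_on_differentiable[OF smooth_on_partial_deriv[OF assms(2)] assms(1,3)] bounded_linear_mult_right])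
    finally show ?thesis .
  qed
  have "smooth_on S (\<lambda>y. - \<i> * f y)"
    by (rule smooth_on_linear[OF assms(1,2) bounded_linear_mult_right])
  from Re[OF assms(2)] Re[OF this] show ?thesis
    unfolding lin by (simp add: complex_eq_iff)
qed

section \<open>Derivatives along lists of coordinates\<close>

abbreviation pderivs :: "'n::finite list \<Rightarrow> (real^'n \<Rightarrow> complex) \<Rightarrow> real^'n \<Rightarrow> complex" where
  "pderivs \<equiv> foldr partial_deriv"

text \<open>
  The coordinates of the derivative \<open>mi_deriv \<alpha>\<close>, outermost first.
\<close>

definition mi_list :: "'n::finite multi_index \<Rightarrow> 'n list" where
  "mi_list \<alpha> = concat (map (\<lambda>i. replicate (\<alpha> i) i) coords)"

lemma coords: "distinct (coords :: 'a::finite list)" "set (coords :: 'a list) = UNIV"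
proof -
  have "\<exists>is::'a list. distinct is \<and> set is = UNIV"
    using finite_distinct_list[OF finite[of UNIV]] by blast
  from someI_ex[OF this] show "distinct (coords::'a list)" "set (coords :: 'a list) = UNIV"
    by (auto simp: coords_def)
qed

lemma mi_deriv_eq_pderivs: "mi_deriv \<alpha> f = pderivs (mi_list \<alpha>) f"
proof -
  have r: "foldr partial_deriv (replicate n i) = partial_deriv i ^^ n" for n and i :: 'a
    by (induction n) auto
  have "foldr (\<lambda>i. partial_deriv i ^^ \<alpha> i) xs f = pderivs (concat (map (\<lambda>i. replicate (\<alpha> i) i) xs)) f" for xs
    by (induction xs) (auto simp: r)
  thus ?thesis by (simp add: mi_deriv_def mi_list_def)
qed

lemma count_mi_list: "count (mset (mi_list \<alpha>)) i = \<alpha> i"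
proof -
  have "count (mset (concat (map (\<lambda>i. replicate (\<alpha> i) i) xs))) i = \<alpha> i * count (mset xs) i" for xs
    by (induction xs) auto
  moreover have "count (mset (coords :: 'a list)) i = 1"
    using coords distinct_count_atmost_1 by (metis UNIV_I)
  ultimately show ?thesis by (simp add: mi_list_def)
qed

lemma length_mi_list: "length (mi_list \<alpha>) = mi_abs \<alpha>"
proof -
  have "length (mi_list \<alpha>) = (\<Sum>i\<in>UNIV. count (mset (mi_list \<alpha>)) i)"
    unfolding size_mset[symmetric] size_multiset_overloaded_eq
    by (rule sum.mono_neutral_left) (auto simp: not_in_iff)
  thus ?thesis by (simp add: count_mi_list mi_abs_def)
qed

lemma smooth_on_pderivs: "smooth_on S f \<Longrightarrow> smooth_on S (pderivs is f)"
  by (induction "is") (auto intro: smooth_on_partial_deriv)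

lemma pderivs_move:
  assumes "open S" "smooth_on S f" "x \<in> S"
  shows "pderivs (as @ i # bs) f x = pderivs (i # as @ bs) f x"
  using assms(3)
proof (induction as arbitrary: x)
  case (Cons j as)
  have "pderivs ((j # as) @ i # bs) f x = partial_deriv j (partial_deriv i (pderivs (as @ bs) f)) x"
    using Cons partial_deriv_cong[OF assms(1) Cons.prems, of "pderivs (as @ i # bs) f" "partial_deriv i (pderivs (as @ bs) f)"]
    by simp
  thus ?case using partial_deriv_commute[OF assms(1) smooth_on_pderivs[OF assms(2)] Cons.prems, of j i "as @ bs"] by simp
qed simp

lemma pderivs_mset_eq:
  assumes "open S" "smooth_on S f" "x \<in> S" "mset as = mset bs"
  shows "pderivs as f x = pderivs bs f x"
  using assms(3,4)
proof (induction as arbitrary: bs x)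
  case (Cons i as)
  have "i \<in> set bs" using Cons.prems by (metis list.set_intros(1) mset_eq_setD)
  then obtain cs ds where bs: "bs = cs @ i # ds" by (auto simp: in_set_conv_decomp)
  have "partial_deriv i (pderivs as f) x = partial_deriv i (pderivs (cs @ ds) f) x"
    by (rule partial_deriv_cong[OF assms(1) Cons.prems(1)], rule Cons.IH) (use Cons.prems bs in auto)
  thus ?case using pderivs_move[OF assms(1,2) Cons.prems(1), of cs i ds] bs by simp
qed simp

text \<open>
  Bounds on the derivatives of the coefficients concern multi-indices, whereas repeated
  differentiation of products produces derivatives in any order; symmetry reconciles the two.
\<close>

lemma pderivs_eq_mi_deriv:
  assumes "open S" "smooth_on S f" "x \<in> S"
  shows "pderivs is f x = mi_deriv (count (mset is)) f x"
  unfolding mi_deriv_eq_pderivs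
  by (rule pderivs_mset_eq[OF assms]) (simp add: multiset_eq_iff count_mi_list)

section \<open>Compactly supported functions and integration by parts\<close>

text \<open>
  Smooth functions supported in \<open>K\<close>, on the whole space. The set \<open>K\<close> is kept explicit because all the
  functions of one construction live on the support of one test function.
\<close>

definition csmooth :: "(real^'n::finite) set \<Rightarrow> (real^'n \<Rightarrow> complex) \<Rightarrow> bool" where
  "csmooth K h \<longleftrightarrow> smooth_on UNIV h \<and> (\<forall>x. x \<notin> K \<longrightarrow> h x = 0)"

lemma csmooth_partial_deriv:
  assumes "compact K" "csmooth K h"
  shows "csmooth K (partial_deriv i h)"
proof -
  have "partial_deriv i h x = 0" if "x \<notin> K" for x
    by (rule partial_deriv_zero[of "-K"]) (use assms that in \<open>auto simp: csmooth_def compact_imp_closed\<close>)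
  thus ?thesis using assms by (auto simp: csmooth_def smooth_on_partial_deriv)
qed

lemma csmooth_pderivs: "compact K \<Longrightarrow> csmooth K h \<Longrightarrow> csmooth K (pderivs is h)"
  by (induction "is") (auto intro: csmooth_partial_deriv)

text \<open>
  The product is smooth on \<open>S\<close> and vanishes on the complement of \<open>K\<close>, and these two open sets
  cover the space; so arbitrary values of \<open>g\<close> outside \<open>S\<close> do no harm.
\<close>

lemma csmooth_mult:
  assumes "compact K" "open S" "K \<subseteq> S" "smooth_on S g" "csmooth K h"
  shows "csmooth K (\<lambda>x. g x * h x)"
proof -
  have "smooth_on (- K) (\<lambda>x. g x * h x)"
    by (rule smooth_on_cong[OF _ _ smooth_on_const[of _ 0]]) (use assms in \<open>auto simp: csmooth_def compact_imp_closed\<close>)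
  moreover have "smooth_on S (\<lambda>x. g x * h x)"
    using assms smooth_on_subset[of UNIV h S] by (auto simp: csmooth_def intro!: smooth_on_mult)
  ultimately have "smooth_on (- K \<union> S) (\<lambda>x. g x * h x)"
    using assms by (intro smooth_on_Un) (auto simp: compact_imp_closed)
  moreover have "- K \<union> S = UNIV" using assms(3) by auto
  ultimately show ?thesis using assms(5) by (auto simp: csmooth_def)
qed

lemma csmooth_continuous: "csmooth K h \<Longrightarrow> continuous_on UNIV h"
  by (simp add: csmooth_def smooth_on_continuous_on)

lemma compact_support_integrable:
  fixes h :: "real^'n::finite \<Rightarrow> complex"
  assumes "compact K" "continuous_on K h" "\<And>x. x \<notin> K \<Longrightarrow> h x = 0"
  shows "integrable lborel h"
proof -
  have "integrable lborel (\<lambda>x. indicator K x *\<^sub>R h x)"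
    by (rule borel_integrable_compact[OF assms(1,2)])
  moreover have "(\<lambda>x. indicator K x *\<^sub>R h x) = h" using assms(3) by (auto simp: indicator_def)
  ultimately show ?thesis by simp
qed

lemma csmooth_integrable: "compact K \<Longrightarrow> csmooth K h \<Longrightarrow> integrable lborel h"
  by (rule compact_support_integrable) (auto simp: csmooth_def intro: smooth_on_continuous_on continuous_on_subset)

lemma integrable_indicator_compact:
  fixes K :: "(real^'n::finite) set"
  assumes "compact K"
  shows "integrable lborel (\<lambda>x. B * indicator K x :: real)"
proof (intro integrable_mult_right integrable_real_indicator)
  show "K \<in> sets lborel" using assms by (simp add: borel_compact)
  show "emeasure lborel K < \<infinity>" using emeasure_compact_finite[OF assms] .
qed

lemma compact_support_integral_bound:
  fixes h :: "real^'n::finite \<Rightarrow> complex"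
  assumes "compact K" "\<And>x. x \<notin> K \<Longrightarrow> h x = 0" "\<And>x. x \<in> K \<Longrightarrow> norm (h x) \<le> B" "0 \<le> B"
  shows "norm (integral\<^sup>L lborel h) \<le> measure lborel K * B"
proof (cases "integrable lborel h")
  case True
  have K: "integrable lborel (\<lambda>x. B * indicator K x :: real)"
    using assms(1) by (rule integrable_indicator_compact)
  have "norm (integral\<^sup>L lborel h) \<le> (LINT x|lborel. norm (h x))"
    by (rule integral_norm_bound)
  also have "\<dots> \<le> (LINT x|lborel. B * indicator K x)"
    by (rule integral_mono[OF integrable_norm[OF True] K]) (use assms in \<open>auto simp: indicator_def\<close>)
  also have "\<dots> = measure lborel K * B"
    using assms(1) by (simp add: borel_compact)
  finally show ?thesis .
qed (use assms(4) in \<open>simp add: not_integrable_integral_eq\<close>)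

lemma csmooth_bounded:
  assumes "compact K" "csmooth K h"
  obtains B where "0 \<le> B" "\<And>x. norm (h x) \<le> B"
proof -
  have "compact (h ` K)"
    using assms csmooth_continuous[OF assms(2)] compact_continuous_image continuous_on_subset by blast
  then obtain B where "0 < B" "\<And>x. x \<in> K \<Longrightarrow> norm (h x) \<le> B"
    using compact_imp_bounded bounded_pos by (metis imageI)
  hence "norm (h x) \<le> B" for x using assms(2) by (cases "x \<in> K") (auto simp: csmooth_def)
  thus ?thesis using \<open>0 < B\<close> that[of B] by simp
qed

lemma integral_translate:
  fixes f :: "real^'n::finite \<Rightarrow> complex"
  assumes "f \<in> borel_measurable borel"
  shows "(LINT x|lborel. f (x + c)) = (LINT x|lborel. f x)"
proof -
  have "(LINT x|lborel. f x) = (LINT x|distr lborel borel ((+) c). f x)"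
    by (simp add: lborel_distr_plus)
  also have "\<dots> = (LINT x|lborel. f (c + x))"
    by (subst integral_distr) (use assms in auto)
  finally show ?thesis by (simp add: add.commute)
qed

text \<open>
  By translation invariance the integral of each difference quotient of \<open>h\<close> in direction \<open>i\<close>
  vanishes. The quotients are dominated by the supremum of the derivative on a compact
  neighbourhood of \<open>K\<close>, so the integrals converge to that of the derivative.
\<close>

lemma integral_partial_deriv_eq_0:
  fixes h :: "real^'n::finite \<Rightarrow> complex"
  assumes K: "compact K" and h: "csmooth K h"
  shows "(LINT x|lborel. partial_deriv i h x) = 0"
proof -
  define t where "t = (\<lambda>k::nat. 1 / real (Suc k))"
  have t: "t k > 0" "t k \<le> 1" for k by (auto simp: t_def)
  have t0: "t \<longlonglongrightarrow> 0" unfolding t_def by (rule LIMSEQ_Suc[OF lim_1_over_n])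
  define q where "q = (\<lambda>k x. (h (x + t k *\<^sub>R axis i 1) - h x) /\<^sub>R t k)"
  have hc: "continuous_on UNIV h" using h by (rule csmooth_continuous)
  have hd: "h differentiable (at x)" for x
    using h by (auto simp: csmooth_def intro: smooth_on_differentiable)
  have meas: "h \<in> borel_measurable borel" using hc by (rule borel_measurable_continuous_onI)
  obtain B where B: "0 \<le> B" "\<And>x. norm (partial_deriv i h x) \<le> B"
    using csmooth_bounded[OF K csmooth_partial_deriv[OF K h]] by blast
  define K' where "K' = {x + y | x y. x \<in> K \<and> y \<in> cball (0::real^'n) 1}"
  have K': "compact K'" unfolding K'_def by (rule compact_sums[OF K compact_cball])
  have q_bound: "norm (q k x) \<le> B * indicator K' x" for k x
  proof (cases "x \<in> K'")
    case True
    have "norm (h (x + t k *\<^sub>R axis i 1) - h (x + 0 *\<^sub>R axis i 1)) \<le> B * norm (t k - 0)"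
    proof (rule differentiable_bound[where S = UNIV and f' = "\<lambda>s v. v *\<^sub>R partial_deriv i h (x + s *\<^sub>R axis i 1)"])
      show "((\<lambda>s. h (x + s *\<^sub>R axis i 1)) has_derivative (\<lambda>v. v *\<^sub>R partial_deriv i h (x + s *\<^sub>R axis i 1))) (at s within UNIV)" for s
        using partial_deriv_line[OF hd] by (simp add: has_vector_derivative_def)
      show "onorm (\<lambda>v::real. v *\<^sub>R partial_deriv i h (x + s *\<^sub>R axis i 1)) \<le> B" for s
        by (rule onorm_le) (use B in \<open>auto simp: mult.commute[of B] intro!: mult_left_mono\<close>)
    qed auto
    moreover have "norm (q k x) = norm (h (x + t k *\<^sub>R axis i 1) - h x) / t k"
      using t[of k] by (simp add: q_def divide_inverse mult.commute)
    ultimately show ?thesis using True t[of k] by (simp add: pos_divide_le_eq)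
  next
    case False
    have "x \<notin> K" using False unfolding K'_def by (metis (mono_tags, lifting) mem_Collect_eq add.right_neutral centre_in_cball zero_le_one)
    moreover have "x + t k *\<^sub>R axis i 1 \<notin> K"
    proof
      assume "x + t k *\<^sub>R axis i 1 \<in> K"
      moreover have "- t k *\<^sub>R axis i (1::real) \<in> cball 0 1" using t[of k] by (simp add: norm_axis_1)
      ultimately have "(x + t k *\<^sub>R axis i 1) + (- t k *\<^sub>R axis i 1) \<in> K'" unfolding K'_def by blast
      thus False using False by simp
    qed
    ultimately show ?thesis using h False by (auto simp: q_def csmooth_def)
  qed
  have q_lim: "(\<lambda>k. q k x) \<longlonglongrightarrow> partial_deriv i h x" for x
  proof -
    have "((\<lambda>s. h (x + s *\<^sub>R axis i 1)) has_derivative (\<lambda>v. v *\<^sub>R partial_deriv i h x)) (at 0)"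
      using partial_deriv_line[of h x 0 i] hd by (simp add: has_vector_derivative_def)
    hence "((\<lambda>s. (h (x + s *\<^sub>R axis i 1) - h x - s *\<^sub>R partial_deriv i h x) /\<^sub>R norm s) \<longlongrightarrow> 0) (at 0)"
      by (simp add: has_derivative_at_within[symmetric] has_derivative_def)
    moreover have "filterlim t (at 0) sequentially"
      using t0 t by (auto simp: filterlim_at less_imp_neq[symmetric])
    ultimately have "(\<lambda>k. (h (x + t k *\<^sub>R axis i 1) - h x - t k *\<^sub>R partial_deriv i h x) /\<^sub>R norm (t k)) \<longlonglongrightarrow> 0"
      by (rule filterlim_compose)
    moreover have "(h (x + t k *\<^sub>R axis i 1) - h x - t k *\<^sub>R partial_deriv i h x) /\<^sub>R norm (t k) = q k x - partial_deriv i h x" for k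
      using t(1)[of k] by (simp add: q_def scaleR_diff_right)
    ultimately show ?thesis by (simp add: LIM_zero_iff)
  qed
  have "(\<lambda>k. LINT x|lborel. q k x) \<longlonglongrightarrow> (LINT x|lborel. partial_deriv i h x)"
  proof (rule integral_dominated_convergence[where w = "\<lambda>x. B * indicator K' x"])
    show "integrable lborel (\<lambda>x. B * indicator K' x :: real)"
      using K' by (rule integrable_indicator_compact)
    show "partial_deriv i h \<in> borel_measurable lborel"
      using borel_measurable_continuous_onI[OF csmooth_continuous[OF csmooth_partial_deriv[OF K h]]] by simp
    show "q k \<in> borel_measurable lborel" for k
      using meas unfolding q_def by measurable
  qed (use q_lim q_bound in auto)
  moreover have "(LINT x|lborel. q k x) = 0" for k
  proof -
    have i1: "integrable lborel h" using K h by (rule csmooth_integrable)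
    have "integrable (distr lborel borel ((+) (t k *\<^sub>R axis i 1))) h"
      using i1 by (simp add: lborel_distr_plus)
    hence "integrable lborel (\<lambda>x. h (x + t k *\<^sub>R axis i 1))"
      by (subst (asm) integrable_distr_eq) (use meas in \<open>auto simp: add.commute\<close>)
    thus ?thesis using i1 integral_translate[OF meas] by (simp add: q_def)
  qed
  ultimately show ?thesis using LIMSEQ_unique[OF _ tendsto_const] by fastforce
qed

lemma integral_by_parts:
  fixes g h :: "real^'n::finite \<Rightarrow> complex"
  assumes K: "compact K" and S: "open S" "K \<subseteq> S" and g: "smooth_on S g" and h: "csmooth K h"
  shows "(LINT x|lborel. partial_deriv i g x * h x) = - (LINT x|lborel. g x * partial_deriv i h x)"
proof -
  note m = csmooth_mult[OF K S]
  have "partial_deriv i (\<lambda>x. g x * h x) x = partial_deriv i g x * h x + g x * partial_deriv i h x" for x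
  proof (cases "x \<in> K")
    case True
    thus ?thesis using S g h by (intro partial_deriv_mult) (auto simp: csmooth_def intro: smooth_on_differentiable)
  next
    case False
    thus ?thesis using h csmooth_partial_deriv[OF K h, of i] csmooth_partial_deriv[OF K m[OF g h], of i] by (simp add: csmooth_def)
  qed
  hence "0 = (LINT x|lborel. partial_deriv i g x * h x + g x * partial_deriv i h x)"
    using integral_partial_deriv_eq_0[OF K m[OF g h], of i] by simp
  also have "\<dots> = (LINT x|lborel. partial_deriv i g x * h x) + (LINT x|lborel. g x * partial_deriv i h x)"
    by (intro Bochner_Integration.integral_add csmooth_integrable[OF K] m g h smooth_on_partial_deriv csmooth_partial_deriv[OF K])
  finally show ?thesis by (simp add: eq_neg_iff_add_eq_0)
qed

section \<open>Plane waves\<close>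

text \<open>
  The plane wave \<open>e\<^sub>\<xi>(x)\<close> of the Fourier transform.
\<close>

definition wave :: "real^'n::finite \<Rightarrow> real^'n \<Rightarrow> complex" where
  "wave \<xi> x = exp (- \<i> * complex_of_real (\<xi> \<bullet> x))"

lemma norm_wave [simp]: "norm (wave \<xi> x) = 1"
  by (simp add: wave_def norm_exp_eq_Re)

lemma wave_has_derivative:
  "(wave \<xi> has_derivative (\<lambda>v. - \<i> * complex_of_real (\<xi> \<bullet> v) * wave \<xi> x)) (at x)"
proof -
  have "((\<lambda>x. - \<i> * complex_of_real (\<xi> \<bullet> x)) has_derivative (\<lambda>v. - \<i> * complex_of_real (\<xi> \<bullet> v))) (at x)"
    by (intro has_derivative_mult_right has_derivative_of_real has_derivative_inner_right has_derivative_ident)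
  from has_derivative_compose[OF this DERIV_exp[unfolded has_field_derivative_def]] show ?thesis
    by (simp add: wave_def[abs_def] mult_ac)
qed

lemma partial_deriv_wave: "partial_deriv i (\<lambda>x. c * wave \<xi> x) = (\<lambda>x. (- \<i> * complex_of_real (\<xi> $ i) * c) * wave \<xi> x)"
proof
  fix x
  have "((\<lambda>x. c * wave \<xi> x) has_derivative (\<lambda>v. c * (- \<i> * complex_of_real (\<xi> \<bullet> v) * wave \<xi> x))) (at x)"
    by (intro has_derivative_mult_right wave_has_derivative)
  from partial_deriv_eqI[OF this, of i]
  show "partial_deriv i (\<lambda>x. c * wave \<xi> x) x = (- \<i> * complex_of_real (\<xi> $ i) * c) * wave \<xi> x"
    by (simp add: wave_def inner_axis)
qed

lemma smooth_wave: "smooth_on S (wave \<xi>)"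
proof (rule smooth_onI[where Q = "\<lambda>f. \<exists>c. f = (\<lambda>x. c * wave \<xi> x)"])
  show "\<exists>c. wave \<xi> = (\<lambda>x. c * wave \<xi> x)" by (rule exI[of _ 1]) simp
  fix f :: "real^'a \<Rightarrow> complex" and i assume "\<exists>c. f = (\<lambda>x. c * wave \<xi> x)"
  then obtain c where f: "f = (\<lambda>x. c * wave \<xi> x)" by blast
  show "\<exists>c. partial_deriv i f = (\<lambda>x. c * wave \<xi> x)" unfolding f partial_deriv_wave by blast
  have "wave \<xi> differentiable (at x)" for x
    using wave_has_derivative by (rule differentiableI)
  thus "f differentiable_on S" unfolding f
    by (intro differentiable_at_imp_differentiable_on) (auto intro!: derivative_intros)
qed

lemma csmooth_wave: "compact K \<Longrightarrow> csmooth K h \<Longrightarrow> csmooth K (\<lambda>x. h x * wave \<xi> x)"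
  using csmooth_mult[of K UNIV "wave \<xi>" h] by (simp add: smooth_wave mult.commute)

lemma partial_deriv_times_wave:
  assumes "h differentiable (at x)"
  shows "partial_deriv i (\<lambda>x. h x * wave \<xi> x) x = (partial_deriv i h x - \<i> * complex_of_real (\<xi> $ i) * h x) * wave \<xi> x"
  using partial_deriv_mult[OF assms smooth_on_differentiable[OF smooth_wave open_UNIV], of i \<xi>]
    partial_deriv_wave[of i 1 \<xi>] by (simp add: algebra_simps)

lemma fourier_wave: "fourier v \<xi> = (LINT x|lborel. v x * wave \<xi> x)"
  by (simp add: fourier_def wave_def)

lemma fourier_partial_deriv:
  assumes "compact K" "csmooth K h"
  shows "fourier (partial_deriv i h) \<eta> = \<i> * complex_of_real (\<eta> $ i) * fourier h \<eta>"
proof -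
  have "(LINT x|lborel. wave \<eta> x * partial_deriv i h x) = - (LINT x|lborel. partial_deriv i (wave \<eta>) x * h x)"
    using integral_by_parts[OF assms(1) open_UNIV _ smooth_wave assms(2), of i \<eta>] by simp
  moreover have "partial_deriv i (wave \<eta>) x = - \<i> * complex_of_real (\<eta> $ i) * wave \<eta> x" for x
    using partial_deriv_wave[of i 1 \<eta>] by simp
  ultimately show ?thesis
    by (simp add: fourier_wave flip: integral_mult_right_zero) (simp add: mult_ac)
qed

lemma norm_fourier_le:
  assumes "compact K" "\<And>x. x \<notin> K \<Longrightarrow> h x = 0" "\<And>x. x \<in> K \<Longrightarrow> norm (h x) \<le> B" "0 \<le> B"
  shows "norm (fourier h \<eta>) \<le> measure lborel K * B"
  unfolding fourier_wave using assms by (intro compact_support_integral_bound) (auto simp: norm_mult)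

text \<open>
  Each derivative in direction \<open>i\<close> multiplies the Fourier transform by \<open>\<i> \<eta>\<^sub>i\<close>. Differentiating
  \<open>k\<close> times in the direction of the largest component of \<open>\<eta>\<close> is enough, because that component
  controls the norm up to the dimension.
\<close>

lemma fourier_decay:
  fixes h :: "real^'n::finite \<Rightarrow> complex"
  assumes K: "compact K" and h: "csmooth K h" and "0 \<le> B"
    and B: "\<And>is x. length is \<le> k \<Longrightarrow> x \<in> K \<Longrightarrow> norm (pderivs is h x) \<le> B"
  shows "(1 + norm \<eta>) ^ k * norm (fourier h \<eta>) \<le> (1 + real CARD('n)) ^ k * (measure lborel K * B)"
proof -
  define \<mu> where "\<mu> = Max (range (\<lambda>i. \<bar>\<eta> $ i\<bar>))"
  have "\<mu> \<in> range (\<lambda>i. \<bar>\<eta> $ i\<bar>)" unfolding \<mu>_def by (rule Max_in) auto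
  then obtain i where i: "\<mu> = \<bar>\<eta> $ i\<bar>" by blast
  have le: "\<bar>\<eta> $ j\<bar> \<le> \<mu>" for j unfolding \<mu>_def by (rule Max_ge) auto
  have "norm \<eta> \<le> (\<Sum>j\<in>UNIV. \<bar>\<eta> $ j\<bar>)" by (rule norm_le_l1_cart)
  also have "\<dots> \<le> (\<Sum>j\<in>(UNIV::'n set). \<mu>)" by (rule sum_mono) (rule le)
  finally have n: "norm \<eta> \<le> real CARD('n) * \<mu>" by simp
  have *: "norm (fourier (pderivs (replicate l i) h) \<eta>) = \<mu> ^ l * norm (fourier h \<eta>)" for l
  proof (induction l)
    case (Suc l)
    thus ?case using fourier_partial_deriv[OF K csmooth_pderivs[OF K h], of i "replicate l i" \<eta>] i
      by (simp add: norm_mult)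
  qed simp
  have bound: "\<mu> ^ l * norm (fourier h \<eta>) \<le> measure lborel K * B" if "l \<le> k" for l
    using norm_fourier_le[OF K _ _ \<open>0 \<le> B\<close>, of "pderivs (replicate l i) h" \<eta>] B[of "replicate l i"] csmooth_pderivs[OF K h, of "replicate l i"] that
    unfolding *[symmetric] csmooth_def by auto
  have M: "0 \<le> measure lborel K * B" using \<open>0 \<le> B\<close> by simp
  show ?thesis
  proof (cases "\<mu> \<le> 1")
    case True
    hence "real CARD('n) * \<mu> \<le> real CARD('n) * 1" by (intro mult_left_mono) auto
    hence "norm \<eta> \<le> real CARD('n)" using n by linarith
    hence "(1 + norm \<eta>) ^ k \<le> (1 + real CARD('n)) ^ k"
      by (intro power_mono) auto
    thus ?thesis using bound[of 0] by (intro mult_mono) auto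
  next
    case False
    hence "1 + norm \<eta> \<le> (1 + real CARD('n)) * \<mu>" using n by (simp add: algebra_simps)
    hence "(1 + norm \<eta>) ^ k \<le> ((1 + real CARD('n)) * \<mu>) ^ k" by (intro power_mono) auto
    hence "(1 + norm \<eta>) ^ k * norm (fourier h \<eta>) \<le> ((1 + real CARD('n)) * \<mu>) ^ k * norm (fourier h \<eta>)"
      by (rule mult_right_mono) simp
    also have "\<dots> = (1 + real CARD('n)) ^ k * (\<mu> ^ k * norm (fourier h \<eta>))"
      by (simp add: power_mult_distrib mult_ac)
    also have "\<dots> \<le> (1 + real CARD('n)) ^ k * (measure lborel K * B)"
      by (intro mult_left_mono bound) auto
    finally show ?thesis .
  qed
qed

section \<open>Fourier inversion\<close>

text \<open>
  The Lebesgue measure of the space is the product of the one-dimensional ones, transported along the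
  coordinates.
\<close>

lemma prod_integral_vec:
  fixes f :: "'n::finite \<Rightarrow> real \<Rightarrow> complex"
  assumes "\<And>i. integrable lborel (f i)"
  shows "integrable lborel (\<lambda>x::real^'n. \<Prod>i\<in>UNIV. f i (x $ i))" (is ?I)
    and "(LINT x|lborel. (\<Prod>i\<in>UNIV. f i ((x::real^'n) $ i))) = (\<Prod>i\<in>UNIV. integral\<^sup>L lborel (f i))" (is ?E)
proof -
  interpret product_sigma_finite "\<lambda>_::real^'n. lborel :: real measure" ..
  define c where "c = (\<lambda>b::real^'n. THE i. b = axis i 1)"
  have c: "c (axis i 1) = i" for i unfolding c_def by (rule the_equality) (auto simp: axis_eq_axis)
  have bij: "bij_betw (\<lambda>i. axis i (1::real)) (UNIV::'n set) Basis"
    by (auto simp: bij_betw_def inj_on_def axis_eq_axis Basis_vec_def)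
  define T where "T = (\<lambda>y. \<Sum>b\<in>Basis. y b *\<^sub>R (b::real^'n))"
  have T: "T \<in> measurable (\<Pi>\<^sub>M b\<in>Basis. lborel) borel" unfolding T_def by measurable
  have lb: "lborel = distr (\<Pi>\<^sub>M b\<in>Basis. lborel) borel T" unfolding T_def by (rule lborel_eq)
  have Tn: "T y $ i = y (axis i 1)" for y i
  proof -
    have "T y $ i = T y \<bullet> axis i 1" by (simp add: inner_axis)
    also have "\<dots> = y (axis i 1)"
      unfolding T_def inner_sum_left
      by (subst sum.remove[of _ "axis i 1"]) (auto simp: inner_not_same_Basis intro!: sum.neutral)
    finally show ?thesis .
  qed
  have eq: "(\<Prod>i\<in>UNIV. f i (T y $ i)) = (\<Prod>b\<in>Basis. f (c b) (y b))" for y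
    unfolding Tn by (rule prod.reindex_bij_betw[OF bij, of "\<lambda>b. f (c b) (y b)", unfolded c])
  have meas: "(\<lambda>x::real^'n. \<Prod>i\<in>UNIV. f i (x $ i)) \<in> borel_measurable borel"
  proof -
    have f: "f i \<in> borel_measurable borel" for i
      using borel_measurable_integrable[OF assms[of i]] by simp
    have "(\<lambda>x::real^'n. x $ i) \<in> borel_measurable borel" for i
      by (rule borel_measurable_continuous_onI) (intro continuous_intros)
    from measurable_compose[OF this f] show ?thesis by (intro borel_measurable_prod)
  qed
  have int: "integrable (\<Pi>\<^sub>M b\<in>Basis. lborel) (\<lambda>y. \<Prod>b\<in>(Basis::(real^'n) set). f (c b) (y b))"
    by (rule product_integrable_prod) (use assms in auto)
  show ?I by (subst lb) (simp add: integrable_distr_eq[OF T meas] eq int)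
  have "(LINT x|lborel. (\<Prod>i\<in>UNIV. f i ((x::real^'n) $ i))) = (\<Prod>b\<in>(Basis::(real^'n) set). integral\<^sup>L lborel (f (c b)))"
    by (subst lb) (simp add: integral_distr[OF T meas] eq product_integral_prod[of Basis "\<lambda>b. f (c b)"] assms)
  also have "\<dots> = (\<Prod>i\<in>UNIV. integral\<^sup>L lborel (f i))"
    by (rule prod.reindex_bij_betw[OF bij, of "\<lambda>b. integral\<^sup>L lborel (f (c b))", unfolded c, symmetric])
  finally show ?E .
qed

definition gauss :: "real^'n::finite \<Rightarrow> real" where
  "gauss x = exp (- (norm x)\<^sup>2 / 2)"

lemma gauss_bounds: "0 \<le> gauss x" "gauss x \<le> 1"
  by (simp_all add: gauss_def)

lemma continuous_gauss: "continuous_on S gauss"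
  unfolding gauss_def by (intro continuous_intros) auto

text \<open>
  The characteristic function of the standard normal distribution, without the normalising factor.
\<close>

lemma gauss_fourier_1:
  fixes z :: real
  shows "integrable lborel (\<lambda>t. complex_of_real (exp (- t\<^sup>2 / 2)) * exp (\<i> * complex_of_real (z * t)))"
    and "(LINT t|lborel. complex_of_real (exp (- t\<^sup>2 / 2)) * exp (\<i> * complex_of_real (z * t)))
      = complex_of_real (sqrt (2 * pi)) * complex_of_real (exp (- z\<^sup>2 / 2))"
proof -
  have e: "complex_of_real (exp (- t\<^sup>2 / 2)) * exp (\<i> * complex_of_real (z * t))
      = complex_of_real (sqrt (2 * pi)) * (std_normal_density t *\<^sub>R exp (\<i> * complex_of_real (z * t)))" for t
    unfolding std_normal_density_def by (simp add: scaleR_conv_of_real exp_of_real)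
  have "integrable lborel (\<lambda>t. std_normal_density t *\<^sub>R exp (\<i> * complex_of_real (z * t)))"
    by (rule Bochner_Integration.integrable_bound[OF integrable_normal_density[of 1 0]])
       (auto simp: norm_exp_eq_Re)
  thus "integrable lborel (\<lambda>t. complex_of_real (exp (- t\<^sup>2 / 2)) * exp (\<i> * complex_of_real (z * t)))"
    unfolding e by (rule integrable_mult_right)
  have "char std_normal_distribution z = (LINT t|lborel. std_normal_density t *\<^sub>R exp (\<i> * complex_of_real (z * t)))"
    unfolding char_def by (subst integral_density) (auto simp: normal_density_nonneg)
  thus "(LINT t|lborel. complex_of_real (exp (- t\<^sup>2 / 2)) * exp (\<i> * complex_of_real (z * t)))
      = complex_of_real (sqrt (2 * pi)) * complex_of_real (exp (- z\<^sup>2 / 2))"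
    unfolding e integral_mult_right_zero char_std_normal_distribution by (rule arg_cong[OF sym])
qed

text \<open>
  The total mass \<open>(2 \<pi>)\<^bsup>n/2\<^esup>\<close> of the Gaussian.
\<close>

definition gauss_const :: "'n::finite itself \<Rightarrow> complex" where
  "gauss_const _ = complex_of_real (sqrt (2 * pi)) ^ CARD('n)"

lemma gauss_const_nz: "gauss_const TYPE('n::finite) \<noteq> 0"
  by (simp add: gauss_const_def)

lemma gauss_fourier:
  fixes z :: "real^'n::finite"
  shows "integrable lborel (\<lambda>x. complex_of_real (gauss x) * wave z x)"
    and "fourier (\<lambda>x. complex_of_real (gauss x)) z = gauss_const TYPE('n) * complex_of_real (gauss z)"
proof -
  define f where "f = (\<lambda>i t. complex_of_real (exp (- t\<^sup>2 / 2)) * exp (\<i> * complex_of_real ((- z $ i) * t)))"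
  have n2: "(norm x)\<^sup>2 = (\<Sum>i\<in>UNIV. (x $ i)\<^sup>2)" for x :: "real^'n"
    unfolding norm_vec_def L2_set_def by (simp add: sum_nonneg)
  have g: "complex_of_real (gauss x) = (\<Prod>i\<in>UNIV. complex_of_real (exp (- (x $ i)\<^sup>2 / 2)))" for x :: "real^'n"
    by (simp add: gauss_def n2 exp_sum sum_divide_distrib flip: sum_negf of_real_prod)
  have eq: "complex_of_real (gauss x) * wave z x = (\<Prod>i\<in>UNIV. f i (x $ i))" for x
    unfolding f_def prod.distrib g wave_def
    by (simp add: inner_vec_def exp_sum sum_distrib_left flip: sum_negf)
  have i: "integrable lborel (f i)" for i unfolding f_def by (rule gauss_fourier_1)
  show "integrable lborel (\<lambda>x. complex_of_real (gauss x) * wave z x)"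
    unfolding eq by (rule prod_integral_vec[OF i])
  show "fourier (\<lambda>x. complex_of_real (gauss x)) z = gauss_const TYPE('n) * complex_of_real (gauss z)"
    unfolding fourier_wave eq prod_integral_vec(2)[OF i]
    unfolding f_def gauss_fourier_1(2) prod.distrib g gauss_const_def by simp
qed

lemma gauss_integrable: "integrable lborel (\<lambda>x::real^'n::finite. gauss x)"
proof -
  have "integrable lborel (\<lambda>x::real^'n. norm (complex_of_real (gauss x) * wave 0 x))"
    by (rule integrable_norm[OF gauss_fourier(1)])
  thus ?thesis by (simp add: norm_mult gauss_bounds)
qed

lemma integral_affine:
  fixes f :: "real^'n::finite \<Rightarrow> complex"
  assumes [measurable]: "f \<in> borel_measurable borel" and r: "r > 0"
  shows "(LINT x|lborel. f x) = of_real (r ^ CARD('n)) * (LINT x|lborel. f (t + r *\<^sub>R x))"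
proof -
  have "r \<noteq> 0" using r by simp
  have "(LINT x|lborel. f x) = (LINT x|density (distr lborel borel (\<lambda>x::real^'n. t + r *\<^sub>R x)) (\<lambda>_. \<bar>r\<bar>^DIM(real^'n)). f x)"
    by (subst lborel_affine[OF \<open>r \<noteq> 0\<close>, of t]) simp
  also have "\<dots> = (LINT x|distr lborel borel (\<lambda>x::real^'n. t + r *\<^sub>R x). (r ^ CARD('n)) *\<^sub>R f x)"
    by (subst integral_density) (use r in auto)
  also have "\<dots> = (LINT x|lborel. (r ^ CARD('n)) *\<^sub>R f (t + r *\<^sub>R x))"
    by (subst integral_distr) auto
  also have "\<dots> = of_real (r ^ CARD('n)) * (LINT x|lborel. f (t + r *\<^sub>R x))"
    by (simp add: scaleR_conv_of_real)
  finally show ?thesis .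
qed

text \<open>
  This justifies the two exchanges of integrals in the inversion formula and in the convolution
  formula, where \<open>k\<close> is a plane wave.
\<close>

lemma integrable_pair_bounded:
  fixes f g :: "real^'n::finite \<Rightarrow> complex" and k :: "real^'n \<Rightarrow> real^'n \<Rightarrow> complex"
  assumes f: "integrable lborel f" and g: "integrable lborel g"
    and k: "continuous_on UNIV (\<lambda>(x, y). k x y)" "\<And>x y. norm (k x y) \<le> 1"
  shows "integrable (lborel \<Otimes>\<^sub>M lborel) (\<lambda>(x, y). f x * g y * k x y)"
proof -
  have [measurable]: "(\<lambda>(x, y). k x y) \<in> borel_measurable (borel \<Otimes>\<^sub>M borel)"
    using borel_measurable_continuous_onI[OF k(1)] by (simp add: borel_prod)
  have [measurable]: "f \<in> borel_measurable borel" "g \<in> borel_measurable borel"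
    using f g by (auto simp: borel_measurable_integrable)
  have m: "(\<lambda>(x, y). f x * g y) \<in> borel_measurable (lborel \<Otimes>\<^sub>M lborel)" by measurable
  have "integrable (lborel \<Otimes>\<^sub>M lborel) (\<lambda>(x, y). f x * g y)"
  proof (rule lborel_pair.Fubini_integrable)
    show "(\<lambda>(x, y). f x * g y) \<in> borel_measurable (lborel \<Otimes>\<^sub>M lborel)" by (rule m)
    show "integrable lborel (\<lambda>x. LINT y|lborel. norm (case (x, y) of (x, y) \<Rightarrow> f x * g y))"
      using f by (simp add: norm_mult)
    show "AE x in lborel. integrable lborel (\<lambda>y. case (x, y) of (x, y) \<Rightarrow> f x * g y)"
      using g by simp
  qed
  thus ?thesis
  proof (rule Bochner_Integration.integrable_bound)
    have "(\<lambda>(x, y). f x * g y * k x y) = (\<lambda>p. (\<lambda>(x, y). f x * g y) p * (\<lambda>(x, y). k x y) p)" by auto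
    thus "(\<lambda>(x, y). f x * g y * k x y) \<in> borel_measurable (lborel \<Otimes>\<^sub>M lborel)"
      using m by (auto intro!: borel_measurable_times)
    show "AE p in lborel \<Otimes>\<^sub>M lborel. norm (case p of (x, y) \<Rightarrow> f x * g y * k x y) \<le> norm (case p of (x, y) \<Rightarrow> f x * g y)"
      using k(2) by (auto simp: norm_mult mult_left_le)
  qed
qed

lemma wave_continuous: "continuous_on UNIV (\<lambda>(x, y). wave x y)"
  unfolding wave_def case_prod_unfold by (intro continuous_intros)

lemma wave_facts: "wave (- \<eta>) x * wave \<eta> y = wave \<eta> (y - x)" "wave \<xi> x * wave (- \<eta>) x = wave (\<xi> - \<eta>) x"
   "wave (r *\<^sub>R \<eta>) x = wave \<eta> (r *\<^sub>R x)" "wave x y = wave y x"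
  by (simp_all add: wave_def inner_diff_left inner_diff_right inner_commute algebra_simps flip: exp_add)

text \<open>
  An integrable function comparable with a power of \<open>1 + |\<eta>|\<close> whose integrability reduces to
  dimension one.
\<close>

definition weight :: "real^'n::finite \<Rightarrow> real" where
  "weight \<eta> = (\<Prod>i\<in>UNIV. inverse (1 + (\<eta> $ i)\<^sup>2))"

lemma weight_pos: "0 < weight \<eta>"
  unfolding weight_def by (intro prod_pos) (auto simp: add_pos_nonneg)

lemma weight_integrable: "integrable lborel (weight :: real^'n::finite \<Rightarrow> real)"
proof -
  have "integrable lborel (\<lambda>t::real. inverse (1 + t\<^sup>2))"
    using integrable_inverse_1_plus_square by (simp add: set_integrable_def einterval_eq)
  hence "integrable lborel (\<lambda>t. complex_of_real (inverse (1 + t\<^sup>2)))" by (rule integrable_of_real)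
  from integrable_norm[OF prod_integral_vec(1)[OF this]]
  have "integrable lborel (\<lambda>x::real^'n. norm (\<Prod>i\<in>UNIV. complex_of_real (inverse (1 + (x $ i)\<^sup>2))))" .
  moreover have "norm (\<Prod>i\<in>UNIV. complex_of_real (inverse (1 + (x $ i)\<^sup>2))) = weight x" for x :: "real^'n"
    using weight_pos[of x] unfolding of_real_prod[symmetric] weight_def norm_of_real by simp
  ultimately show ?thesis by simp
qed

lemma weight_lower: "1 \<le> weight (\<eta>::real^'n::finite) * (1 + norm \<eta>) ^ (2 * CARD('n))"
proof -
  have "(\<Prod>i\<in>UNIV. 1 + (\<eta> $ i)\<^sup>2) \<le> (\<Prod>i\<in>(UNIV::'n set). (1 + norm \<eta>)\<^sup>2)"
  proof (intro prod_mono conjI)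
    fix i
    have "(\<eta> $ i)\<^sup>2 \<le> (norm \<eta>)\<^sup>2" using component_le_norm_cart[of \<eta> i]
      by (metis abs_norm_cancel power2_abs power_mono abs_ge_zero)
    moreover have "(1 + norm \<eta>)\<^sup>2 = 1 + 2 * norm \<eta> + (norm \<eta>)\<^sup>2" by (simp add: power2_sum)
    ultimately show "1 + (\<eta> $ i)\<^sup>2 \<le> (1 + norm \<eta>)\<^sup>2" using norm_ge_zero[of \<eta>] by linarith
  qed (auto simp: add_nonneg_nonneg)
  also have "\<dots> = (1 + norm \<eta>) ^ (2 * CARD('n))" by (simp add: power_mult)
  finally have "inverse (weight \<eta>) \<le> (1 + norm \<eta>) ^ (2 * CARD('n))"
    by (simp add: weight_def prod_inversef flip: prod_inversef)
  thus ?thesis using weight_pos[of \<eta>] by (simp add: field_simps)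
qed

lemma integrable_affine:
  fixes f :: "real^'n::finite \<Rightarrow> complex"
  assumes "integrable lborel f" and r: "r > 0"
  shows "integrable lborel (\<lambda>x. f (t + r *\<^sub>R x))"
proof -
  have [measurable]: "f \<in> borel_measurable borel"
    using assms by (auto simp: borel_measurable_integrable)
  have "r \<noteq> 0" using r by simp
  have "integrable (density (distr lborel borel (\<lambda>x::real^'n. t + r *\<^sub>R x)) (\<lambda>_. \<bar>r\<bar>^DIM(real^'n))) f"
    using assms(1) by (subst (asm) lborel_affine[OF \<open>r \<noteq> 0\<close>, of t]) simp
  hence "integrable (distr lborel borel (\<lambda>x::real^'n. t + r *\<^sub>R x)) (\<lambda>x. (r ^ CARD('n)) *\<^sub>R f x)"
    by (subst (asm) integrable_density) (use r in auto)
  hence "integrable lborel (\<lambda>x. (r ^ CARD('n)) *\<^sub>R f (t + r *\<^sub>R x))"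
    by (subst (asm) integrable_distr_eq) auto
  hence "integrable lborel (\<lambda>x. (1 / r ^ CARD('n)) *\<^sub>R (r ^ CARD('n)) *\<^sub>R f (t + r *\<^sub>R x))"
    by (rule integrable_scaleR_right)
  thus ?thesis using \<open>r \<noteq> 0\<close> by simp
qed

lemma gauss_measurable [measurable]: "gauss \<in> borel_measurable borel"
  by (rule borel_measurable_continuous_onI[OF continuous_gauss])

lemma wave_measurable [measurable]: "wave \<xi> \<in> borel_measurable borel"
  by (rule borel_measurable_continuous_onI[OF smooth_on_continuous_on[OF smooth_wave]])

text \<open>
  Substitution of \<open>r \<eta>\<close> in the Fourier transform of the Gaussian.
\<close>

lemma scaled_gauss_fourier:
  fixes z :: "real^'n::finite"
  assumes "r > 0"
  shows "(LINT \<eta>|lborel. complex_of_real (gauss (r *\<^sub>R \<eta>)) * wave \<eta> z)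
    = gauss_const TYPE('n) * complex_of_real (gauss (z /\<^sub>R r)) / complex_of_real (r ^ CARD('n))"
proof -
  have w: "wave (z /\<^sub>R r) (r *\<^sub>R \<eta>) = wave \<eta> z" for \<eta>
  proof -
    have "(z /\<^sub>R r) \<bullet> (r *\<^sub>R \<eta>) = \<eta> \<bullet> z" using assms by (simp add: inner_commute[of z])
    thus ?thesis by (simp only: wave_def)
  qed
  have "gauss_const TYPE('n) * complex_of_real (gauss (z /\<^sub>R r))
    = (LINT \<eta>|lborel. complex_of_real (gauss \<eta>) * wave (z /\<^sub>R r) \<eta>)"
    unfolding gauss_fourier(2)[symmetric] fourier_wave ..
  also have "\<dots> = complex_of_real (r ^ CARD('n)) * (LINT \<eta>|lborel. complex_of_real (gauss (r *\<^sub>R \<eta>)) * wave \<eta> z)"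
    by (subst integral_affine[OF _ assms, of _ 0]) (simp_all add: w)
  finally show ?thesis using assms by (simp add: field_simps)
qed

lemma csmooth_derivs_bounded:
  fixes h :: "real^'n::finite \<Rightarrow> complex"
  assumes "compact K" "csmooth K h"
  obtains B where "0 \<le> B" "\<And>is x. length is \<le> k \<Longrightarrow> norm (pderivs is h x) \<le> B"
proof -
  have "\<exists>B. 0 \<le> B \<and> (\<forall>x. norm (pderivs is h x) \<le> B)" for "is"
    using csmooth_bounded[OF assms(1) csmooth_pderivs[OF assms]] by metis
  then obtain b where b: "\<And>is. 0 \<le> b is" "\<And>is x. norm (pderivs is h x) \<le> b is" by metis
  define A where "A = {is :: 'n list. length is \<le> k}"
  have A: "finite A" unfolding A_def using finite_lists_length_le[of "UNIV :: 'n set" k] by simp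
  show ?thesis
  proof (rule that[of "sum b A"])
    show "0 \<le> sum b A" by (intro sum_nonneg b)
    fix "is" x assume "length (is :: 'n list) \<le> k"
    hence "b is \<le> sum b A" by (intro member_le_sum A b) (simp add: A_def)
    thus "norm (pderivs is h x) \<le> sum b A" using b(2)[of "is" x] by simp
  qed
qed

lemma fourier_measurable:
  assumes "integrable lborel h"
  shows "fourier h \<in> borel_measurable borel"
proof -
  have [measurable]: "h \<in> borel_measurable borel" using assms by (simp add: borel_measurable_integrable)
  have [measurable]: "(\<lambda>(x, y). wave x y) \<in> borel_measurable (borel \<Otimes>\<^sub>M borel)"
    using borel_measurable_continuous_onI[OF wave_continuous] by (simp add: borel_prod)
  have "(\<lambda>\<eta>. LINT x|lborel. h x * wave \<eta> x) \<in> borel_measurable borel"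
    by (rule lborel.borel_measurable_lebesgue_integral) measurable
  thus ?thesis by (simp add: fourier_wave[abs_def])
qed

lemma integrable_weight_bound:
  fixes f :: "real^'n::finite \<Rightarrow> complex"
  assumes "f \<in> borel_measurable borel" "\<And>\<eta>. norm (f \<eta>) \<le> C * weight \<eta>"
  shows "integrable lborel f"
    and "norm (integral\<^sup>L lborel f) \<le> C * integral\<^sup>L lborel (weight :: real^'n \<Rightarrow> real)"
proof -
  show i: "integrable lborel f"
  proof (rule Bochner_Integration.integrable_bound[OF integrable_mult_right[OF weight_integrable, of C]])
    show "AE x in lborel. norm (f x) \<le> norm (C * weight x)"
      using assms(2) by (auto intro!: AE_I2 order.trans[OF assms(2)])
  qed (use assms in auto)
  have "norm (integral\<^sup>L lborel f) \<le> (LINT \<eta>|lborel. norm (f \<eta>))" by (rule integral_norm_bound)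
  also have "\<dots> \<le> (LINT \<eta>|lborel. C * weight (\<eta>::real^'n))"
    by (rule integral_mono[OF integrable_norm[OF i] integrable_mult_right[OF weight_integrable]]) (rule assms(2))
  finally show "norm (integral\<^sup>L lborel f) \<le> C * integral\<^sup>L lborel (weight :: real^'n \<Rightarrow> real)" by simp
qed

lemma fourier_integrable:
  fixes h :: "real^'n::finite \<Rightarrow> complex"
  assumes K: "compact K" and h: "csmooth K h"
  shows "integrable lborel (fourier h)"
proof -
  define k where "k = 2 * CARD('n)"
  obtain B where B: "0 \<le> B" "\<And>is x. length is \<le> k \<Longrightarrow> norm (pderivs is h x) \<le> B"
    using csmooth_derivs_bounded[OF K h, of k] by metis
  define C where "C = (1 + real CARD('n)) ^ k * (measure lborel K * B)"
  have "norm (fourier h \<eta>) \<le> C * weight \<eta>" for \<eta>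
  proof -
    have "norm (fourier h \<eta>) * 1 \<le> norm (fourier h \<eta>) * (weight \<eta> * (1 + norm \<eta>) ^ k)"
      unfolding k_def by (intro mult_left_mono weight_lower) auto
    also have "\<dots> = weight \<eta> * ((1 + norm \<eta>) ^ k * norm (fourier h \<eta>))" by (simp add: mult_ac)
    also have "\<dots> \<le> weight \<eta> * C" unfolding C_def
      by (intro mult_left_mono fourier_decay K h B) (auto intro: less_imp_le weight_pos)
    finally show ?thesis by (simp add: mult_ac)
  qed
  thus ?thesis using fourier_measurable[OF csmooth_integrable[OF K h]] by (intro integrable_weight_bound(1)) auto
qed

text \<open>
  Insert the factor \<open>gauss (t \<eta>)\<close> into the integral. By Fubini's theorem the result is the mean of \<open>h\<close>
  with respect to a Gaussian of width \<open>t\<close> centred at \<open>x\<close>, up to constants. As \<open>t\<close> tends to 0, both sides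
  converge by dominated convergence.
\<close>

theorem fourier_inversion:
  fixes h :: "real^'n::finite \<Rightarrow> complex"
  assumes K: "compact K" and h: "csmooth K h"
  shows "(LINT \<eta>|lborel. fourier h \<eta> * wave (- \<eta>) x) = (gauss_const TYPE('n))\<^sup>2 * h x"
proof -
  define t where "t = (\<lambda>k::nat. 1 / real (Suc k))"
  have t: "t k > 0" for k by (auto simp: t_def)
  have t0: "t \<longlonglongrightarrow> 0" unfolding t_def by (rule LIMSEQ_Suc[OF lim_1_over_n])
  have hi: "integrable lborel h" using K h by (rule csmooth_integrable)
  have [measurable]: "h \<in> borel_measurable borel" using hi by (simp add: borel_measurable_integrable)
  note fi = fourier_integrable[OF K h]
  have [measurable]: "fourier h \<in> borel_measurable borel" using fi by (simp add: borel_measurable_integrable)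
  have [measurable]: "(\<lambda>\<eta>. wave (- \<eta>) x) \<in> borel_measurable borel"
    by (simp add: wave_def) 
  obtain B where B: "0 \<le> B" "\<And>x. norm (h x) \<le> B" using csmooth_bounded[OF K h] by blast
  have eq: "(LINT \<eta>|lborel. fourier h \<eta> * wave (- \<eta>) x * complex_of_real (gauss (t k *\<^sub>R \<eta>)))
      = gauss_const TYPE('n) * (LINT w|lborel. h (x + t k *\<^sub>R w) * complex_of_real (gauss w))" for k
  proof -
    have gi: "integrable lborel (\<lambda>\<eta>::real^'n. complex_of_real (gauss (t k *\<^sub>R \<eta>)))"
      using integrable_affine[OF integrable_of_real[OF gauss_integrable] t, of 0 k] by simp
    have "continuous_on UNIV (\<lambda>(\<eta>, y). wave \<eta> (y - x))"
      unfolding wave_def case_prod_unfold by (intro continuous_intros)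
    from integrable_pair_bounded[OF gi hi this]
    have F: "integrable (lborel \<Otimes>\<^sub>M lborel) (\<lambda>(\<eta>, y). complex_of_real (gauss (t k *\<^sub>R \<eta>)) * h y * wave \<eta> (y - x))"
      by simp
    have "(LINT \<eta>|lborel. fourier h \<eta> * wave (- \<eta>) x * complex_of_real (gauss (t k *\<^sub>R \<eta>)))
      = (LINT \<eta>|lborel. LINT y|lborel. complex_of_real (gauss (t k *\<^sub>R \<eta>)) * h y * wave \<eta> (y - x))"
      unfolding fourier_wave integral_mult_left_zero[symmetric]
      by (intro Bochner_Integration.integral_cong refl) (simp add: wave_facts(1)[symmetric] mult_ac)
    also have "\<dots> = (LINT y|lborel. LINT \<eta>|lborel. complex_of_real (gauss (t k *\<^sub>R \<eta>)) * h y * wave \<eta> (y - x))"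
      by (rule lborel_pair.Fubini_integral[OF F, symmetric])
    also have "\<dots> = (LINT y|lborel. h y * (LINT \<eta>|lborel. complex_of_real (gauss (t k *\<^sub>R \<eta>)) * wave \<eta> (y - x)))"
      unfolding integral_mult_right_zero[symmetric]
      by (intro Bochner_Integration.integral_cong refl) (simp add: mult_ac)
    also have "\<dots> = (LINT y|lborel. h y * (gauss_const TYPE('n) * complex_of_real (gauss ((y - x) /\<^sub>R t k)) / complex_of_real (t k ^ CARD('n))))"
      by (simp only: scaled_gauss_fourier[OF t])
    also have "\<dots> = complex_of_real (t k ^ CARD('n)) * (LINT w|lborel. h (x + t k *\<^sub>R w) * (gauss_const TYPE('n) * complex_of_real (gauss w) / complex_of_real (t k ^ CARD('n))))"
      by (subst integral_affine[OF _ t, of _ k x]) (use t[of k] in simp_all)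
    also have "\<dots> = gauss_const TYPE('n) * (LINT w|lborel. h (x + t k *\<^sub>R w) * complex_of_real (gauss w))"
      unfolding integral_mult_right_zero[symmetric]
      by (intro Bochner_Integration.integral_cong refl) (use t[of k] in \<open>simp add: field_simps\<close>)
    finally show ?thesis .
  qed
  have "(\<lambda>k. LINT \<eta>|lborel. fourier h \<eta> * wave (- \<eta>) x * complex_of_real (gauss (t k *\<^sub>R \<eta>)))
      \<longlonglongrightarrow> (LINT \<eta>|lborel. fourier h \<eta> * wave (- \<eta>) x)"
  proof (rule integral_dominated_convergence[where w = "\<lambda>\<eta>. norm (fourier h \<eta>)"])
    show "integrable lborel (\<lambda>\<eta>. norm (fourier h \<eta>))" using fi by (rule integrable_norm)
    have "(\<lambda>k. gauss (t k *\<^sub>R \<eta>)) \<longlonglongrightarrow> gauss (0 *\<^sub>R \<eta>)" for \<eta> :: "real^'n"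
      using continuous_gauss[of UNIV]
      by (intro isCont_tendsto_compose[of _ gauss] tendsto_scaleR t0 tendsto_const) (auto simp: continuous_on_eq_continuous_at)
    hence "(\<lambda>k. fourier h \<eta> * wave (- \<eta>) x * complex_of_real (gauss (t k *\<^sub>R \<eta>)))
        \<longlonglongrightarrow> fourier h \<eta> * wave (- \<eta>) x * complex_of_real 1" for \<eta>
      by (intro tendsto_mult tendsto_const tendsto_of_real) (simp add: gauss_def)
    thus "AE \<eta> in lborel. (\<lambda>k. fourier h \<eta> * wave (- \<eta>) x * complex_of_real (gauss (t k *\<^sub>R \<eta>)))
        \<longlonglongrightarrow> fourier h \<eta> * wave (- \<eta>) x" by simp
  qed (auto simp: norm_mult gauss_bounds mult_left_le)
  moreover have "(\<lambda>k. LINT w|lborel. h (x + t k *\<^sub>R w) * complex_of_real (gauss w))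
      \<longlonglongrightarrow> (LINT w|lborel. h x * complex_of_real (gauss (w::real^'n)))"
  proof (rule integral_dominated_convergence[where w = "\<lambda>w. B * gauss w"])
    show "integrable lborel (\<lambda>w::real^'n. B * gauss w)" by (intro integrable_mult_right gauss_integrable)
    have "(\<lambda>k. h (x + t k *\<^sub>R w)) \<longlonglongrightarrow> h (x + 0 *\<^sub>R w)" for w
      using csmooth_continuous[OF h]
      by (intro isCont_tendsto_compose[of _ h] tendsto_add tendsto_scaleR t0 tendsto_const) (auto simp: continuous_on_eq_continuous_at)
    thus "AE w in lborel. (\<lambda>k. h (x + t k *\<^sub>R w) * complex_of_real (gauss w))
        \<longlonglongrightarrow> h x * complex_of_real (gauss w)"
      by (intro AE_I2 tendsto_mult tendsto_const) simp
    show "AE w in lborel. norm (h (x + t k *\<^sub>R w) * complex_of_real (gauss w)) \<le> B * gauss w" for k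
      using B by (auto simp: norm_mult gauss_bounds intro!: mult_right_mono AE_I2)
  qed auto
  hence "(\<lambda>k. gauss_const TYPE('n) * (LINT w|lborel. h (x + t k *\<^sub>R w) * complex_of_real (gauss w)))
      \<longlonglongrightarrow> gauss_const TYPE('n) * (LINT w|lborel. h x * complex_of_real (gauss (w::real^'n)))"
    by (intro tendsto_mult tendsto_const)
  ultimately have "(LINT \<eta>|lborel. fourier h \<eta> * wave (- \<eta>) x) = gauss_const TYPE('n) * (LINT w|lborel. h x * complex_of_real (gauss (w::real^'n)))"
    unfolding eq by (rule LIMSEQ_unique)
  moreover have "(LINT w|lborel. complex_of_real (gauss (w::real^'n))) = gauss_const TYPE('n)"
    using gauss_fourier(2)[of "0::real^'n"] by (simp add: fourier_wave wave_def gauss_def)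
  ultimately show ?thesis by (simp add: power2_eq_square)
qed

text \<open>
  The convolution theorem for a smooth factor \<open>h\<close>: replace \<open>h\<close> by its inverse Fourier integral and
  exchange the integrals.
\<close>

theorem fourier_mult:
  fixes g h :: "real^'n::finite \<Rightarrow> complex"
  assumes K: "compact K" and h: "csmooth K h" and g: "integrable lborel g"
  shows "(gauss_const TYPE('n))\<^sup>2 * fourier (\<lambda>x. g x * h x) \<xi> = (LINT \<eta>|lborel. fourier h \<eta> * fourier g (\<xi> - \<eta>))"
proof -
  have "continuous_on UNIV (\<lambda>(\<eta>, x). wave (\<xi> - \<eta>) (x::real^'n))"
    unfolding wave_def case_prod_unfold by (intro continuous_intros)
  from integrable_pair_bounded[OF fourier_integrable[OF K h] g this]
  have F: "integrable (lborel \<Otimes>\<^sub>M lborel) (\<lambda>(\<eta>, x). fourier h \<eta> * g x * wave (\<xi> - \<eta>) x)" by simp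
  have "(gauss_const TYPE('n))\<^sup>2 * fourier (\<lambda>x. g x * h x) \<xi>
      = (LINT x|lborel. g x * wave \<xi> x * (LINT \<eta>|lborel. fourier h \<eta> * wave (- \<eta>) x))"
    unfolding fourier_inversion[OF K h] unfolding fourier_wave integral_mult_right_zero[symmetric]
    by (intro Bochner_Integration.integral_cong refl) (simp add: mult_ac)
  also have "\<dots> = (LINT x|lborel. LINT \<eta>|lborel. fourier h \<eta> * g x * wave (\<xi> - \<eta>) x)"
    unfolding integral_mult_right_zero[symmetric]
    by (intro Bochner_Integration.integral_cong refl) (simp add: wave_facts(2)[symmetric] mult_ac)
  also have "\<dots> = (LINT \<eta>|lborel. LINT x|lborel. fourier h \<eta> * g x * wave (\<xi> - \<eta>) x)"
    by (rule lborel_pair.Fubini_integral[OF F])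
  also have "\<dots> = (LINT \<eta>|lborel. fourier h \<eta> * fourier g (\<xi> - \<eta>))"
    unfolding fourier_wave[of g] integral_mult_right_zero[symmetric]
    by (intro Bochner_Integration.integral_cong refl) (simp add: mult_ac)
  finally show ?thesis .
qed

section \<open>Slow scale nets and the filter of high frequencies\<close>

lemma small_eps_iff: "(\<exists>e\<in>{0<..1}. \<forall>\<epsilon>\<in>{0<..<e}. P \<epsilon>) \<longleftrightarrow> eventually P (at_right (0::real))"
proof
  assume "eventually P (at_right (0::real))"
  then obtain b where b: "b > 0" "\<And>y. 0 < y \<Longrightarrow> y < b \<Longrightarrow> P y"
    unfolding eventually_at_right_field by blast
  have "min b 1 \<in> {0<..1}" "\<forall>\<epsilon>\<in>{0<..<min b 1}. P \<epsilon>" using b by auto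
  thus "\<exists>e\<in>{0<..1}. \<forall>\<epsilon>\<in>{0<..<e}. P \<epsilon>" by blast
next
  assume "\<exists>e\<in>{0<..1}. \<forall>\<epsilon>\<in>{0<..<e}. P \<epsilon>"
  then obtain e where "e > 0" "\<And>\<epsilon>. 0 < \<epsilon> \<Longrightarrow> \<epsilon> < e \<Longrightarrow> P \<epsilon>" by auto
  thus "eventually P (at_right (0::real))" unfolding eventually_at_right_field by blast
qed

lemma eventually_unit: "\<forall>\<^sub>F \<epsilon> in at_right (0::real). 0 < \<epsilon> \<and> \<epsilon> \<le> 1"
  unfolding small_eps_iff[symmetric] by (rule bexI[of _ 1]) auto

text \<open>
  The polynomial bound in the definition of slow scale nets is the case \<open>t = 1\<close> of the other condition.
\<close>

lemma pos_slow_scale_iff: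
  "pos_slow_scale r \<longleftrightarrow> (\<forall>\<epsilon>\<in>{0<..1}. 0 < r \<epsilon>) \<and> (\<forall>t\<ge>0. \<forall>\<^sub>F \<epsilon> in at_right 0. r \<epsilon> powr t \<le> 1 / \<epsilon>)"
proof -
  have "slow_scale (\<lambda>\<epsilon>. complex_of_real (r \<epsilon>)) \<longleftrightarrow> (\<forall>t\<ge>0. \<forall>\<^sub>F \<epsilon> in at_right 0. r \<epsilon> powr t \<le> 1 / \<epsilon>)"
    if pos: "\<forall>\<epsilon>\<in>{0<..1}. 0 < r \<epsilon>"
  proof -
    have eq: "(\<forall>\<^sub>F \<epsilon> in at_right 0. norm (complex_of_real (r \<epsilon>)) powr t \<le> 1 / \<epsilon>) \<longleftrightarrow>
        (\<forall>\<^sub>F \<epsilon> in at_right 0. r \<epsilon> powr t \<le> 1 / \<epsilon>)" for t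
      by (rule eventually_cong[OF eventually_unit]) (use pos in \<open>auto simp: abs_of_pos\<close>)
    have "(\<lambda>\<epsilon>. norm (complex_of_real (r \<epsilon>))) \<in> O[at_right 0](\<lambda>\<epsilon>. \<epsilon> powr (-1))"
      if "\<forall>t\<ge>0. \<forall>\<^sub>F \<epsilon> in at_right 0. r \<epsilon> powr t \<le> 1 / \<epsilon>"
    proof (rule landau_o.big_mono)
      have "\<forall>\<^sub>F \<epsilon> in at_right 0. r \<epsilon> powr 1 \<le> 1 / \<epsilon>" using that[rule_format, of 1] by simp
      with eventually_unit show "\<forall>\<^sub>F \<epsilon> in at_right 0. norm (norm (complex_of_real (r \<epsilon>))) \<le> norm (\<epsilon> powr - 1)"
        by eventually_elim (use pos in \<open>auto simp: powr_minus_divide\<close>)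
    qed
    thus ?thesis unfolding slow_scale_def small_eps_iff eq by blast
  qed
  thus ?thesis unfolding pos_slow_scale_def by blast
qed

lemma pos_slow_scale_pos: "pos_slow_scale r \<Longrightarrow> \<forall>\<^sub>F \<epsilon> in at_right 0. 0 < r \<epsilon>"
  by (rule eventually_mono[OF eventually_unit]) (auto simp: pos_slow_scale_iff)

lemma pos_slow_scale_powr_le: "pos_slow_scale r \<Longrightarrow> 0 \<le> t \<Longrightarrow> \<forall>\<^sub>F \<epsilon> in at_right 0. r \<epsilon> powr t \<le> 1 / \<epsilon>"
  by (auto simp: pos_slow_scale_iff)

lemma pos_slow_scale_const: "0 < c \<Longrightarrow> pos_slow_scale (\<lambda>_. c)"
  unfolding pos_slow_scale_iff
proof (intro conjI allI impI ballI)
  fix t :: real assume "0 < c" "0 \<le> t"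
  define d where "d = 1 / (c powr t)"
  have "0 < d" using \<open>0 < c\<close> by (simp add: d_def)
  hence "\<forall>\<^sub>F \<epsilon> in at_right 0. \<epsilon> \<in> {0<..<d}" by (rule eventually_at_right_real)
  thus "\<forall>\<^sub>F \<epsilon> in at_right 0. c powr t \<le> 1 / \<epsilon>"
    by eventually_elim (use \<open>0 < c\<close> in \<open>auto simp: d_def field_simps\<close>)
qed

lemma pos_slow_scale_powr: "pos_slow_scale r \<Longrightarrow> 0 \<le> p \<Longrightarrow> pos_slow_scale (\<lambda>\<epsilon>. r \<epsilon> powr p)"
  by (auto simp: pos_slow_scale_iff powr_powr)

lemma pos_slow_scale_mult:
  assumes "pos_slow_scale r" "pos_slow_scale s"
  shows "pos_slow_scale (\<lambda>\<epsilon>. r \<epsilon> * s \<epsilon>)"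
  unfolding pos_slow_scale_iff
proof (intro conjI allI impI ballI)
  fix t :: real assume t: "0 \<le> t"
  have "\<forall>\<^sub>F \<epsilon> in at_right 0. r \<epsilon> powr (2 * t) \<le> 1 / \<epsilon>" "\<forall>\<^sub>F \<epsilon> in at_right 0. s \<epsilon> powr (2 * t) \<le> 1 / \<epsilon>"
    using assms t by (auto intro!: pos_slow_scale_powr_le)
  with eventually_unit pos_slow_scale_pos[OF assms(1)] pos_slow_scale_pos[OF assms(2)]
  show "\<forall>\<^sub>F \<epsilon> in at_right 0. (r \<epsilon> * s \<epsilon>) powr t \<le> 1 / \<epsilon>"
  proof eventually_elim
    case (elim \<epsilon>)
    have "((r \<epsilon> * s \<epsilon>) powr t)\<^sup>2 = r \<epsilon> powr (2 * t) * s \<epsilon> powr (2 * t)"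
    proof -
      have "((r \<epsilon> * s \<epsilon>) powr t)\<^sup>2 = (r \<epsilon> * s \<epsilon>) powr (t + t)" unfolding powr_add power2_eq_square ..
      also have "\<dots> = r \<epsilon> powr (t + t) * s \<epsilon> powr (t + t)" by (rule powr_mult)
      finally show ?thesis by simp
    qed
    also have "\<dots> \<le> (1 / \<epsilon>) * (1 / \<epsilon>)" by (rule mult_mono) (use elim in auto)
    finally have "((r \<epsilon> * s \<epsilon>) powr t)\<^sup>2 \<le> (1 / \<epsilon>)\<^sup>2" by (simp add: power2_eq_square)
    moreover have "0 \<le> 1 / \<epsilon>" using elim by simp
    ultimately show ?case by (rule power2_le_imp_le)
  qed
qed (use assms in \<open>auto simp: pos_slow_scale_iff\<close>)

lemma pos_slow_scale_max:
  assumes "pos_slow_scale r" "pos_slow_scale s"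
  shows "pos_slow_scale (\<lambda>\<epsilon>. max (r \<epsilon>) (s \<epsilon>))"
  unfolding pos_slow_scale_iff
proof (intro conjI allI impI ballI)
  fix t :: real assume t: "0 \<le> t"
  from pos_slow_scale_powr_le[OF assms(1) t] pos_slow_scale_powr_le[OF assms(2) t]
  show "\<forall>\<^sub>F \<epsilon> in at_right 0. max (r \<epsilon>) (s \<epsilon>) powr t \<le> 1 / \<epsilon>"
    by eventually_elim (auto simp only: max_def split: if_split)
qed (use assms in \<open>auto simp: pos_slow_scale_iff less_max_iff_disj\<close>)

text \<open>
  Small \<open>\<epsilon>\<close> and frequencies in \<open>\<Gamma>\<close> above some slow scale net, the regime of all the symbol
  estimates.
\<close>

definition high_freq :: "(real^'n::finite) set \<Rightarrow> (real \<times> (real^'n)) filter" where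
  "high_freq \<Gamma> = Abs_filter (\<lambda>P. \<exists>r. pos_slow_scale r \<and>
     (\<exists>\<epsilon>\<^sub>0\<in>{0<..1}. \<forall>\<epsilon>\<in>{0<..<\<epsilon>\<^sub>0}. \<forall>\<xi>\<in>\<Gamma>. r \<epsilon> \<le> norm \<xi> \<longrightarrow> P (\<epsilon>, \<xi>)))"

lemma eventually_high_freq:
  fixes \<Gamma> :: "(real^'n::finite) set"
  shows
  "eventually P (high_freq \<Gamma>) \<longleftrightarrow> (\<exists>r. pos_slow_scale r \<and>
     (\<exists>\<epsilon>\<^sub>0\<in>{0<..1}. \<forall>\<epsilon>\<in>{0<..<\<epsilon>\<^sub>0}. \<forall>\<xi>\<in>\<Gamma>. r \<epsilon> \<le> norm \<xi> \<longrightarrow> P (\<epsilon>, \<xi>)))"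
  unfolding high_freq_def
proof (rule eventually_Abs_filter, unfold small_eps_iff, rule is_filter.intro)
  show "\<exists>r. pos_slow_scale r \<and> (\<forall>\<^sub>F \<epsilon> in at_right 0. \<forall>\<xi>\<in>\<Gamma>. r \<epsilon> \<le> norm \<xi> \<longrightarrow> True)"
    using pos_slow_scale_const[of 1] by auto
next
  fix P Q :: "real \<times> (real^'n) \<Rightarrow> bool"
  assume "\<exists>r. pos_slow_scale r \<and> (\<forall>\<^sub>F \<epsilon> in at_right 0. \<forall>\<xi>\<in>\<Gamma>. r \<epsilon> \<le> norm \<xi> \<longrightarrow> P (\<epsilon>, \<xi>))"
    "\<exists>r. pos_slow_scale r \<and> (\<forall>\<^sub>F \<epsilon> in at_right 0. \<forall>\<xi>\<in>\<Gamma>. r \<epsilon> \<le> norm \<xi> \<longrightarrow> Q (\<epsilon>, \<xi>))"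
  then obtain r s where rs: "pos_slow_scale r" "pos_slow_scale s"
    and ev: "\<forall>\<^sub>F \<epsilon> in at_right 0. \<forall>\<xi>\<in>\<Gamma>. r \<epsilon> \<le> norm \<xi> \<longrightarrow> P (\<epsilon>, \<xi>)"
      "\<forall>\<^sub>F \<epsilon> in at_right 0. \<forall>\<xi>\<in>\<Gamma>. s \<epsilon> \<le> norm \<xi> \<longrightarrow> Q (\<epsilon>, \<xi>)" by blast
  have "\<forall>\<^sub>F \<epsilon> in at_right 0. \<forall>\<xi>\<in>\<Gamma>. max (r \<epsilon>) (s \<epsilon>) \<le> norm \<xi> \<longrightarrow> P (\<epsilon>, \<xi>) \<and> Q (\<epsilon>, \<xi>)"
    using ev by eventually_elim auto
  with pos_slow_scale_max[OF rs]
  show "\<exists>r. pos_slow_scale r \<and> (\<forall>\<^sub>F \<epsilon> in at_right 0. \<forall>\<xi>\<in>\<Gamma>. r \<epsilon> \<le> norm \<xi> \<longrightarrow> P (\<epsilon>, \<xi>) \<and> Q (\<epsilon>, \<xi>))" by blast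
next
  fix P Q :: "real \<times> (real^'n) \<Rightarrow> bool" assume PQ: "\<forall>x. P x \<longrightarrow> Q x"
  assume "\<exists>r. pos_slow_scale r \<and> (\<forall>\<^sub>F \<epsilon> in at_right 0. \<forall>\<xi>\<in>\<Gamma>. r \<epsilon> \<le> norm \<xi> \<longrightarrow> P (\<epsilon>, \<xi>))"
  then obtain r where r: "pos_slow_scale r" "\<forall>\<^sub>F \<epsilon> in at_right 0. \<forall>\<xi>\<in>\<Gamma>. r \<epsilon> \<le> norm \<xi> \<longrightarrow> P (\<epsilon>, \<xi>)" by blast
  from r(2) have "\<forall>\<^sub>F \<epsilon> in at_right 0. \<forall>\<xi>\<in>\<Gamma>. r \<epsilon> \<le> norm \<xi> \<longrightarrow> Q (\<epsilon>, \<xi>)"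
    by eventually_elim (use PQ in auto)
  with r(1) show "\<exists>r. pos_slow_scale r \<and> (\<forall>\<^sub>F \<epsilon> in at_right 0. \<forall>\<xi>\<in>\<Gamma>. r \<epsilon> \<le> norm \<xi> \<longrightarrow> Q (\<epsilon>, \<xi>))" by blast
qed

lemma eventually_high_freqI:
  assumes "pos_slow_scale r" "\<forall>\<^sub>F \<epsilon> in at_right 0. \<forall>\<xi>\<in>\<Gamma>. r \<epsilon> \<le> norm \<xi> \<longrightarrow> P (\<epsilon>, \<xi>)"
  shows "eventually P (high_freq \<Gamma>)"
  using assms unfolding eventually_high_freq small_eps_iff by blast

lemma eventually_high_freq_eps:
  assumes "eventually P (at_right 0)"
  shows "\<forall>\<^sub>F (\<epsilon>, \<xi>) in high_freq \<Gamma>. P \<epsilon>"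
  by (rule eventually_high_freqI[OF pos_slow_scale_const[of 1]], simp, rule eventually_mono[OF assms], simp)

lemma eventually_high_freq_cone: "\<forall>\<^sub>F (\<epsilon>, \<xi>) in high_freq \<Gamma>. \<xi> \<in> \<Gamma> \<and> 0 < \<epsilon> \<and> \<epsilon> \<le> 1"
  by (rule eventually_high_freqI[OF pos_slow_scale_const[of 1]], simp, rule eventually_mono[OF eventually_unit], simp)

abbreviation (input) jb :: "real^'n::finite \<Rightarrow> real" where "jb \<xi> \<equiv> 1 + norm \<xi>"

lemma jb_pos [simp]: "0 < jb \<xi>" "jb \<xi> \<noteq> 0"
  using norm_ge_zero[of \<xi>] by linarith+

text \<open>
  If \<open>s\<close> is a slow scale net, so is \<open>s\<close> to the power \<open>1 / \<theta>\<close>, and this net can serve as the lower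
  bound for the frequencies.
\<close>

lemma eventually_slow_le_jb:
  assumes "pos_slow_scale s" "0 < \<theta>"
  shows "\<forall>\<^sub>F (\<epsilon>, \<xi>) in high_freq \<Gamma>. s \<epsilon> \<le> jb \<xi> powr \<theta>"
proof (rule eventually_high_freqI)
  show "pos_slow_scale (\<lambda>\<epsilon>. s \<epsilon> powr (1 / \<theta>))" using assms by (intro pos_slow_scale_powr) auto
  show "\<forall>\<^sub>F \<epsilon> in at_right 0. \<forall>\<xi>\<in>\<Gamma>. s \<epsilon> powr (1 / \<theta>) \<le> norm \<xi> \<longrightarrow> (case (\<epsilon>, \<xi>) of (\<epsilon>, \<xi>) \<Rightarrow> s \<epsilon> \<le> jb \<xi> powr \<theta>)"
    using pos_slow_scale_pos[OF assms(1)]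
  proof eventually_elim
    case (elim \<epsilon>)
    show ?case
    proof (intro ballI impI, unfold prod.case)
      fix \<xi> :: "real^'a" assume le: "s \<epsilon> powr (1 / \<theta>) \<le> norm \<xi>"
      have "s \<epsilon> = (s \<epsilon> powr (1 / \<theta>)) powr \<theta>" using elim assms(2) by (simp add: powr_powr)
      also have "\<dots> \<le> jb \<xi> powr \<theta>" using le assms(2) by (intro powr_mono2) auto
      finally show "s \<epsilon> \<le> jb \<xi> powr \<theta>" .
    qed
  qed
qed

lemma eventually_const_le_jb: "0 < \<theta> \<Longrightarrow> \<forall>\<^sub>F (\<epsilon>, \<xi>) in high_freq \<Gamma>. c \<le> jb \<xi> powr \<theta>"
  by (rule eventually_mono[OF eventually_slow_le_jb[OF pos_slow_scale_const[of "max c 1"]]]) auto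

section \<open>Orders of decay\<close>

abbreviation cone_freq :: "(real^'n::finite) set \<Rightarrow> (real \<times> (real^'n)) filter" where
  "cone_freq \<Gamma> \<equiv> at_right 0 \<times>\<^sub>F principal \<Gamma>"

lemma eventually_cone_freq: "eventually P (cone_freq \<Gamma>) \<longleftrightarrow> (\<forall>\<^sub>F \<epsilon> in at_right 0. \<forall>\<xi>\<in>\<Gamma>. P (\<epsilon>, \<xi>))"
proof
  assume "eventually P (cone_freq \<Gamma>)"
  then obtain Q where Q: "eventually Q (at_right 0)" "\<forall>\<epsilon> \<xi>. Q \<epsilon> \<longrightarrow> \<xi> \<in> \<Gamma> \<longrightarrow> P (\<epsilon>, \<xi>)"
    unfolding eventually_prod_filter eventually_principal by blast
  from Q(1) show "\<forall>\<^sub>F \<epsilon> in at_right 0. \<forall>\<xi>\<in>\<Gamma>. P (\<epsilon>, \<xi>)" by eventually_elim (use Q(2) in blast)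
next
  assume "\<forall>\<^sub>F \<epsilon> in at_right 0. \<forall>\<xi>\<in>\<Gamma>. P (\<epsilon>, \<xi>)"
  thus "eventually P (cone_freq \<Gamma>)"
    unfolding eventually_prod_filter eventually_principal
    by (intro exI[of _ "\<lambda>\<epsilon>. \<forall>\<xi>\<in>\<Gamma>. P (\<epsilon>, \<xi>)"] exI[of _ "\<lambda>\<xi>. \<xi> \<in> \<Gamma>"]) blast
qed

text \<open>
  The power \<open>N\<close> of \<open>1 / \<epsilon>\<close> is a parameter, since microlocal regularity asks for one power that serves
  all the orders \<open>l\<close>.
\<close>

definition decay :: "(real \<times> (real^'n::finite)) filter \<Rightarrow> real \<Rightarrow> nat \<Rightarrow> (real \<Rightarrow> real^'n \<Rightarrow> complex) \<Rightarrow> bool" where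
  "decay F N l G \<longleftrightarrow>
    (\<exists>C. \<forall>\<^sub>F (\<epsilon>, \<xi>) in F. norm (G \<epsilon> \<xi>) \<le> C * \<epsilon> powr (- N) * jb \<xi> powr (- real l))"

lemma decay_triangle:
  assumes "decay F N l G" "decay F N l H" "\<forall>\<^sub>F (\<epsilon>, \<xi>) in F. norm (J \<epsilon> \<xi>) \<le> norm (G \<epsilon> \<xi>) + norm (H \<epsilon> \<xi>)"
  shows "decay F N l J"
proof -
  let ?b = "\<lambda>C \<epsilon> \<xi>. C * \<epsilon> powr (- N) * jb (\<xi>::real^'a) powr (- real l)"
  obtain C1 C2 where C: "\<forall>\<^sub>F (\<epsilon>, \<xi>) in F. norm (G \<epsilon> \<xi>) \<le> ?b C1 \<epsilon> \<xi>" "\<forall>\<^sub>F (\<epsilon>, \<xi>) in F. norm (H \<epsilon> \<xi>) \<le> ?b C2 \<epsilon> \<xi>"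
    using assms(1,2) unfolding decay_def by blast
  have "\<forall>\<^sub>F (\<epsilon>, \<xi>) in F. norm (J \<epsilon> \<xi>) \<le> ?b (C1 + C2) \<epsilon> \<xi>"
    using C assms(3) by eventually_elim (auto simp: distrib_right)
  thus ?thesis unfolding decay_def by blast
qed

lemma decay_cong:
  assumes "decay F N l G" "\<forall>\<^sub>F (\<epsilon>, \<xi>) in F. J \<epsilon> \<xi> = G \<epsilon> \<xi>"
  shows "decay F N l J"
proof -
  have "\<forall>\<^sub>F (\<epsilon>, \<xi>) in F. norm (J \<epsilon> \<xi>) \<le> norm (G \<epsilon> \<xi>) + norm (G \<epsilon> \<xi>)"
    using assms(2) by eventually_elim auto
  thus ?thesis by (rule decay_triangle[OF assms(1,1)])
qed

lemma decay_mono: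
  assumes "decay F N l G" "N \<le> N'" "\<forall>\<^sub>F (\<epsilon>, \<xi>) in F. 0 < \<epsilon> \<and> \<epsilon> \<le> 1"
  shows "decay F N' l G"
proof -
  obtain C where C: "\<forall>\<^sub>F (\<epsilon>, \<xi>) in F. norm (G \<epsilon> \<xi>) \<le> C * \<epsilon> powr (- N) * jb \<xi> powr (- real l)"
    using assms(1) unfolding decay_def by blast
  have "\<forall>\<^sub>F (\<epsilon>, \<xi>) in F. norm (G \<epsilon> \<xi>) \<le> \<bar>C\<bar> * \<epsilon> powr (- N') * jb \<xi> powr (- real l)"
    using C assms(3)
  proof (eventually_elim, safe)
    fix \<epsilon> \<xi> assume 1: "norm (G \<epsilon> \<xi>) \<le> C * \<epsilon> powr (- N) * jb \<xi> powr (- real l)" and \<epsilon>: "0 < \<epsilon>" "\<epsilon> \<le> 1"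
    have "C * \<epsilon> powr (- N) * jb \<xi> powr (- real l) \<le> \<bar>C\<bar> * \<epsilon> powr (- N') * jb \<xi> powr (- real l)"
      using assms(2) \<epsilon> by (intro mult_right_mono mult_mono powr_mono') auto
    with 1 show "norm (G \<epsilon> \<xi>) \<le> \<bar>C\<bar> * \<epsilon> powr (- N') * jb \<xi> powr (- real l)" by linarith
  qed
  thus ?thesis unfolding decay_def by blast
qed

lemma eventually_cone_freq_eps: "\<forall>\<^sub>F (\<epsilon>, \<xi>) in cone_freq \<Gamma>. 0 < \<epsilon> \<and> \<epsilon> \<le> 1"
  unfolding eventually_cone_freq by (rule eventually_mono[OF eventually_unit]) simp

lemma eventually_high_freq_unit: "\<forall>\<^sub>F (\<epsilon>, \<xi>) in high_freq \<Gamma>. 0 < \<epsilon> \<and> \<epsilon> \<le> 1"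
  by (rule eventually_high_freq_eps[OF eventually_unit])

text \<open>
  The condition in the definition of microlocal regularity.
\<close>

lemma decay_cone_freq_iff:
  "decay (cone_freq \<Gamma>) N l G \<longleftrightarrow> (\<exists>C>0. \<exists>\<epsilon>\<^sub>0\<in>{0<..1}. \<forall>\<xi>\<in>\<Gamma>. \<forall>\<epsilon>\<in>{0<..<\<epsilon>\<^sub>0}.
    norm (G \<epsilon> \<xi>) \<le> C * \<epsilon> powr (-N) * (1 + norm \<xi>) powr (- real l))" (is "?L \<longleftrightarrow> ?R")
proof
  assume ?L
  then obtain C e where e: "e \<in> {0<..1}" and C: "\<forall>\<epsilon>\<in>{0<..<e}. \<forall>\<xi>\<in>\<Gamma>. norm (G \<epsilon> \<xi>) \<le> C * \<epsilon> powr (-N) * jb \<xi> powr (- real l)"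
    unfolding decay_def eventually_cone_freq prod.case small_eps_iff[symmetric] by blast
  have "norm (G \<epsilon> \<xi>) \<le> max C 1 * \<epsilon> powr (-N) * jb \<xi> powr (- real l)" if "\<xi> \<in> \<Gamma>" "\<epsilon> \<in> {0<..<e}" for \<xi> \<epsilon>
  proof -
    have "C * \<epsilon> powr (-N) * jb \<xi> powr (- real l) \<le> max C 1 * \<epsilon> powr (-N) * jb \<xi> powr (- real l)"
      by (intro mult_right_mono) auto
    thus ?thesis using bspec[OF bspec[OF C that(2)] that(1)] by linarith
  qed
  moreover have "0 < max C 1" by simp
  ultimately show ?R using e by blast
next
  assume ?R
  then obtain C e where "e \<in> {0<..1}" "\<forall>\<epsilon>\<in>{0<..<e}. \<forall>\<xi>\<in>\<Gamma>. norm (G \<epsilon> \<xi>) \<le> C * \<epsilon> powr (-N) * jb \<xi> powr (- real l)"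
    by blast
  thus ?L unfolding decay_def eventually_cone_freq prod.case small_eps_iff[symmetric] by blast
qed

text \<open>
  Below a slow scale net \<open>r\<close>, the factor \<open>(1 + |\<xi>|)\<^sup>l\<close> is bounded by a slow scale net and so by
  \<open>1 / \<epsilon>\<close>; there the bound without decay suffices, at the cost of one power of \<open>\<epsilon>\<close>.
\<close>

lemma low_frequencies:
  assumes bd: "decay (cone_freq UNIV) N 0 G" and hf: "decay (high_freq \<Gamma>) N l G"
  shows "decay (cone_freq \<Gamma>) (N + 1) l G"
proof -
  obtain C0 where bd: "\<forall>\<^sub>F \<epsilon> in at_right 0. \<forall>\<xi>. norm (G \<epsilon> \<xi>) \<le> C0 * \<epsilon> powr (- N)"
    using bd unfolding decay_def eventually_cone_freq by auto
  obtain C1 where "\<forall>\<^sub>F (\<epsilon>, \<xi>) in high_freq \<Gamma>. norm (G \<epsilon> \<xi>) \<le> C1 * \<epsilon> powr (- N) * jb \<xi> powr (- real l)"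
    using hf unfolding decay_def by blast
  then obtain r where r: "pos_slow_scale r"
    and ev: "\<forall>\<^sub>F \<epsilon> in at_right 0. \<forall>\<xi>\<in>\<Gamma>. r \<epsilon> \<le> norm \<xi> \<longrightarrow> norm (G \<epsilon> \<xi>) \<le> C1 * \<epsilon> powr (- N) * jb \<xi> powr (- real l)"
    unfolding eventually_high_freq small_eps_iff by auto
  \<comment> \<open>an upper bound for \<open>1 + |\<xi>|\<close> when \<open>|\<xi>| < r \<epsilon>\<close>\<close>
  have slow: "pos_slow_scale (\<lambda>\<epsilon>. 2 * max 1 (r \<epsilon>))"
    by (intro pos_slow_scale_mult pos_slow_scale_max pos_slow_scale_const r) auto
  define C where "C = \<bar>C0\<bar> + \<bar>C1\<bar> + 1"
  have "\<forall>\<^sub>F \<epsilon> in at_right 0. \<forall>\<xi>\<in>\<Gamma>. norm (G \<epsilon> \<xi>) \<le> C * \<epsilon> powr (- (N + 1)) * jb \<xi> powr (- real l)"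
    using bd ev pos_slow_scale_powr_le[OF slow of_nat_0_le_iff[of l]] eventually_unit
  proof (eventually_elim, safe)
    fix \<epsilon> and \<xi> :: "real^'a"
    assume bd: "\<forall>\<xi>. norm (G \<epsilon> \<xi>) \<le> C0 * \<epsilon> powr (- N)"
      and hi: "\<forall>\<xi>\<in>\<Gamma>. r \<epsilon> \<le> norm \<xi> \<longrightarrow> norm (G \<epsilon> \<xi>) \<le> C1 * \<epsilon> powr (- N) * jb \<xi> powr (- real l)"
      and sl: "(2 * max 1 (r \<epsilon>)) powr real l \<le> 1 / \<epsilon>" and \<epsilon>: "0 < \<epsilon>" "\<epsilon> \<le> 1" and \<xi>: "\<xi> \<in> \<Gamma>"
    have e1: "\<epsilon> powr (- (N + 1)) = \<epsilon> powr (- N) * (1 / \<epsilon>)"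
      using \<epsilon> by (simp add: powr_diff powr_minus)
    show "norm (G \<epsilon> \<xi>) \<le> C * \<epsilon> powr (- (N + 1)) * jb \<xi> powr (- real l)"
    proof (cases "r \<epsilon> \<le> norm \<xi>")
      case True
      hence "norm (G \<epsilon> \<xi>) \<le> C1 * \<epsilon> powr (- N) * jb \<xi> powr (- real l)" using hi \<xi> by blast
      also have "\<dots> \<le> (C * \<epsilon> powr (- (N + 1))) * jb \<xi> powr (- real l)"
      proof (intro mult_right_mono mult_mono)
        show "\<epsilon> powr (- N) \<le> \<epsilon> powr (- (N + 1))" using \<epsilon> by (intro powr_mono') auto
      qed (auto simp: C_def)
      finally show ?thesis .
    next
      case False
      have "jb \<xi> \<le> 2 * max 1 (r \<epsilon>)" using False by (simp add: max_def)
      hence "jb \<xi> powr real l \<le> (2 * max 1 (r \<epsilon>)) powr real l" by (intro powr_mono2) auto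
      hence "jb \<xi> powr real l \<le> 1 / \<epsilon>" using sl by linarith
      hence "jb \<xi> powr real l * jb \<xi> powr (- real l) \<le> (1 / \<epsilon>) * jb \<xi> powr (- real l)"
        by (rule mult_right_mono) simp
      moreover have "jb \<xi> powr real l * jb \<xi> powr (- real l) = 1" by (simp flip: powr_add)
      ultimately have "1 \<le> (1 / \<epsilon>) * jb \<xi> powr (- real l)" by simp
      hence "C * \<epsilon> powr (- N) * 1 \<le> C * \<epsilon> powr (- N) * ((1 / \<epsilon>) * jb \<xi> powr (- real l))"
        by (intro mult_left_mono) (auto simp: C_def)
      moreover have "norm (G \<epsilon> \<xi>) \<le> C * \<epsilon> powr (- N)"
      proof -
        have "C0 * \<epsilon> powr (- N) \<le> C * \<epsilon> powr (- N)" by (intro mult_right_mono) (auto simp: C_def)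
        thus ?thesis using bd order_trans by blast
      qed
      ultimately show ?thesis unfolding e1 by (simp add: mult_ac)
    qed
  qed
  thus ?thesis unfolding decay_def eventually_cone_freq prod.case by blast
qed

section \<open>A symbol calculus\<close>

text \<open>
  Smoothness on a neighbourhood of \<open>K\<close> that may depend on the function: the zeros of a symbol, where
  its inverse fails to be smooth, approach \<open>K\<close> in a way that depends on \<open>\<epsilon>\<close> and \<open>\<xi>\<close>.
\<close>

definition smooth_near :: "(real^'n::finite) set \<Rightarrow> (real^'n \<Rightarrow> complex) \<Rightarrow> bool" where
  "smooth_near K f \<longleftrightarrow> (\<exists>V. open V \<and> K \<subseteq> V \<and> smooth_on V f)"

definition eq_near :: "(real^'n::finite) set \<Rightarrow> (real^'n \<Rightarrow> complex) \<Rightarrow> (real^'n \<Rightarrow> complex) \<Rightarrow> bool" where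
  "eq_near K f g \<longleftrightarrow> (\<exists>V. open V \<and> K \<subseteq> V \<and> (\<forall>x\<in>V. f x = g x))"

lemma eq_nearD: "eq_near K f g \<Longrightarrow> x \<in> K \<Longrightarrow> f x = g x"
  by (auto simp: eq_near_def)

lemma eq_near_partial_deriv: "eq_near K f g \<Longrightarrow> eq_near K (partial_deriv i f) (partial_deriv i g)"
  unfolding eq_near_def by (blast intro: partial_deriv_cong)

lemma smooth_near_cong:
  assumes "eq_near K f g" "smooth_near K f" shows "smooth_near K g"
proof -
  obtain V W where "open V" "K \<subseteq> V" "\<forall>x\<in>V. f x = g x" "open W" "K \<subseteq> W" "smooth_on W f"
    using assms by (auto simp: eq_near_def smooth_near_def)
  hence "open (V \<inter> W)" "K \<subseteq> V \<inter> W" "smooth_on (V \<inter> W) g"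
    using smooth_on_cong[of "V \<inter> W" f g] smooth_on_subset[of W f "V \<inter> W"] by auto
  thus ?thesis unfolding smooth_near_def by blast
qed

lemma smooth_near_partial_deriv: "smooth_near K f \<Longrightarrow> smooth_near K (partial_deriv i f)"
  using smooth_on_partial_deriv unfolding smooth_near_def by blast

lemma smooth_near_const: "smooth_near K (\<lambda>_. c)"
  unfolding smooth_near_def using smooth_on_const by blast

lemma smooth_near_on: "open S \<Longrightarrow> K \<subseteq> S \<Longrightarrow> smooth_on S f \<Longrightarrow> smooth_near K f"
  unfolding smooth_near_def by blast

lemma smooth_near_common:
  assumes "smooth_near K f" "smooth_near K g"
  obtains V where "open V" "K \<subseteq> V" "smooth_on V f" "smooth_on V g"
proof -
  obtain V W where "open V" "K \<subseteq> V" "smooth_on V f" "open W" "K \<subseteq> W" "smooth_on W g"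
    using assms by (auto simp: smooth_near_def)
  thus ?thesis using that[of "V \<inter> W"] smooth_on_subset[of V f] smooth_on_subset[of W g] by auto
qed

lemma smooth_near_add: "smooth_near K f \<Longrightarrow> smooth_near K g \<Longrightarrow> smooth_near K (\<lambda>x. f x + g x)"
  by (erule (1) smooth_near_common) (auto simp: smooth_near_def intro!: smooth_on_add)

lemma smooth_near_mult: "smooth_near K f \<Longrightarrow> smooth_near K g \<Longrightarrow> smooth_near K (\<lambda>x. f x * g x)"
  by (erule (1) smooth_near_common) (auto simp: smooth_near_def intro!: smooth_on_mult)

lemma smooth_near_nonzero:
  assumes "smooth_near K f" "\<And>x. x \<in> K \<Longrightarrow> f x \<noteq> 0"
  obtains V where "open V" "K \<subseteq> V" "smooth_on V f" "\<And>x. x \<in> V \<Longrightarrow> f x \<noteq> 0"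
proof -
  obtain V where V: "open V" "K \<subseteq> V" "smooth_on V f" using assms(1) by (auto simp: smooth_near_def)
  have o: "open (f -` (- {0}) \<inter> V)"
    using continuous_open_preimage[OF smooth_on_continuous_on[OF V(3)] V(1), of "- {0}"]
    by (simp add: Int_commute open_Compl)
  show ?thesis
    by (rule that[of "f -` (- {0}) \<inter> V"]) (use V assms(2) o smooth_on_subset[of V f] in auto)
qed

lemma smooth_near_inverse:
  assumes "smooth_near K f" "\<And>x. x \<in> K \<Longrightarrow> f x \<noteq> 0"
  shows "smooth_near K (\<lambda>x. inverse (f x))"
  by (rule smooth_near_nonzero[OF assms]) (auto simp: smooth_near_def intro!: smooth_on_inverse)

lemma smooth_near_partial_deriv_add:
  assumes "smooth_near K f" "smooth_near K g"
  shows "eq_near K (\<lambda>x. partial_deriv i f x + partial_deriv i g x) (partial_deriv i (\<lambda>x. f x + g x))"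
  by (rule smooth_near_common[OF assms])
    (auto simp: eq_near_def partial_deriv_add smooth_on_differentiable)

lemma smooth_near_partial_deriv_mult:
  assumes "smooth_near K f" "smooth_near K g"
  shows "eq_near K (\<lambda>x. partial_deriv i f x * g x + f x * partial_deriv i g x) (partial_deriv i (\<lambda>x. f x * g x))"
  by (rule smooth_near_common[OF assms])
    (auto simp: eq_near_def partial_deriv_mult smooth_on_differentiable)

lemma smooth_near_partial_deriv_inverse:
  assumes "smooth_near K f" "\<And>x. x \<in> K \<Longrightarrow> f x \<noteq> 0"
  shows "eq_near K (\<lambda>x. - 1 * (inverse (f x) * inverse (f x) * partial_deriv i f x)) (partial_deriv i (\<lambda>x. inverse (f x)))"
proof -
  obtain V where V: "open V" "K \<subseteq> V" "smooth_on V f" "\<And>x. x \<in> V \<Longrightarrow> f x \<noteq> 0"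
    using smooth_near_nonzero[OF assms] by blast
  have "\<forall>x\<in>V. - 1 * (inverse (f x) * inverse (f x) * partial_deriv i f x) = partial_deriv i (\<lambda>x. inverse (f x)) x"
    using V by (auto simp: partial_deriv_inverse smooth_on_differentiable)
  thus ?thesis using V unfolding eq_near_def by blast
qed

type_synonym 'n family = "real \<Rightarrow> real^'n \<Rightarrow> real^'n \<Rightarrow> complex"
type_synonym 'n weights = "real \<Rightarrow> real^'n \<Rightarrow> real^'n \<Rightarrow> real"

text \<open>
  The loss \<open>(1 + |\<xi>|)\<^sup>\<theta>\<close> with arbitrary \<open>\<theta> > 0\<close> absorbs constants and slow scale factors, so that none
  of them has to be carried along.
\<close>

definition symbol0 :: "(real^'n::finite) set \<Rightarrow> (real^'n) set \<Rightarrow> 'n weights \<Rightarrow> 'n family \<Rightarrow> bool" where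
  "symbol0 \<Gamma> K w h \<longleftrightarrow> (\<forall>\<^sub>F (\<epsilon>, \<xi>) in high_freq \<Gamma>. smooth_near K (h \<epsilon> \<xi>)) \<and>
     (\<forall>\<theta>>0. \<forall>\<^sub>F (\<epsilon>, \<xi>) in high_freq \<Gamma>. \<forall>x\<in>K. norm (h \<epsilon> \<xi> x) \<le> w \<epsilon> \<xi> x * jb \<xi> powr \<theta>)"

text \<open>
  Derivatives in \<open>x\<close> of order at most \<open>n\<close> obey the bound. The recursion strips the innermost
  derivative, which makes the product rule an induction on \<open>n\<close>.
\<close>

primrec symbol_upto :: "nat \<Rightarrow> (real^'n::finite) set \<Rightarrow> (real^'n) set \<Rightarrow> 'n weights \<Rightarrow> 'n family \<Rightarrow> bool" where
  "symbol_upto 0 \<Gamma> K w h \<longleftrightarrow> symbol0 \<Gamma> K w h"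
| "symbol_upto (Suc n) \<Gamma> K w h \<longleftrightarrow> symbol0 \<Gamma> K w h \<and> (\<forall>i. symbol_upto n \<Gamma> K w (\<lambda>\<epsilon> \<xi>. partial_deriv i (h \<epsilon> \<xi>)))"

lemma symbol_upto_symbol0: "symbol_upto n \<Gamma> K w h \<Longrightarrow> symbol0 \<Gamma> K w h"
  by (cases n) auto

lemma symbol_upto_SucD: "symbol_upto (Suc n) \<Gamma> K w h \<Longrightarrow> symbol_upto n \<Gamma> K w h"
  by (induction n arbitrary: h) auto

lemma symbol0_smooth: "symbol0 \<Gamma> K w h \<Longrightarrow> \<forall>\<^sub>F (\<epsilon>, \<xi>) in high_freq \<Gamma>. smooth_near K (h \<epsilon> \<xi>)"
  by (simp add: symbol0_def)

lemma symbol0_bound: "symbol0 \<Gamma> K w h \<Longrightarrow> 0 < \<theta> \<Longrightarrow>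
  \<forall>\<^sub>F (\<epsilon>, \<xi>) in high_freq \<Gamma>. \<forall>x\<in>K. norm (h \<epsilon> \<xi> x) \<le> w \<epsilon> \<xi> x * jb \<xi> powr \<theta>"
  by (simp add: symbol0_def)

lemma symbol0_cong:
  assumes "\<forall>\<^sub>F (\<epsilon>, \<xi>) in high_freq \<Gamma>. eq_near K (h \<epsilon> \<xi>) (g \<epsilon> \<xi>)" "symbol0 \<Gamma> K w h"
  shows "symbol0 \<Gamma> K w g"
  unfolding symbol0_def
proof (intro conjI allI impI)
  show "\<forall>\<^sub>F (\<epsilon>, \<xi>) in high_freq \<Gamma>. smooth_near K (g \<epsilon> \<xi>)"
    using assms(1) symbol0_smooth[OF assms(2)] by eventually_elim (auto intro: smooth_near_cong)
  fix \<theta> :: real assume "0 < \<theta>"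
  from assms(1) symbol0_bound[OF assms(2) this]
  show "\<forall>\<^sub>F (\<epsilon>, \<xi>) in high_freq \<Gamma>. \<forall>x\<in>K. norm (g \<epsilon> \<xi> x) \<le> w \<epsilon> \<xi> x * jb \<xi> powr \<theta>"
  proof (eventually_elim, safe)
    fix \<epsilon> \<xi> x
    assume "eq_near K (h \<epsilon> \<xi>) (g \<epsilon> \<xi>)" "x \<in> K" "\<forall>x\<in>K. norm (h \<epsilon> \<xi> x) \<le> w \<epsilon> \<xi> x * jb \<xi> powr \<theta>"
    thus "norm (g \<epsilon> \<xi> x) \<le> w \<epsilon> \<xi> x * jb \<xi> powr \<theta>"
      using eq_nearD[of K "h \<epsilon> \<xi>" "g \<epsilon> \<xi>" x] by fastforce
  qed
qed

lemma symbol_upto_cong: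
  assumes "\<forall>\<^sub>F (\<epsilon>, \<xi>) in high_freq \<Gamma>. eq_near K (h \<epsilon> \<xi>) (g \<epsilon> \<xi>)" "symbol_upto n \<Gamma> K w h"
  shows "symbol_upto n \<Gamma> K w g"
  using assms
proof (induction n arbitrary: h g)
  case (Suc n)
  have "\<forall>\<^sub>F (\<epsilon>, \<xi>) in high_freq \<Gamma>. eq_near K (partial_deriv i (h \<epsilon> \<xi>)) (partial_deriv i (g \<epsilon> \<xi>))" for i
    using Suc.prems(1) by eventually_elim (auto intro: eq_near_partial_deriv)
  hence "symbol_upto n \<Gamma> K w (\<lambda>\<epsilon> \<xi>. partial_deriv i (g \<epsilon> \<xi>))" for i
    by (rule Suc.IH) (use Suc.prems(2) in simp)
  thus ?case using Suc.prems symbol0_cong by auto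
qed (auto intro: symbol0_cong)

lemma symbol_upto_mono:
  assumes "\<forall>\<^sub>F (\<epsilon>, \<xi>) in high_freq \<Gamma>. \<forall>x\<in>K. w \<epsilon> \<xi> x \<le> w' \<epsilon> \<xi> x" "symbol_upto n \<Gamma> K w h"
  shows "symbol_upto n \<Gamma> K w' h"
proof -
  have *: "symbol0 \<Gamma> K w' h" if "symbol0 \<Gamma> K w h" for h
    unfolding symbol0_def
  proof (intro conjI allI impI symbol0_smooth[OF that])
    fix \<theta> :: real assume "0 < \<theta>"
    from assms(1) symbol0_bound[OF that this]
    show "\<forall>\<^sub>F (\<epsilon>, \<xi>) in high_freq \<Gamma>. \<forall>x\<in>K. norm (h \<epsilon> \<xi> x) \<le> w' \<epsilon> \<xi> x * jb \<xi> powr \<theta>"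
    proof (eventually_elim, safe)
      fix \<epsilon> \<xi> x
      assume x: "x \<in> K" and w: "\<forall>x\<in>K. w \<epsilon> \<xi> x \<le> w' \<epsilon> \<xi> x"
        and h: "\<forall>x\<in>K. norm (h \<epsilon> \<xi> x) \<le> w \<epsilon> \<xi> x * jb \<xi> powr \<theta>"
      have "w \<epsilon> \<xi> x * jb \<xi> powr \<theta> \<le> w' \<epsilon> \<xi> x * jb \<xi> powr \<theta>"
        using bspec[OF w x] by (rule mult_right_mono) simp
      with bspec[OF h x] show "norm (h \<epsilon> \<xi> x) \<le> w' \<epsilon> \<xi> x * jb \<xi> powr \<theta>" by (rule order_trans)
    qed
  qed
  from assms(2) show ?thesis by (induction n arbitrary: h) (auto intro: *)
qed

lemma symbol_upto_add:
  assumes "symbol_upto n \<Gamma> K w h" "symbol_upto n \<Gamma> K w g"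
  shows "symbol_upto n \<Gamma> K w (\<lambda>\<epsilon> \<xi> x. h \<epsilon> \<xi> x + g \<epsilon> \<xi> x)"
proof -
  have *: "symbol0 \<Gamma> K w (\<lambda>\<epsilon> \<xi> x. h \<epsilon> \<xi> x + g \<epsilon> \<xi> x)" if "symbol0 \<Gamma> K w h" "symbol0 \<Gamma> K w g" for h g
    unfolding symbol0_def
  proof (intro conjI allI impI)
    show "\<forall>\<^sub>F (\<epsilon>, \<xi>) in high_freq \<Gamma>. smooth_near K (\<lambda>x. h \<epsilon> \<xi> x + g \<epsilon> \<xi> x)"
      using that[THEN symbol0_smooth] by eventually_elim (auto intro: smooth_near_add)
    fix \<theta> :: real assume \<theta>: "0 < \<theta>"
    hence "0 < \<theta> / 2" by simp
    from symbol0_bound[OF that(1) this] symbol0_bound[OF that(2) this] eventually_const_le_jb[OF this, of 2 \<Gamma>]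
    show "\<forall>\<^sub>F (\<epsilon>, \<xi>) in high_freq \<Gamma>. \<forall>x\<in>K. norm (h \<epsilon> \<xi> x + g \<epsilon> \<xi> x) \<le> w \<epsilon> \<xi> x * jb \<xi> powr \<theta>"
    proof (eventually_elim, safe)
      fix \<epsilon> \<xi> x
      assume x: "x \<in> K" and h: "\<forall>x\<in>K. norm (h \<epsilon> \<xi> x) \<le> w \<epsilon> \<xi> x * jb \<xi> powr (\<theta> / 2)"
        and g: "\<forall>x\<in>K. norm (g \<epsilon> \<xi> x) \<le> w \<epsilon> \<xi> x * jb \<xi> powr (\<theta> / 2)"
        and 2: "2 \<le> jb \<xi> powr (\<theta> / 2)"
      have "norm (h \<epsilon> \<xi> x + g \<epsilon> \<xi> x) \<le> 2 * (w \<epsilon> \<xi> x * jb \<xi> powr (\<theta> / 2))"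
        using bspec[OF h x] bspec[OF g x] norm_triangle_ineq[of "h \<epsilon> \<xi> x" "g \<epsilon> \<xi> x"] by linarith
      also have "\<dots> \<le> jb \<xi> powr (\<theta> / 2) * (w \<epsilon> \<xi> x * jb \<xi> powr (\<theta> / 2))"
        by (intro mult_right_mono 2 order_trans[OF norm_ge_zero bspec[OF h x]])
      also have "\<dots> = w \<epsilon> \<xi> x * jb \<xi> powr \<theta>" by (simp add: powr_add[symmetric])
      finally show "norm (h \<epsilon> \<xi> x + g \<epsilon> \<xi> x) \<le> w \<epsilon> \<xi> x * jb \<xi> powr \<theta>" .
    qed
  qed
  from assms show ?thesis
  proof (induction n arbitrary: h g)
    case (Suc n)
    have "\<forall>\<^sub>F (\<epsilon>, \<xi>) in high_freq \<Gamma>. eq_near K (\<lambda>x. partial_deriv i (h \<epsilon> \<xi>) x + partial_deriv i (g \<epsilon> \<xi>) x)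
        (partial_deriv i (\<lambda>x. h \<epsilon> \<xi> x + g \<epsilon> \<xi> x))" for i
      using Suc.prems[THEN symbol_upto_symbol0, THEN symbol0_smooth] by eventually_elim (auto intro: smooth_near_partial_deriv_add)
    moreover have "symbol_upto n \<Gamma> K w (\<lambda>\<epsilon> \<xi> x. partial_deriv i (h \<epsilon> \<xi>) x + partial_deriv i (g \<epsilon> \<xi>) x)" for i
      using Suc.prems by (intro Suc.IH) auto
    ultimately have "symbol_upto n \<Gamma> K w (\<lambda>\<epsilon> \<xi>. partial_deriv i (\<lambda>x. h \<epsilon> \<xi> x + g \<epsilon> \<xi> x))" for i
      by (rule symbol_upto_cong)
    thus ?case using * Suc.prems[THEN symbol_upto_symbol0] by auto
  qed (auto intro: *)
qed

text \<open>
  Each factor contributes half of the exponent \<open>\<theta>\<close>.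
\<close>

lemma symbol_upto_mult:
  assumes "symbol_upto n \<Gamma> K w h" "symbol_upto n \<Gamma> K w' g"
  shows "symbol_upto n \<Gamma> K (\<lambda>\<epsilon> \<xi> x. w \<epsilon> \<xi> x * w' \<epsilon> \<xi> x) (\<lambda>\<epsilon> \<xi> x. h \<epsilon> \<xi> x * g \<epsilon> \<xi> x)"
proof -
  have *: "symbol0 \<Gamma> K (\<lambda>\<epsilon> \<xi> x. w \<epsilon> \<xi> x * w' \<epsilon> \<xi> x) (\<lambda>\<epsilon> \<xi> x. h \<epsilon> \<xi> x * g \<epsilon> \<xi> x)"
    if "symbol0 \<Gamma> K w h" "symbol0 \<Gamma> K w' g" for h g
    unfolding symbol0_def
  proof (intro conjI allI impI)
    show "\<forall>\<^sub>F (\<epsilon>, \<xi>) in high_freq \<Gamma>. smooth_near K (\<lambda>x. h \<epsilon> \<xi> x * g \<epsilon> \<xi> x)"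
      using that[THEN symbol0_smooth] by eventually_elim (auto intro: smooth_near_mult)
    fix \<theta> :: real assume \<theta>: "0 < \<theta>"
    hence "0 < \<theta> / 2" by simp
    from symbol0_bound[OF that(1) this] symbol0_bound[OF that(2) this]
    show "\<forall>\<^sub>F (\<epsilon>, \<xi>) in high_freq \<Gamma>. \<forall>x\<in>K. norm (h \<epsilon> \<xi> x * g \<epsilon> \<xi> x) \<le> w \<epsilon> \<xi> x * w' \<epsilon> \<xi> x * jb \<xi> powr \<theta>"
    proof (eventually_elim, safe)
      fix \<epsilon> \<xi> x
      assume x: "x \<in> K" and h: "\<forall>x\<in>K. norm (h \<epsilon> \<xi> x) \<le> w \<epsilon> \<xi> x * jb \<xi> powr (\<theta> / 2)"
        and g: "\<forall>x\<in>K. norm (g \<epsilon> \<xi> x) \<le> w' \<epsilon> \<xi> x * jb \<xi> powr (\<theta> / 2)"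
      have "norm (h \<epsilon> \<xi> x * g \<epsilon> \<xi> x) \<le> (w \<epsilon> \<xi> x * jb \<xi> powr (\<theta> / 2)) * (w' \<epsilon> \<xi> x * jb \<xi> powr (\<theta> / 2))"
        unfolding norm_mult
        by (intro mult_mono bspec[OF h x] bspec[OF g x] norm_ge_zero order_trans[OF norm_ge_zero bspec[OF h x]])
      also have "\<dots> = w \<epsilon> \<xi> x * w' \<epsilon> \<xi> x * (jb \<xi> powr (\<theta> / 2) * jb \<xi> powr (\<theta> / 2))" by (simp only: mult_ac)
      also have "\<dots> = w \<epsilon> \<xi> x * w' \<epsilon> \<xi> x * jb \<xi> powr \<theta>" by (simp add: powr_add[symmetric])
      finally show "norm (h \<epsilon> \<xi> x * g \<epsilon> \<xi> x) \<le> w \<epsilon> \<xi> x * w' \<epsilon> \<xi> x * jb \<xi> powr \<theta>" .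
    qed
  qed
  from assms show ?thesis
  proof (induction n arbitrary: h g)
    case (Suc n)
    have "\<forall>\<^sub>F (\<epsilon>, \<xi>) in high_freq \<Gamma>. eq_near K (\<lambda>x. partial_deriv i (h \<epsilon> \<xi>) x * g \<epsilon> \<xi> x + h \<epsilon> \<xi> x * partial_deriv i (g \<epsilon> \<xi>) x)
        (partial_deriv i (\<lambda>x. h \<epsilon> \<xi> x * g \<epsilon> \<xi> x))" for i
      using Suc.prems[THEN symbol_upto_symbol0, THEN symbol0_smooth] by eventually_elim (auto intro: smooth_near_partial_deriv_mult)
    moreover have "symbol_upto n \<Gamma> K (\<lambda>\<epsilon> \<xi> x. w \<epsilon> \<xi> x * w' \<epsilon> \<xi> x)
        (\<lambda>\<epsilon> \<xi> x. partial_deriv i (h \<epsilon> \<xi>) x * g \<epsilon> \<xi> x + h \<epsilon> \<xi> x * partial_deriv i (g \<epsilon> \<xi>) x)" for i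
      using Suc.prems Suc.prems[THEN symbol_upto_SucD] by (intro symbol_upto_add Suc.IH) auto
    ultimately have "symbol_upto n \<Gamma> K (\<lambda>\<epsilon> \<xi> x. w \<epsilon> \<xi> x * w' \<epsilon> \<xi> x) (\<lambda>\<epsilon> \<xi>. partial_deriv i (\<lambda>x. h \<epsilon> \<xi> x * g \<epsilon> \<xi> x))" for i
      by (rule symbol_upto_cong)
    thus ?case using * Suc.prems[THEN symbol_upto_symbol0] by auto
  qed (auto intro: *)
qed

lemma symbol_upto_const:
  assumes "\<And>\<theta>. 0 < \<theta> \<Longrightarrow> \<forall>\<^sub>F (\<epsilon>, \<xi>) in high_freq \<Gamma>. \<forall>x\<in>K. norm (c \<epsilon> \<xi>) \<le> w \<epsilon> \<xi> x * jb \<xi> powr \<theta>"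
  shows "symbol_upto n \<Gamma> K w (\<lambda>\<epsilon> \<xi> x. c \<epsilon> \<xi>)"
proof -
  have 0: "\<forall>\<^sub>F (\<epsilon>, \<xi>) in high_freq \<Gamma>. \<forall>x\<in>K. norm (0::complex) \<le> w \<epsilon> \<xi> x * jb \<xi> powr \<theta>" if "0 < \<theta>" for \<theta>
    using assms[OF that] by eventually_elim (auto intro: order_trans[OF norm_ge_zero])
  have z: "symbol_upto n \<Gamma> K w (\<lambda>\<epsilon> \<xi> x. 0)" for n
    by (induction n) (use 0 in \<open>auto simp: symbol0_def smooth_near_const case_prod_unfold\<close>)
  show ?thesis by (cases n) (use assms z in \<open>auto simp: symbol0_def smooth_near_const case_prod_unfold\<close>)
qed

lemma symbol_upto_zero:
  assumes "\<forall>\<^sub>F (\<epsilon>, \<xi>) in high_freq \<Gamma>. \<forall>x\<in>K. 0 \<le> w \<epsilon> \<xi> x"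
  shows "symbol_upto n \<Gamma> K w (\<lambda>\<epsilon> \<xi> x. 0)"
proof (rule symbol_upto_const)
  fix \<theta> :: real
  from assms show "\<forall>\<^sub>F (\<epsilon>, \<xi>) in high_freq \<Gamma>. \<forall>x\<in>K. norm (0::complex) \<le> w \<epsilon> \<xi> x * jb \<xi> powr \<theta>"
    by eventually_elim auto
qed

lemma symbol_upto_cmult:
  assumes "symbol_upto n \<Gamma> K w h"
  shows "symbol_upto n \<Gamma> K w (\<lambda>\<epsilon> \<xi> x. c * h \<epsilon> \<xi> x)"
proof -
  have "symbol_upto n \<Gamma> K (\<lambda>_ _ _. 1) (\<lambda>_ _ _. c)"
  proof (rule symbol_upto_const)
    fix \<theta> :: real assume "0 < \<theta>"
    from eventually_const_le_jb[OF this, of "norm c" \<Gamma>]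
    show "\<forall>\<^sub>F (\<epsilon>, \<xi>) in high_freq \<Gamma>. \<forall>x\<in>K. norm c \<le> 1 * jb \<xi> powr \<theta>"
      by eventually_elim auto
  qed
  from symbol_upto_mult[OF this assms] show ?thesis by simp
qed

lemma symbol_upto_sum:
  assumes "finite I" "\<And>i. i \<in> I \<Longrightarrow> symbol_upto n \<Gamma> K w (h i)"
    "\<forall>\<^sub>F (\<epsilon>, \<xi>) in high_freq \<Gamma>. \<forall>x\<in>K. 0 \<le> w \<epsilon> \<xi> x"
  shows "symbol_upto n \<Gamma> K w (\<lambda>\<epsilon> \<xi> x. \<Sum>i\<in>I. h i \<epsilon> \<xi> x)"
  using assms(1,2) by (induction I rule: finite_induct) (auto intro!: symbol_upto_add symbol_upto_zero assms(3))

text \<open>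
  Functions that depend on neither parameter are symbols of weight 1, since constants are dominated by
  powers of \<open>1 + |\<xi>|\<close>.
\<close>

lemma symbol_upto_fixed:
  assumes "compact K" "smooth_near K f"
  shows "symbol_upto n \<Gamma> K (\<lambda>_ _ _. 1) (\<lambda>_ _. f)"
proof -
  have *: "symbol0 \<Gamma> K (\<lambda>_ _ _. 1) (\<lambda>_ _. f)" if f: "smooth_near K f" for f
    unfolding symbol0_def
  proof (intro conjI allI impI)
    fix \<theta> :: real assume "0 < \<theta>"
    have "continuous_on K f"
      using f smooth_on_continuous_on continuous_on_subset unfolding smooth_near_def by blast
    hence "compact (f ` K)" using assms(1) compact_continuous_image by blast
    then obtain B where B: "\<And>x. x \<in> K \<Longrightarrow> norm (f x) \<le> B"
      using compact_imp_bounded bounded_pos by (metis imageI)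
    from eventually_const_le_jb[OF \<open>0 < \<theta>\<close>, of B \<Gamma>]
    show "\<forall>\<^sub>F (\<epsilon>, \<xi>) in high_freq \<Gamma>. \<forall>x\<in>K. norm (f x) \<le> 1 * jb \<xi> powr \<theta>"
      by eventually_elim (use B in force)
  qed (simp add: f case_prod_unfold)
  from assms(2) show ?thesis by (induction n arbitrary: f) (auto intro: * smooth_near_partial_deriv)
qed

text \<open>
  A derivative of \<open>1 / p\<close> is \<open>- (1 / p) (1 / p) \<partial>p\<close>, which involves \<open>1 / p\<close> itself only to the order for
  which the claim is already known; the three weights multiply to \<open>1 / w\<close>.
\<close>

lemma symbol_upto_inverse:
  assumes p: "\<And>n. symbol_upto n \<Gamma> K w p"
    and pos: "\<forall>\<^sub>F (\<epsilon>, \<xi>) in high_freq \<Gamma>. \<forall>x\<in>K. 0 < w \<epsilon> \<xi> x"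
    and low: "\<And>\<theta>. 0 < \<theta> \<Longrightarrow> \<forall>\<^sub>F (\<epsilon>, \<xi>) in high_freq \<Gamma>. \<forall>x\<in>K. w \<epsilon> \<xi> x \<le> norm (p \<epsilon> \<xi> x) * jb \<xi> powr \<theta>"
  shows "symbol_upto n \<Gamma> K (\<lambda>\<epsilon> \<xi> x. 1 / w \<epsilon> \<xi> x) (\<lambda>\<epsilon> \<xi> x. inverse (p \<epsilon> \<xi> x))"
proof -
  have nz: "\<forall>\<^sub>F (\<epsilon>, \<xi>) in high_freq \<Gamma>. \<forall>x\<in>K. p \<epsilon> \<xi> x \<noteq> 0"
    using low[OF zero_less_one] pos by eventually_elim force
  have 0: "symbol0 \<Gamma> K (\<lambda>\<epsilon> \<xi> x. 1 / w \<epsilon> \<xi> x) (\<lambda>\<epsilon> \<xi> x. inverse (p \<epsilon> \<xi> x))"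
    unfolding symbol0_def
  proof (intro conjI allI impI)
    show "\<forall>\<^sub>F (\<epsilon>, \<xi>) in high_freq \<Gamma>. smooth_near K (\<lambda>x. inverse (p \<epsilon> \<xi> x))"
      using symbol0_smooth[OF symbol_upto_symbol0[OF p]] nz by eventually_elim (auto intro: smooth_near_inverse)
    fix \<theta> :: real assume "0 < \<theta>"
    from low[OF this] pos nz
    show "\<forall>\<^sub>F (\<epsilon>, \<xi>) in high_freq \<Gamma>. \<forall>x\<in>K. norm (inverse (p \<epsilon> \<xi> x)) \<le> 1 / w \<epsilon> \<xi> x * jb \<xi> powr \<theta>"
    proof (eventually_elim, safe)
      fix \<epsilon> \<xi> x
      assume x: "x \<in> K" and a: "\<forall>x\<in>K. w \<epsilon> \<xi> x \<le> norm (p \<epsilon> \<xi> x) * jb \<xi> powr \<theta>"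
        "\<forall>x\<in>K. 0 < w \<epsilon> \<xi> x" "\<forall>x\<in>K. p \<epsilon> \<xi> x \<noteq> 0"
      have "0 < norm (p \<epsilon> \<xi> x)" "0 < w \<epsilon> \<xi> x" using a x by auto
      thus "norm (inverse (p \<epsilon> \<xi> x)) \<le> 1 / w \<epsilon> \<xi> x * jb \<xi> powr \<theta>"
        using bspec[OF a(1) x] by (simp add: norm_inverse norm_divide field_simps)
    qed
  qed
  show ?thesis
  proof (induction n)
    case (Suc n)
    let ?w = "\<lambda>\<epsilon> \<xi> x. 1 / w \<epsilon> \<xi> x"
    have "symbol_upto n \<Gamma> K ?w (\<lambda>\<epsilon> \<xi>. partial_deriv i (\<lambda>x. inverse (p \<epsilon> \<xi> x)))" for i
    proof (rule symbol_upto_cong)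
      show "\<forall>\<^sub>F (\<epsilon>, \<xi>) in high_freq \<Gamma>. eq_near K (\<lambda>x. - 1 * (inverse (p \<epsilon> \<xi> x) * inverse (p \<epsilon> \<xi> x) * partial_deriv i (p \<epsilon> \<xi>) x))
          (partial_deriv i (\<lambda>x. inverse (p \<epsilon> \<xi> x)))"
        using symbol0_smooth[OF symbol_upto_symbol0[OF p]] nz by eventually_elim (blast intro: smooth_near_partial_deriv_inverse)
      have "symbol_upto n \<Gamma> K w (\<lambda>\<epsilon> \<xi>. partial_deriv i (p \<epsilon> \<xi>))" using p[of "Suc n"] by simp
      hence "symbol_upto n \<Gamma> K (\<lambda>\<epsilon> \<xi> x. ?w \<epsilon> \<xi> x * ?w \<epsilon> \<xi> x * w \<epsilon> \<xi> x)
          (\<lambda>\<epsilon> \<xi> x. inverse (p \<epsilon> \<xi> x) * inverse (p \<epsilon> \<xi> x) * partial_deriv i (p \<epsilon> \<xi>) x)"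
        by (intro symbol_upto_mult Suc.IH)
      hence "symbol_upto n \<Gamma> K ?w (\<lambda>\<epsilon> \<xi> x. inverse (p \<epsilon> \<xi> x) * inverse (p \<epsilon> \<xi> x) * partial_deriv i (p \<epsilon> \<xi>) x)"
        by (rule symbol_upto_mono[rotated]) (rule eventually_mono[OF pos], auto)
      thus "symbol_upto n \<Gamma> K ?w (\<lambda>\<epsilon> \<xi> x. - 1 * (inverse (p \<epsilon> \<xi> x) * inverse (p \<epsilon> \<xi> x) * partial_deriv i (p \<epsilon> \<xi>) x))"
        by (rule symbol_upto_cmult)
    qed
    thus ?case using 0 by simp
  qed (use 0 in simp)
qed

lemma symbol_upto_lists:
  assumes "symbol_upto n \<Gamma> K w h" "0 < \<theta>"
  shows "\<forall>\<^sub>F (\<epsilon>, \<xi>) in high_freq \<Gamma>. \<forall>is. length is \<le> n \<longrightarrow> (\<forall>x\<in>K. norm (pderivs is (h \<epsilon> \<xi>) x) \<le> w \<epsilon> \<xi> x * jb \<xi> powr \<theta>)"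
  using assms(1)
proof (induction n arbitrary: h)
  case 0
  from symbol0_bound[OF symbol_upto_symbol0[OF 0] assms(2)] show ?case by eventually_elim auto
next
  case (Suc n)
  have "\<forall>\<^sub>F p in high_freq \<Gamma>. \<forall>i. case p of (\<epsilon>, \<xi>) \<Rightarrow> \<forall>is. length is \<le> n \<longrightarrow> (\<forall>x\<in>K. norm (pderivs is (partial_deriv i (h \<epsilon> \<xi>)) x) \<le> w \<epsilon> \<xi> x * jb \<xi> powr \<theta>)"
    by (rule eventually_all_finite, rule Suc.IH) (use Suc.prems in auto)
  with symbol0_bound[OF symbol_upto_symbol0[OF Suc.prems] assms(2)] show ?case
  proof (eventually_elim, safe)
    fix \<epsilon> \<xi> x and "is" :: "'a list"
    assume 0: "\<forall>x\<in>K. norm (h \<epsilon> \<xi> x) \<le> w \<epsilon> \<xi> x * jb \<xi> powr \<theta>"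
      and 1: "\<forall>i. \<forall>is. length is \<le> n \<longrightarrow> (\<forall>x\<in>K. norm (pderivs is (partial_deriv i (h \<epsilon> \<xi>)) x) \<le> w \<epsilon> \<xi> x * jb \<xi> powr \<theta>)"
      and "length is \<le> Suc n" "x \<in> K"
    thus "norm (pderivs is (h \<epsilon> \<xi>) x) \<le> w \<epsilon> \<xi> x * jb \<xi> powr \<theta>"
      by (cases "is" rule: rev_cases) auto
  qed
qed

text \<open>
  The form in which assumptions on all the derivatives of a net enter the calculus.
\<close>

lemma symbol_uptoI_lists:
  assumes "\<forall>\<^sub>F (\<epsilon>, \<xi>) in high_freq \<Gamma>. smooth_near K (h \<epsilon> \<xi>)"
    and "\<And>is \<theta>. 0 < \<theta> \<Longrightarrow> \<forall>\<^sub>F (\<epsilon>, \<xi>) in high_freq \<Gamma>. \<forall>x\<in>K. norm (pderivs is (h \<epsilon> \<xi>) x) \<le> w \<epsilon> \<xi> x * jb \<xi> powr \<theta>"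
  shows "symbol_upto n \<Gamma> K w h"
  using assms
proof (induction n arbitrary: h)
  case 0
  thus ?case using "0.prems"(2)[of _ "[]"] by (simp add: symbol0_def)
next
  case (Suc n)
  have "symbol_upto n \<Gamma> K w (\<lambda>\<epsilon> \<xi>. partial_deriv i (h \<epsilon> \<xi>))" for i
  proof (rule Suc.IH)
    show "\<forall>\<^sub>F (\<epsilon>, \<xi>) in high_freq \<Gamma>. smooth_near K (partial_deriv i (h \<epsilon> \<xi>))"
      using Suc.prems(1) by eventually_elim (auto intro: smooth_near_partial_deriv)
    fix "is" and \<theta> :: real assume "0 < \<theta>"
    from Suc.prems(2)[OF this, of "is @ [i]"]
    show "\<forall>\<^sub>F (\<epsilon>, \<xi>) in high_freq \<Gamma>. \<forall>x\<in>K. norm (pderivs is (partial_deriv i (h \<epsilon> \<xi>)) x) \<le> w \<epsilon> \<xi> x * jb \<xi> powr \<theta>"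
      by simp
  qed
  thus ?case using Suc.prems(1) Suc.prems(2)[of _ "[]"] by (simp add: symbol0_def)
qed

section \<open>The transposed operator\<close>

text \<open>
  The Fourier transform at \<open>\<xi>\<close> of \<open>f b\<close>, where \<open>b\<close> may itself depend on \<open>\<xi>\<close>.
\<close>

definition osc_integral :: "'n::finite net \<Rightarrow> 'n family \<Rightarrow> real \<Rightarrow> real^'n \<Rightarrow> complex" where
  "osc_integral f b \<epsilon> \<xi> = (LINT x|lborel. f \<epsilon> x * b \<epsilon> \<xi> x * wave \<xi> x)"

definition local_fourier :: "(real^'n::finite \<Rightarrow> complex) \<Rightarrow> 'n net \<Rightarrow> real \<Rightarrow> real^'n \<Rightarrow> complex" where
  "local_fourier \<phi> f \<epsilon> = fourier (\<lambda>x. \<phi> x * f \<epsilon> x)"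

lemma local_fourier_eq_osc: "local_fourier \<phi> f \<epsilon> \<xi> = osc_integral f (\<lambda>_ _. \<phi>) \<epsilon> \<xi>"
  by (simp add: local_fourier_def osc_integral_def fourier_wave mult.commute[of "\<phi> _"])

lemma finite_mi_le: "finite {\<alpha> :: 'n::finite multi_index. mi_abs \<alpha> \<le> m}"
proof (rule finite_subset)
  show "{\<alpha> :: 'n multi_index. mi_abs \<alpha> \<le> m} \<subseteq> UNIV \<rightarrow>\<^sub>E {..m}"
  proof
    fix \<alpha> :: "'n multi_index" assume "\<alpha> \<in> {\<alpha>. mi_abs \<alpha> \<le> m}"
    hence "mi_abs \<alpha> \<le> m" by simp
    moreover have "\<alpha> i \<le> mi_abs \<alpha>" for i unfolding mi_abs_def by (rule member_le_sum) auto
    ultimately show "\<alpha> \<in> UNIV \<rightarrow>\<^sub>E {..m}" by (auto intro: order_trans)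
  qed
qed (auto intro: finite_PiE)

lemma finite_mi_eq: "finite {\<alpha> :: 'n::finite multi_index. mi_abs \<alpha> = m}"
  by (rule finite_subset[OF _ finite_mi_le[of m]]) auto

text \<open>
  The operator \<open>\<xi>\<^sub>i - D\<^sub>i\<close>, that is the transpose of \<open>D\<^sub>i\<close> conjugated by the plane wave.
\<close>

definition transp1 :: "'n::finite \<Rightarrow> real^'n \<Rightarrow> (real^'n \<Rightarrow> complex) \<Rightarrow> real^'n \<Rightarrow> complex" where
  "transp1 i \<xi> h x = complex_of_real (\<xi> $ i) * h x + \<i> * partial_deriv i h x"

primrec transp_list :: "'n::finite list \<Rightarrow> real^'n \<Rightarrow> (real^'n \<Rightarrow> complex) \<Rightarrow> real^'n \<Rightarrow> complex" where
  "transp_list [] \<xi> h = h"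
| "transp_list (i # is) \<xi> h = transp_list is \<xi> (transp1 i \<xi> h)"

definition list_power :: "'n::finite list \<Rightarrow> real^'n \<Rightarrow> real" where
  "list_power is \<xi> = (\<Prod>i\<leftarrow>is. \<xi> $ i)"

lemma list_power_mi_list: "list_power (mi_list \<alpha>) \<xi> = mi_power \<xi> \<alpha>"
proof -
  have r: "(\<Prod>i\<leftarrow>replicate n j. \<xi> $ i) = (\<xi> $ j) ^ n" for n j by (induction n) auto
  have "(\<Prod>i\<leftarrow>concat (map (\<lambda>i. replicate (\<alpha> i) i) xs). \<xi> $ i) = (\<Prod>i\<leftarrow>xs. (\<xi> $ i) ^ \<alpha> i)" for xs
    by (induction xs) (auto simp: r)
  moreover have "(\<Prod>i\<leftarrow>coords. (\<xi> $ i) ^ \<alpha> i) = (\<Prod>i\<in>UNIV. (\<xi> $ i) ^ \<alpha> i)"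
    using prod.distinct_set_conv_list[OF coords(1), of "\<lambda>i. (\<xi> $ i) ^ \<alpha> i"] by (simp add: coords(2))
  ultimately show ?thesis by (simp add: list_power_def mi_list_def mi_power_def)
qed

lemma abs_list_power_le: "\<bar>list_power is \<xi>\<bar> \<le> norm \<xi> ^ length is"
proof (induction "is")
  case (Cons i "is")
  have "\<bar>\<xi> $ i\<bar> * \<bar>list_power is \<xi>\<bar> \<le> norm \<xi> * norm \<xi> ^ length is"
    by (intro mult_mono Cons component_le_norm_cart) auto
  thus ?case by (simp add: list_power_def abs_mult)
qed (simp add: list_power_def)

lemma csmooth_add: "csmooth K f \<Longrightarrow> csmooth K g \<Longrightarrow> csmooth K (\<lambda>x. f x + g x)"
  by (auto simp: csmooth_def intro: smooth_on_add)

lemma csmooth_cmult: "csmooth K f \<Longrightarrow> csmooth K (\<lambda>x. c * f x)"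
  by (auto simp: csmooth_def intro: smooth_on_mult smooth_on_const)

lemma csmooth_sum: "(\<And>i. i \<in> I \<Longrightarrow> csmooth K (f i)) \<Longrightarrow> csmooth K (\<lambda>x. \<Sum>i\<in>I. f i x)"
  by (auto simp: csmooth_def intro!: smooth_on_sum sum.neutral)

lemma csmooth_transp1: "compact K \<Longrightarrow> csmooth K h \<Longrightarrow> csmooth K (transp1 i \<xi> h)"
  unfolding transp1_def[abs_def] by (intro csmooth_add csmooth_cmult csmooth_partial_deriv)

lemma csmooth_transp_list: "compact K \<Longrightarrow> csmooth K h \<Longrightarrow> csmooth K (transp_list is \<xi> h)"
  by (induction "is" arbitrary: h) (auto intro: csmooth_transp1)

lemma csmooth_near:
  assumes "compact K" "smooth_near K f" "\<And>x. x \<notin> K \<Longrightarrow> f x = 0"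
  shows "csmooth K f"
proof -
  obtain V where V: "open V" "K \<subseteq> V" "smooth_on V f" using assms(2) by (auto simp: smooth_near_def)
  have "smooth_on (- K) f"
    by (rule smooth_on_cong[OF _ _ smooth_on_const[of _ 0]]) (use assms in \<open>auto simp: compact_imp_closed open_Compl\<close>)
  hence "smooth_on (V \<union> - K) f" using V assms(1) by (intro smooth_on_Un) (auto simp: compact_imp_closed open_Compl)
  moreover have "V \<union> - K = UNIV" using V by auto
  ultimately show ?thesis using assms(3) by (simp add: csmooth_def)
qed

lemma csmooth_smooth_near: "csmooth K f \<Longrightarrow> smooth_near K f"
  using smooth_near_on[of UNIV K f] by (simp add: csmooth_def)

text \<open>
  Each integration by parts moves the outermost derivative of \<open>v\<close> to \<open>h e\<^sub>\<xi>\<close>, and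
  \<open>\<i> \<partial>\<^sub>i (h e\<^sub>\<xi>) = ((\<xi>\<^sub>i - D\<^sub>i) h) e\<^sub>\<xi>\<close>.
\<close>

lemma integral_transp_list:
  assumes K: "compact K" and S: "open S" "K \<subseteq> S" and v: "smooth_on S v" and h: "csmooth K h"
  shows "(LINT x|lborel. (- \<i>) ^ length is * pderivs is v x * h x * wave \<xi> x) = (LINT x|lborel. v x * transp_list is \<xi> h x * wave \<xi> x)"
  using h
proof (induction "is" arbitrary: h)
  case (Cons i "is")
  have "(LINT x|lborel. (- \<i>) ^ length (i # is) * pderivs (i # is) v x * h x * wave \<xi> x)
      = (- \<i>) ^ length (i # is) * (LINT x|lborel. partial_deriv i (pderivs is v) x * (h x * wave \<xi> x))"
    unfolding integral_mult_right_zero[symmetric] by (simp add: mult_ac)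
  also have "(LINT x|lborel. partial_deriv i (pderivs is v) x * (h x * wave \<xi> x))
      = - (LINT x|lborel. pderivs is v x * partial_deriv i (\<lambda>x. h x * wave \<xi> x) x)"
    by (rule integral_by_parts[OF K S smooth_on_pderivs[OF v] csmooth_wave[OF K Cons.prems]])
  also have "(- \<i>) ^ length (i # is) * - (LINT x|lborel. pderivs is v x * partial_deriv i (\<lambda>x. h x * wave \<xi> x) x)
      = (LINT x|lborel. (- \<i>) ^ length is * pderivs is v x * (\<i> * partial_deriv i (\<lambda>x. h x * wave \<xi> x) x))"
  proof -
    have "(- \<i>) ^ length (i # is) * - (LINT x|lborel. pderivs is v x * partial_deriv i (\<lambda>x. h x * wave \<xi> x) x)
      = ((- \<i>) ^ length is * \<i>) * (LINT x|lborel. pderivs is v x * partial_deriv i (\<lambda>x. h x * wave \<xi> x) x)" by simp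
    thus ?thesis unfolding integral_mult_right_zero[symmetric] by (simp add: mult_ac)
  qed
  also have "\<dots> = (LINT x|lborel. (- \<i>) ^ length is * pderivs is v x * transp1 i \<xi> h x * wave \<xi> x)"
  proof (intro Bochner_Integration.integral_cong refl)
    fix x
    have "h differentiable (at x)" using Cons.prems by (auto simp: csmooth_def intro: smooth_on_differentiable)
    hence "\<i> * partial_deriv i (\<lambda>x. h x * wave \<xi> x) x = transp1 i \<xi> h x * wave \<xi> x"
      unfolding transp1_def by (subst partial_deriv_times_wave) (simp_all add: algebra_simps)
    thus "(- \<i>) ^ length is * pderivs is v x * (\<i> * partial_deriv i (\<lambda>x. h x * wave \<xi> x) x)
      = (- \<i>) ^ length is * pderivs is v x * transp1 i \<xi> h x * wave \<xi> x" by (simp only: mult.assoc)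
  qed
  also have "\<dots> = (LINT x|lborel. v x * transp_list (i # is) \<xi> h x * wave \<xi> x)"
    using Cons.IH[OF csmooth_transp1[OF K Cons.prems]] by simp
  finally show ?case .
qed simp

text \<open>
  The operator \<open>L h = \<Sum>\<alpha>. (\<xi> - D)\<^sup>\<alpha> (a\<^sub>\<alpha> h)\<close>.
\<close>

definition transp_op :: "nat \<Rightarrow> ('n::finite multi_index \<Rightarrow> 'n net) \<Rightarrow> real \<Rightarrow> real^'n \<Rightarrow> (real^'n \<Rightarrow> complex) \<Rightarrow> real^'n \<Rightarrow> complex" where
  "transp_op m a \<epsilon> \<xi> h x = (\<Sum>\<alpha> | mi_abs \<alpha> \<le> m. transp_list (mi_list \<alpha>) \<xi> (\<lambda>x. a \<alpha> \<epsilon> x * h x) x)"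

lemma D_deriv_pderivs: "D_deriv \<alpha> f x = (- \<i>) ^ length (mi_list \<alpha>) * pderivs (mi_list \<alpha>) f x"
  by (simp add: D_deriv_def mi_deriv_eq_pderivs length_mi_list)

lemma csmooth_transp_op:
  assumes "compact K" "open S" "K \<subseteq> S" "\<And>\<alpha>. mi_abs \<alpha> \<le> m \<Longrightarrow> smooth_on S (a \<alpha> \<epsilon>)" "csmooth K h"
  shows "csmooth K (transp_op m a \<epsilon> \<xi> h)"
  unfolding transp_op_def[abs_def] using assms by (intro csmooth_sum csmooth_transp_list csmooth_mult) auto

lemma integral_transp_op:
  fixes v :: "'n::finite net"
  assumes K: "compact K" and S: "open S" "K \<subseteq> S" and v: "smooth_on S (v \<epsilon>)"
    and a: "\<And>\<alpha>. mi_abs \<alpha> \<le> m \<Longrightarrow> smooth_on S (a \<alpha> \<epsilon>)" and h: "csmooth K h"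
  shows "(LINT x|lborel. diff_op_net m a v \<epsilon> x * h x * wave \<xi> x) = (LINT x|lborel. v \<epsilon> x * transp_op m a \<epsilon> \<xi> h x * wave \<xi> x)"
proof -
  let ?M = "{\<alpha> :: 'n multi_index. mi_abs \<alpha> \<le> m}"
  have ah: "csmooth K (\<lambda>x. a \<alpha> \<epsilon> x * h x)" if "\<alpha> \<in> ?M" for \<alpha>
    using that by (intro csmooth_mult[OF K S] a h) simp
  have "(LINT x|lborel. diff_op_net m a v \<epsilon> x * h x * wave \<xi> x)
      = (LINT x|lborel. (\<Sum>\<alpha>\<in>?M. (- \<i>) ^ length (mi_list \<alpha>) * pderivs (mi_list \<alpha>) (v \<epsilon>) x * (a \<alpha> \<epsilon> x * h x) * wave \<xi> x))"
    unfolding diff_op_net_def D_deriv_pderivs sum_distrib_right by (simp only: mult_ac)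
  also have "\<dots> = (\<Sum>\<alpha>\<in>?M. (LINT x|lborel. (- \<i>) ^ length (mi_list \<alpha>) * pderivs (mi_list \<alpha>) (v \<epsilon>) x * (a \<alpha> \<epsilon> x * h x) * wave \<xi> x))"
  proof (rule Bochner_Integration.integral_sum)
    fix \<alpha> assume \<alpha>: "\<alpha> \<in> ?M"
    have "csmooth K (\<lambda>x. (- \<i>) ^ length (mi_list \<alpha>) * (pderivs (mi_list \<alpha>) (v \<epsilon>) x * (a \<alpha> \<epsilon> x * h x)))"
      by (intro csmooth_cmult csmooth_mult[OF K S] smooth_on_pderivs v ah \<alpha>)
    from csmooth_integrable[OF K csmooth_wave[OF K this, of \<xi>]]
    show "integrable lborel (\<lambda>x. (- \<i>) ^ length (mi_list \<alpha>) * pderivs (mi_list \<alpha>) (v \<epsilon>) x * (a \<alpha> \<epsilon> x * h x) * wave \<xi> x)"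
      by (simp only: mult_ac)
  qed
  also have "\<dots> = (\<Sum>\<alpha>\<in>?M. (LINT x|lborel. v \<epsilon> x * transp_list (mi_list \<alpha>) \<xi> (\<lambda>x. a \<alpha> \<epsilon> x * h x) x * wave \<xi> x))"
    by (intro sum.cong refl integral_transp_list[OF K S v] ah)
  also have "\<dots> = (LINT x|lborel. (\<Sum>\<alpha>\<in>?M. v \<epsilon> x * transp_list (mi_list \<alpha>) \<xi> (\<lambda>x. a \<alpha> \<epsilon> x * h x) x * wave \<xi> x))"
    by (rule Bochner_Integration.integral_sum[symmetric])
       (intro csmooth_integrable[OF K] csmooth_wave[OF K] csmooth_mult[OF K S] v csmooth_transp_list[OF K] ah)
  also have "\<dots> = (LINT x|lborel. v \<epsilon> x * transp_op m a \<epsilon> \<xi> h x * wave \<xi> x)"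
    unfolding transp_op_def sum_distrib_left sum_distrib_right ..
  finally show ?thesis .
qed

section \<open>Symbols of the transposed operator\<close>

abbreviation symbol :: "(real^'n::finite) set \<Rightarrow> (real^'n) set \<Rightarrow> 'n weights \<Rightarrow> 'n family \<Rightarrow> bool" where
  "symbol \<Gamma> K w h \<equiv> \<forall>n. symbol_upto n \<Gamma> K w h"

lemma symbol_partial_deriv: "symbol \<Gamma> K w h \<Longrightarrow> symbol \<Gamma> K w (\<lambda>\<epsilon> \<xi>. partial_deriv i (h \<epsilon> \<xi>))"
  by (metis symbol_upto.simps(2))

lemma symbol_symbol0: "symbol \<Gamma> K w h \<Longrightarrow> symbol0 \<Gamma> K w h"
  using symbol_upto_symbol0 by blast

lemma symbol0_nonneg:
  assumes "symbol0 \<Gamma> K w h"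
  shows "\<forall>\<^sub>F (\<epsilon>, \<xi>) in high_freq \<Gamma>. \<forall>x\<in>K. 0 \<le> w \<epsilon> \<xi> x"
  using symbol0_bound[OF assms zero_less_one]
proof (eventually_elim, safe)
  fix \<epsilon> \<xi> x assume "\<forall>x\<in>K. norm (h \<epsilon> \<xi> x) \<le> w \<epsilon> \<xi> x * jb \<xi> powr 1" "x \<in> K"
  hence "0 \<le> w \<epsilon> \<xi> x * jb \<xi> powr 1" by (meson norm_ge_zero order_trans)
  thus "0 \<le> w \<epsilon> \<xi> x" using jb_pos(1)[of \<xi>] by (auto simp: zero_le_mult_iff)
qed

lemma one_le_jb_powr: "0 \<le> t \<Longrightarrow> 1 \<le> jb \<xi> powr t"
  by (rule ge_one_powr_ge_zero) auto

lemma jb_powr_mono: "s \<le> t \<Longrightarrow> jb \<xi> powr s \<le> jb \<xi> powr t"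
  by (rule powr_mono) auto

lemma symbol_mono_powr:
  assumes "symbol \<Gamma> K (\<lambda>\<epsilon> \<xi> x. w \<epsilon> \<xi> x * jb \<xi> powr s) h" "s \<le> t"
  shows "symbol \<Gamma> K (\<lambda>\<epsilon> \<xi> x. w \<epsilon> \<xi> x * jb \<xi> powr t) h"
proof
  fix n
  show "symbol_upto n \<Gamma> K (\<lambda>\<epsilon> \<xi> x. w \<epsilon> \<xi> x * jb \<xi> powr t) h"
  proof (rule symbol_upto_mono[OF _ assms(1)[rule_format]])
    show "\<forall>\<^sub>F (\<epsilon>, \<xi>) in high_freq \<Gamma>. \<forall>x\<in>K. w \<epsilon> \<xi> x * jb \<xi> powr s \<le> w \<epsilon> \<xi> x * jb \<xi> powr t"
      using symbol0_nonneg[OF symbol_symbol0[OF assms(1)]]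
      by eventually_elim (auto simp: zero_le_mult_iff intro!: mult_left_mono jb_powr_mono assms(2))
  qed
qed

lemma symbol_upto_list_power: "symbol_upto n \<Gamma> K (\<lambda>\<epsilon> \<xi> x. jb \<xi> powr length is) (\<lambda>\<epsilon> \<xi> x. complex_of_real (list_power is \<xi>))"
proof (rule symbol_upto_const)
  fix \<theta> :: real assume "0 < \<theta>"
  have "norm (complex_of_real (list_power is \<xi>)) \<le> jb \<xi> powr length is * jb \<xi> powr \<theta>" for \<xi>
  proof -
    have "\<bar>list_power is \<xi>\<bar> \<le> norm \<xi> ^ length is" by (rule abs_list_power_le)
    also have "\<dots> \<le> jb \<xi> ^ length is" by (intro power_mono) auto
    also have "\<dots> * 1 \<le> jb \<xi> ^ length is * jb \<xi> powr \<theta>"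
      using \<open>0 < \<theta>\<close> by (intro mult_left_mono one_le_jb_powr) auto
    finally show ?thesis by (simp add: powr_realpow)
  qed
  thus "\<forall>\<^sub>F (\<epsilon>, \<xi>) in high_freq \<Gamma>. \<forall>x\<in>K. norm (complex_of_real (list_power is \<xi>)) \<le> jb \<xi> powr length is * jb \<xi> powr \<theta>"
    by (simp add: case_prod_unfold)
qed

lemma symbol_list_power_mult:
  assumes "symbol \<Gamma> K (\<lambda>\<epsilon> \<xi> x. w \<epsilon> \<xi> x * jb \<xi> powr t) h"
  shows "symbol \<Gamma> K (\<lambda>\<epsilon> \<xi> x. w \<epsilon> \<xi> x * jb \<xi> powr (t + length is)) (\<lambda>\<epsilon> \<xi> x. complex_of_real (list_power is \<xi>) * h \<epsilon> \<xi> x)"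
  using symbol_upto_mult[OF assms[rule_format] symbol_upto_list_power[of _ \<Gamma> K "is"]]
  by (simp add: powr_add mult_ac)

lemma symbol_transp1:
  assumes "symbol \<Gamma> K (\<lambda>\<epsilon> \<xi> x. w \<epsilon> \<xi> x * jb \<xi> powr t) h"
  shows "symbol \<Gamma> K (\<lambda>\<epsilon> \<xi> x. w \<epsilon> \<xi> x * jb \<xi> powr (t + 1)) (\<lambda>\<epsilon> \<xi>. transp1 i \<xi> (h \<epsilon> \<xi>))"
proof -
  have "symbol \<Gamma> K (\<lambda>\<epsilon> \<xi> x. w \<epsilon> \<xi> x * jb \<xi> powr (t + 1)) (\<lambda>\<epsilon> \<xi> x. complex_of_real (\<xi> $ i) * h \<epsilon> \<xi> x)"
    using symbol_list_power_mult[OF assms, of "[i]"] by (simp add: list_power_def)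
  moreover have "symbol \<Gamma> K (\<lambda>\<epsilon> \<xi> x. w \<epsilon> \<xi> x * jb \<xi> powr (t + 1)) (\<lambda>\<epsilon> \<xi>. partial_deriv i (h \<epsilon> \<xi>))"
    by (rule symbol_mono_powr[OF symbol_partial_deriv[OF assms]]) simp
  ultimately show ?thesis unfolding transp1_def[abs_def] by (auto intro!: symbol_upto_add symbol_upto_cmult)
qed

lemma symbol_transp_list:
  assumes "symbol \<Gamma> K (\<lambda>\<epsilon> \<xi> x. w \<epsilon> \<xi> x * jb \<xi> powr t) h"
  shows "symbol \<Gamma> K (\<lambda>\<epsilon> \<xi> x. w \<epsilon> \<xi> x * jb \<xi> powr (t + length is)) (\<lambda>\<epsilon> \<xi>. transp_list is \<xi> (h \<epsilon> \<xi>))"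
  using assms
proof (induction "is" arbitrary: h t)
  case (Cons i "is")
  from Cons.IH[OF symbol_transp1[OF Cons.prems]] show ?case by (simp add: add_ac)
qed simp

text \<open>
  Expanding \<open>(\<xi> - D)\<^sup>\<alpha> h\<close>, every term but \<open>\<xi>\<^sup>\<alpha> h\<close> has lost at least one factor of \<open>\<xi>\<close> to a derivative of
  \<open>h\<close>, and derivatives of a symbol are symbols of the same weight.
\<close>

lemma symbol_transp_list_diff:
  assumes "symbol \<Gamma> K (\<lambda>\<epsilon> \<xi> x. w \<epsilon> \<xi> x * jb \<xi> powr t) h"
  shows "symbol \<Gamma> K (\<lambda>\<epsilon> \<xi> x. w \<epsilon> \<xi> x * jb \<xi> powr (t + length is - 1))
    (\<lambda>\<epsilon> \<xi> x. transp_list is \<xi> (h \<epsilon> \<xi>) x - complex_of_real (list_power is \<xi>) * h \<epsilon> \<xi> x)"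
  using assms
proof (induction "is" arbitrary: h t)
  case Nil
  have "\<forall>\<^sub>F (\<epsilon>, \<xi>) in high_freq \<Gamma>. \<forall>x\<in>K. 0 \<le> w \<epsilon> \<xi> x * jb \<xi> powr (t - 1)"
    using symbol0_nonneg[OF symbol_symbol0[OF Nil]] by eventually_elim (auto simp: zero_le_mult_iff)
  from symbol_upto_zero[OF this] show ?case by (simp add: list_power_def)
next
  case (Cons i "is")
  let ?W = "\<lambda>\<epsilon> \<xi> x. w \<epsilon> \<xi> x * jb \<xi> powr (t + length (i # is) - 1)"
  have "symbol \<Gamma> K ?W (\<lambda>\<epsilon> \<xi> x. transp_list is \<xi> (transp1 i \<xi> (h \<epsilon> \<xi>)) x - complex_of_real (list_power is \<xi>) * transp1 i \<xi> (h \<epsilon> \<xi>) x)"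
    using Cons.IH[OF symbol_transp1[OF Cons.prems]] by (simp add: algebra_simps)
  moreover have "symbol \<Gamma> K ?W (\<lambda>\<epsilon> \<xi> x. \<i> * (complex_of_real (list_power is \<xi>) * partial_deriv i (h \<epsilon> \<xi>) x))"
    using symbol_list_power_mult[OF symbol_partial_deriv[OF Cons.prems], of "is" i] by (auto intro!: symbol_upto_cmult)
  ultimately have "symbol \<Gamma> K ?W (\<lambda>\<epsilon> \<xi> x. (transp_list is \<xi> (transp1 i \<xi> (h \<epsilon> \<xi>)) x - complex_of_real (list_power is \<xi>) * transp1 i \<xi> (h \<epsilon> \<xi>) x)
      + \<i> * (complex_of_real (list_power is \<xi>) * partial_deriv i (h \<epsilon> \<xi>) x))"
    by (auto intro!: symbol_upto_add)
  moreover have "(transp_list is \<xi> (transp1 i \<xi> (h \<epsilon> \<xi>)) x - complex_of_real (list_power is \<xi>) * transp1 i \<xi> (h \<epsilon> \<xi>) x)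
      + \<i> * (complex_of_real (list_power is \<xi>) * partial_deriv i (h \<epsilon> \<xi>) x)
      = transp_list (i # is) \<xi> (h \<epsilon> \<xi>) x - complex_of_real (list_power (i # is) \<xi>) * h \<epsilon> \<xi> x" for \<epsilon> \<xi> x
    by (simp add: transp1_def list_power_def algebra_simps)
  ultimately show ?case by simp
qed

section \<open>One step of the parametrix\<close>

text \<open>
  Ellipticity on a compact set \<open>K\<close>, up to the small loss: \<open>A\<close> stands for the size of the leading
  coefficients, which bounds all the derivatives of all the coefficients and, multiplied by
  \<open>(1 + |\<xi>|)\<^sup>m\<close>, bounds the full symbol from below.
\<close>

locale elliptic_data =
  fixes m :: nat and a :: "'n::finite multi_index \<Rightarrow> 'n net"
    and \<Gamma> K S :: "(real^'n) set" and A :: "real \<Rightarrow> real^'n \<Rightarrow> real"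
  assumes K: "compact K" and S: "open S" "K \<subseteq> S"
    and a_smooth: "\<And>\<alpha> \<epsilon>. mi_abs \<alpha> \<le> m \<Longrightarrow> \<epsilon> \<in> {0<..1} \<Longrightarrow> smooth_on S (a \<alpha> \<epsilon>)"
    and A_pos: "\<forall>\<^sub>F \<epsilon> in at_right 0. \<forall>x\<in>K. 0 < A \<epsilon> x"
    and a_sym: "\<And>\<alpha>. mi_abs \<alpha> \<le> m \<Longrightarrow> symbol \<Gamma> K (\<lambda>\<epsilon> \<xi> x. A \<epsilon> x) (\<lambda>\<epsilon> \<xi>. a \<alpha> \<epsilon>)"
    and elliptic: "\<And>\<theta>. 0 < \<theta> \<Longrightarrow> \<forall>\<^sub>F (\<epsilon>, \<xi>) in high_freq \<Gamma>. \<forall>x\<in>K.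
      A \<epsilon> x * jb \<xi> powr m \<le> norm (symb m a \<epsilon> x \<xi>) * jb \<xi> powr \<theta>"
begin

text \<open>
  One approximate inversion of the transposed operator: divide by the symbol.
\<close>

definition quot :: "'n family \<Rightarrow> 'n family" where
  "quot h \<epsilon> \<xi> x = h \<epsilon> \<xi> x * inverse (symb m a \<epsilon> x \<xi>)"

text \<open>
  The error \<open>R h = h - L (h / P)\<close> of this inversion.
\<close>

definition rem :: "'n family \<Rightarrow> 'n family" where
  "rem h \<epsilon> \<xi> x = h \<epsilon> \<xi> x - transp_op m a \<epsilon> \<xi> (quot h \<epsilon> \<xi>) x"

lemma A_pos_high_freq: "\<forall>\<^sub>F (\<epsilon>, \<xi>) in high_freq \<Gamma>. \<forall>x\<in>K. 0 < A \<epsilon> x"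
  using eventually_high_freq_eps[OF A_pos] .

lemma symbol_symb: "symbol \<Gamma> K (\<lambda>\<epsilon> \<xi> x. A \<epsilon> x * jb \<xi> powr m) (\<lambda>\<epsilon> \<xi> x. symb m a \<epsilon> x \<xi>)"
proof
  fix n
  show "symbol_upto n \<Gamma> K (\<lambda>\<epsilon> \<xi> x. A \<epsilon> x * jb \<xi> powr m) (\<lambda>\<epsilon> \<xi> x. symb m a \<epsilon> x \<xi>)"
    unfolding symb_def
  proof (rule symbol_upto_sum[OF finite_mi_le])
    fix \<alpha> :: "'n multi_index" assume "\<alpha> \<in> {\<alpha>. mi_abs \<alpha> \<le> m}"
    hence \<alpha>: "mi_abs \<alpha> \<le> m" by simp
    have "symbol \<Gamma> K (\<lambda>\<epsilon> \<xi> x. A \<epsilon> x * jb \<xi> powr (0 + real (length (mi_list \<alpha>)))) (\<lambda>\<epsilon> \<xi> x. complex_of_real (list_power (mi_list \<alpha>) \<xi>) * a \<alpha> \<epsilon> x)"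
      by (rule symbol_list_power_mult) (use a_sym[OF \<alpha>] in simp)
    from symbol_mono_powr[OF this, of m]
    show "symbol_upto n \<Gamma> K (\<lambda>\<epsilon> \<xi> x. A \<epsilon> x * jb \<xi> powr m) (\<lambda>\<epsilon> \<xi> x. a \<alpha> \<epsilon> x * complex_of_real (mi_power \<xi> \<alpha>))"
      using \<alpha> by (simp add: list_power_mi_list length_mi_list mult.commute)
  next
    show "\<forall>\<^sub>F (\<epsilon>, \<xi>) in high_freq \<Gamma>. \<forall>x\<in>K. 0 \<le> A \<epsilon> x * jb \<xi> powr m"
      using A_pos_high_freq by eventually_elim (auto intro: less_imp_le)
  qed
qed

lemma symb_nonzero: "\<forall>\<^sub>F (\<epsilon>, \<xi>) in high_freq \<Gamma>. \<forall>x\<in>K. symb m a \<epsilon> x \<xi> \<noteq> 0"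
  using elliptic[OF zero_less_one] A_pos_high_freq
proof (eventually_elim, safe)
  fix \<epsilon> \<xi> x
  assume e: "\<forall>x\<in>K. A \<epsilon> x * jb \<xi> powr m \<le> norm (symb m a \<epsilon> x \<xi>) * jb \<xi> powr 1" "\<forall>x\<in>K. 0 < A \<epsilon> x"
    and x: "x \<in> K" and z: "symb m a \<epsilon> x \<xi> = 0"
  have "0 < A \<epsilon> x * jb \<xi> powr m" using e(2) x by simp
  with bspec[OF e(1) x] z show False by simp
qed

lemma symbol_inverse_symb: "symbol \<Gamma> K (\<lambda>\<epsilon> \<xi> x. 1 / A \<epsilon> x * jb \<xi> powr (- real m)) (\<lambda>\<epsilon> \<xi> x. inverse (symb m a \<epsilon> x \<xi>))"
proof
  fix n
  have "symbol_upto n \<Gamma> K (\<lambda>\<epsilon> \<xi> x. 1 / (A \<epsilon> x * jb \<xi> powr m)) (\<lambda>\<epsilon> \<xi> x. inverse (symb m a \<epsilon> x \<xi>))"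
  proof (rule symbol_upto_inverse[OF symbol_symb[rule_format] _ elliptic])
    show "\<forall>\<^sub>F (\<epsilon>, \<xi>) in high_freq \<Gamma>. \<forall>x\<in>K. 0 < A \<epsilon> x * jb \<xi> powr m"
      using A_pos_high_freq by eventually_elim auto
  qed
  moreover have "1 / (A \<epsilon> x * jb \<xi> powr m) = 1 / A \<epsilon> x * jb \<xi> powr (- real m)" for \<epsilon> x and \<xi> :: "real^'n"
    by (simp only: powr_minus_divide times_divide_times_eq mult_1)
  ultimately show "symbol_upto n \<Gamma> K (\<lambda>\<epsilon> \<xi> x. 1 / A \<epsilon> x * jb \<xi> powr (- real m)) (\<lambda>\<epsilon> \<xi> x. inverse (symb m a \<epsilon> x \<xi>))"
    by simp
qed

lemma symbol_quot:
  assumes "symbol \<Gamma> K (\<lambda>_ \<xi> _. jb \<xi> powr t) h"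
  shows "symbol \<Gamma> K (\<lambda>\<epsilon> \<xi> x. 1 / A \<epsilon> x * jb \<xi> powr (t - m)) (quot h)"
proof
  fix n
  from symbol_upto_mult[OF assms[rule_format] symbol_inverse_symb[rule_format]]
  have "symbol_upto n \<Gamma> K (\<lambda>\<epsilon> \<xi> x. jb \<xi> powr t * (1 / A \<epsilon> x * jb \<xi> powr (- real m))) (quot h)"
    by (simp add: quot_def[abs_def])
  moreover have "jb \<xi> powr t * (1 / A \<epsilon> x * jb \<xi> powr (- real m)) = 1 / A \<epsilon> x * jb \<xi> powr (t - m)" for \<epsilon> x and \<xi> :: "real^'n"
    using powr_add[of "jb \<xi>" t "- real m"] by simp
  ultimately show "symbol_upto n \<Gamma> K (\<lambda>\<epsilon> \<xi> x. 1 / A \<epsilon> x * jb \<xi> powr (t - m)) (quot h)" by (simp only:)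
qed

text \<open>
  The weight \<open>A\<close> of the coefficients cancels against that of \<open>1 / P\<close>, so the powers of \<open>\<epsilon>\<close> hidden in \<open>A\<close>
  do not accumulate when the step is repeated.
\<close>

lemma symbol_coeff_quot:
  assumes "symbol \<Gamma> K (\<lambda>_ \<xi> _. jb \<xi> powr t) h" "mi_abs \<alpha> \<le> m"
  shows "symbol \<Gamma> K (\<lambda>\<epsilon> \<xi> x. 1 * jb \<xi> powr (t - m)) (\<lambda>\<epsilon> \<xi> x. a \<alpha> \<epsilon> x * quot h \<epsilon> \<xi> x)"
proof
  fix n
  show "symbol_upto n \<Gamma> K (\<lambda>\<epsilon> \<xi> x. 1 * jb \<xi> powr (t - m)) (\<lambda>\<epsilon> \<xi> x. a \<alpha> \<epsilon> x * quot h \<epsilon> \<xi> x)"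
  proof (rule symbol_upto_mono)
    show "symbol_upto n \<Gamma> K (\<lambda>\<epsilon> \<xi> x. A \<epsilon> x * (1 / A \<epsilon> x * jb \<xi> powr (t - m))) (\<lambda>\<epsilon> \<xi> x. a \<alpha> \<epsilon> x * quot h \<epsilon> \<xi> x)"
      by (intro symbol_upto_mult a_sym[rule_format] assms(2) symbol_quot[OF assms(1), rule_format])
    show "\<forall>\<^sub>F (\<epsilon>, \<xi>) in high_freq \<Gamma>. \<forall>x\<in>K. A \<epsilon> x * (1 / A \<epsilon> x * jb \<xi> powr (t - m)) \<le> 1 * jb \<xi> powr (t - m)"
      using A_pos_high_freq by eventually_elim (auto simp: less_imp_neq[symmetric])
  qed
qed

text \<open>
  Where \<open>P\<close> does not vanish, \<open>h\<close> equals \<open>\<Sum>\<alpha>. \<xi>\<^sup>\<alpha> a\<^sub>\<alpha> h / P\<close>, which cancels the leading terms of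
  \<open>L (h / P)\<close>.
\<close>

lemma rem_eq_near:
  assumes "symbol \<Gamma> K (\<lambda>_ \<xi> _. jb \<xi> powr t) h"
  shows "\<forall>\<^sub>F (\<epsilon>, \<xi>) in high_freq \<Gamma>. eq_near K
    (\<lambda>x. \<Sum>\<alpha> | mi_abs \<alpha> \<le> m. - 1 * (transp_list (mi_list \<alpha>) \<xi> (\<lambda>x. a \<alpha> \<epsilon> x * quot h \<epsilon> \<xi> x) x
      - complex_of_real (list_power (mi_list \<alpha>) \<xi>) * (a \<alpha> \<epsilon> x * quot h \<epsilon> \<xi> x))) (rem h \<epsilon> \<xi>)"
  using symb_nonzero symbol0_smooth[OF symbol_symbol0[OF symbol_symb]]
proof (eventually_elim, safe)
  fix \<epsilon> and \<xi> :: "real^'n"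
  assume nz: "\<forall>x\<in>K. symb m a \<epsilon> x \<xi> \<noteq> 0" and sm: "smooth_near K (\<lambda>x. symb m a \<epsilon> x \<xi>)"
  obtain V where V: "open V" "K \<subseteq> V" "\<And>x. x \<in> V \<Longrightarrow> symb m a \<epsilon> x \<xi> \<noteq> 0"
    by (rule smooth_near_nonzero[OF sm]) (use nz in auto)
  let ?M = "{\<alpha> :: 'n multi_index. mi_abs \<alpha> \<le> m}"
  have "(\<Sum>\<alpha>\<in>?M. - 1 * (transp_list (mi_list \<alpha>) \<xi> (\<lambda>x. a \<alpha> \<epsilon> x * quot h \<epsilon> \<xi> x) x
      - complex_of_real (list_power (mi_list \<alpha>) \<xi>) * (a \<alpha> \<epsilon> x * quot h \<epsilon> \<xi> x))) = rem h \<epsilon> \<xi> x" if "x \<in> V" for x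
  proof -
    have "(\<Sum>\<alpha>\<in>?M. complex_of_real (list_power (mi_list \<alpha>) \<xi>) * (a \<alpha> \<epsilon> x * quot h \<epsilon> \<xi> x)) = symb m a \<epsilon> x \<xi> * quot h \<epsilon> \<xi> x"
      unfolding symb_def list_power_mi_list sum_distrib_right by (simp only: mult_ac)
    also have "\<dots> = h \<epsilon> \<xi> x" using V(3)[OF that] by (simp add: quot_def)
    finally have "h \<epsilon> \<xi> x = (\<Sum>\<alpha>\<in>?M. complex_of_real (list_power (mi_list \<alpha>) \<xi>) * (a \<alpha> \<epsilon> x * quot h \<epsilon> \<xi> x))" ..
    thus ?thesis by (simp add: rem_def transp_op_def sum_subtractf)
  qed
  thus "eq_near K (\<lambda>x. \<Sum>\<alpha>\<in>?M. - 1 * (transp_list (mi_list \<alpha>) \<xi> (\<lambda>x. a \<alpha> \<epsilon> x * quot h \<epsilon> \<xi> x) x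
      - complex_of_real (list_power (mi_list \<alpha>) \<xi>) * (a \<alpha> \<epsilon> x * quot h \<epsilon> \<xi> x))) (rem h \<epsilon> \<xi>)"
    using V(1,2) unfolding eq_near_def by blast
qed

text \<open>
  The remainder gains one power of \<open>1 + |\<xi>|\<close>; this makes the iteration work.
\<close>

lemma symbol_rem:
  assumes "symbol \<Gamma> K (\<lambda>_ \<xi> _. jb \<xi> powr t) h"
  shows "symbol \<Gamma> K (\<lambda>_ \<xi> _. jb \<xi> powr (t - 1)) (rem h)"
proof
  fix n
  show "symbol_upto n \<Gamma> K (\<lambda>_ \<xi> _. jb \<xi> powr (t - 1)) (rem h)"
  proof (rule symbol_upto_cong[OF rem_eq_near[OF assms]], rule symbol_upto_sum[OF finite_mi_le])
    fix \<alpha> :: "'n multi_index" assume "\<alpha> \<in> {\<alpha>. mi_abs \<alpha> \<le> m}"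
    hence \<alpha>: "mi_abs \<alpha> \<le> m" by simp
    from symbol_mono_powr[OF symbol_transp_list_diff[OF symbol_coeff_quot[OF assms \<alpha>], of "mi_list \<alpha>"], of "t - 1"] \<alpha>
    show "symbol_upto n \<Gamma> K (\<lambda>_ \<xi> _. jb \<xi> powr (t - 1)) (\<lambda>\<epsilon> \<xi> x. - 1 * (transp_list (mi_list \<alpha>) \<xi> (\<lambda>x. a \<alpha> \<epsilon> x * quot h \<epsilon> \<xi> x) x
      - complex_of_real (list_power (mi_list \<alpha>) \<xi>) * (a \<alpha> \<epsilon> x * quot h \<epsilon> \<xi> x)))"
      by (intro symbol_upto_cmult) (simp add: length_mi_list)
  qed (simp add: case_prod_unfold)
qed

lemma csmooth_quot:
  assumes "\<forall>\<^sub>F (\<epsilon>, \<xi>) in high_freq \<Gamma>. csmooth K (h \<epsilon> \<xi>)"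
  shows "\<forall>\<^sub>F (\<epsilon>, \<xi>) in high_freq \<Gamma>. csmooth K (quot h \<epsilon> \<xi>)"
  using assms symbol0_smooth[OF symbol_symbol0[OF symbol_inverse_symb]]
proof (eventually_elim, safe)
  fix \<epsilon> and \<xi> :: "real^'n"
  assume h: "csmooth K (h \<epsilon> \<xi>)" and s: "smooth_near K (\<lambda>x. inverse (symb m a \<epsilon> x \<xi>))"
  show "csmooth K (quot h \<epsilon> \<xi>)"
  proof (rule csmooth_near[OF K])
    show "smooth_near K (quot h \<epsilon> \<xi>)"
      unfolding quot_def[abs_def] using csmooth_smooth_near[OF h] s by (rule smooth_near_mult)
  qed (use h in \<open>simp add: csmooth_def quot_def\<close>)
qed

lemma csmooth_rem:
  assumes "\<forall>\<^sub>F (\<epsilon>, \<xi>) in high_freq \<Gamma>. csmooth K (h \<epsilon> \<xi>)"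
  shows "\<forall>\<^sub>F (\<epsilon>, \<xi>) in high_freq \<Gamma>. csmooth K (rem h \<epsilon> \<xi>)"
  using assms csmooth_quot[OF assms] eventually_high_freq_cone
proof (eventually_elim, safe)
  fix \<epsilon> and \<xi> :: "real^'n"
  assume h: "csmooth K (h \<epsilon> \<xi>)" "csmooth K (quot h \<epsilon> \<xi>)" and e: "0 < \<epsilon>" "\<epsilon> \<le> 1"
  have "csmooth K (\<lambda>x. h \<epsilon> \<xi> x + - 1 * transp_op m a \<epsilon> \<xi> (quot h \<epsilon> \<xi>) x)"
    by (intro csmooth_add csmooth_cmult csmooth_transp_op[OF K S] h a_smooth) (use e in auto)
  thus "csmooth K (rem h \<epsilon> \<xi>)" by (simp add: rem_def[abs_def])
qed

lemma parametrix_step: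
  assumes h: "\<forall>\<^sub>F (\<epsilon>, \<xi>) in high_freq \<Gamma>. csmooth K (h \<epsilon> \<xi>)"
    and v: "\<And>\<epsilon>. \<epsilon> \<in> {0<..1} \<Longrightarrow> smooth_on S (v \<epsilon>)"
  shows "\<forall>\<^sub>F (\<epsilon>, \<xi>) in high_freq \<Gamma>.
    osc_integral v h \<epsilon> \<xi> = osc_integral (diff_op_net m a v) (quot h) \<epsilon> \<xi> + osc_integral v (rem h) \<epsilon> \<xi>"
  using csmooth_quot[OF h] csmooth_rem[OF h] eventually_high_freq_cone
proof (eventually_elim, safe)
  fix \<epsilon> and \<xi> :: "real^'n"
  assume q: "csmooth K (quot h \<epsilon> \<xi>)" and r: "csmooth K (rem h \<epsilon> \<xi>)" and e: "0 < \<epsilon>" "\<epsilon> \<le> 1"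
  have v': "smooth_on S (v \<epsilon>)" and a': "\<And>\<alpha>. mi_abs \<alpha> \<le> m \<Longrightarrow> smooth_on S (a \<alpha> \<epsilon>)"
    using v a_smooth e by auto
  have i1: "integrable lborel (\<lambda>x. v \<epsilon> x * transp_op m a \<epsilon> \<xi> (quot h \<epsilon> \<xi>) x * wave \<xi> x)"
    by (intro csmooth_integrable[OF K] csmooth_wave[OF K] csmooth_mult[OF K S] v' csmooth_transp_op[OF K S] a' q)
  have i2: "integrable lborel (\<lambda>x. v \<epsilon> x * rem h \<epsilon> \<xi> x * wave \<xi> x)"
    by (intro csmooth_integrable[OF K] csmooth_wave[OF K] csmooth_mult[OF K S] v' r)
  have "(LINT x|lborel. v \<epsilon> x * h \<epsilon> \<xi> x * wave \<xi> x) =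
      (LINT x|lborel. v \<epsilon> x * transp_op m a \<epsilon> \<xi> (quot h \<epsilon> \<xi>) x * wave \<xi> x + v \<epsilon> x * rem h \<epsilon> \<xi> x * wave \<xi> x)"
    by (simp add: rem_def algebra_simps)
  also have "\<dots> = (LINT x|lborel. v \<epsilon> x * transp_op m a \<epsilon> \<xi> (quot h \<epsilon> \<xi>) x * wave \<xi> x) + (LINT x|lborel. v \<epsilon> x * rem h \<epsilon> \<xi> x * wave \<xi> x)"
    by (rule Bochner_Integration.integral_add[OF i1 i2])
  also have "(LINT x|lborel. v \<epsilon> x * transp_op m a \<epsilon> \<xi> (quot h \<epsilon> \<xi>) x * wave \<xi> x) = (LINT x|lborel. diff_op_net m a v \<epsilon> x * quot h \<epsilon> \<xi> x * wave \<xi> x)"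
    by (rule integral_transp_op[where v = v and a = a and \<epsilon> = \<epsilon>, OF K S v' a' q, symmetric])
  finally show "osc_integral v h \<epsilon> \<xi> = osc_integral (diff_op_net m a v) (quot h) \<epsilon> \<xi> + osc_integral v (rem h) \<epsilon> \<xi>"
    unfolding osc_integral_def .
qed

text \<open>
  Induction on the number \<open>k\<close> of steps that are left. In the case \<open>k = 0\<close> the symbol \<open>h\<close> itself decays fast
  enough for the trivial estimate by the suprema of \<open>v\<close> and \<open>h\<close>.
\<close>

lemma parametrix_iterate:
  assumes v: "\<And>\<epsilon>. \<epsilon> \<in> {0<..1} \<Longrightarrow> smooth_on S (v \<epsilon>)"
    and vb: "\<forall>\<^sub>F \<epsilon> in at_right 0. \<forall>x\<in>K. norm (v \<epsilon> x) \<le> \<epsilon> powr (- N)"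
    and mult: "\<And>h t. symbol \<Gamma> K (\<lambda>_ \<xi> _. jb \<xi> powr t) h \<Longrightarrow> \<forall>\<^sub>F (\<epsilon>, \<xi>) in high_freq \<Gamma>. csmooth K (h \<epsilon> \<xi>) \<Longrightarrow>
      decay (high_freq \<Gamma>) N l (osc_integral (diff_op_net m a v) (quot h))"
    and h: "symbol \<Gamma> K (\<lambda>_ \<xi> _. jb \<xi> powr t) h" "\<forall>\<^sub>F (\<epsilon>, \<xi>) in high_freq \<Gamma>. csmooth K (h \<epsilon> \<xi>)"
    and k: "t \<le> real k - real l - 1"
  shows "decay (high_freq \<Gamma>) N l (osc_integral v h)"
  using h k
proof (induction k arbitrary: h t)
  case 0
  have "\<forall>\<^sub>F (\<epsilon>, \<xi>) in high_freq \<Gamma>. norm (LINT x|lborel. v \<epsilon> x * h \<epsilon> \<xi> x * wave \<xi> x) \<le> measure lborel K * \<epsilon> powr (- N) * jb \<xi> powr (- real l)"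
    using symbol0_bound[OF symbol_symbol0[OF 0(1)] zero_less_one] 0(2) eventually_high_freq_eps[OF vb]
  proof (eventually_elim, safe)
    fix \<epsilon> and \<xi> :: "real^'n"
    assume b: "\<forall>x\<in>K. norm (h \<epsilon> \<xi> x) \<le> jb \<xi> powr t * jb \<xi> powr 1"
      and c: "csmooth K (h \<epsilon> \<xi>)" and vb: "\<forall>x\<in>K. norm (v \<epsilon> x) \<le> \<epsilon> powr (- N)"
    have "norm (LINT x|lborel. v \<epsilon> x * h \<epsilon> \<xi> x * wave \<xi> x) \<le> measure lborel K * (\<epsilon> powr (- N) * jb \<xi> powr (- real l))"
    proof (rule compact_support_integral_bound[OF K])
      fix x assume x: "x \<in> K"
      have "norm (h \<epsilon> \<xi> x) \<le> jb \<xi> powr (t + 1)" using bspec[OF b x] by (simp add: powr_add)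
      also have "\<dots> \<le> jb \<xi> powr (- real l)" by (rule jb_powr_mono) (use 0(3) in simp)
      finally have "norm (v \<epsilon> x) * norm (h \<epsilon> \<xi> x) \<le> \<epsilon> powr (- N) * jb \<xi> powr (- real l)"
        by (intro mult_mono bspec[OF vb x]) auto
      thus "norm (v \<epsilon> x * h \<epsilon> \<xi> x * wave \<xi> x) \<le> \<epsilon> powr (- N) * jb \<xi> powr (- real l)" by (simp add: norm_mult)
    qed (use c in \<open>auto simp: csmooth_def\<close>)
    thus "norm (LINT x|lborel. v \<epsilon> x * h \<epsilon> \<xi> x * wave \<xi> x) \<le> measure lborel K * \<epsilon> powr (- N) * jb \<xi> powr (- real l)"
      by (simp add: mult.assoc)
  qed
  thus ?case unfolding decay_def osc_integral_def by blast
next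
  case (Suc k)
  have "\<forall>\<^sub>F (\<epsilon>, \<xi>) in high_freq \<Gamma>.
      osc_integral v h \<epsilon> \<xi> = osc_integral (diff_op_net m a v) (quot h) \<epsilon> \<xi> + osc_integral v (rem h) \<epsilon> \<xi>"
    by (rule parametrix_step[OF Suc.prems(2)]) (rule v)
  hence "\<forall>\<^sub>F (\<epsilon>, \<xi>) in high_freq \<Gamma>. norm (osc_integral v h \<epsilon> \<xi>)
      \<le> norm (osc_integral (diff_op_net m a v) (quot h) \<epsilon> \<xi>) + norm (osc_integral v (rem h) \<epsilon> \<xi>)"
    by eventually_elim (auto simp: norm_triangle_ineq)
  moreover have "decay (high_freq \<Gamma>) N l (osc_integral v (rem h))"
    by (rule Suc.IH[OF symbol_rem[OF Suc.prems(1)] csmooth_rem[OF Suc.prems(2)]]) (use Suc.prems(3) in simp)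
  ultimately show ?case using decay_triangle[OF mult[OF Suc.prems(1,2)]] by blast
qed

text \<open>
  This is the symbol in the integral for the Fourier transform of \<open>\<phi> P v\<close>.
\<close>

lemma symbol_transp_op:
  assumes "symbol \<Gamma> K (\<lambda>_ _ _. 1) h"
  shows "symbol \<Gamma> K (\<lambda>\<epsilon> \<xi> x. A \<epsilon> x * jb \<xi> powr m) (\<lambda>\<epsilon> \<xi>. transp_op m a \<epsilon> \<xi> (h \<epsilon> \<xi>))"
proof
  fix n
  show "symbol_upto n \<Gamma> K (\<lambda>\<epsilon> \<xi> x. A \<epsilon> x * jb \<xi> powr m) (\<lambda>\<epsilon> \<xi>. transp_op m a \<epsilon> \<xi> (h \<epsilon> \<xi>))"
    unfolding transp_op_def[abs_def]
  proof (rule symbol_upto_sum[OF finite_mi_le])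
    fix \<alpha> :: "'n multi_index" assume "\<alpha> \<in> {\<alpha>. mi_abs \<alpha> \<le> m}"
    hence \<alpha>: "mi_abs \<alpha> \<le> m" by simp
    have "symbol \<Gamma> K (\<lambda>\<epsilon> \<xi> x. A \<epsilon> x * jb \<xi> powr 0) (\<lambda>\<epsilon> \<xi> x. a \<alpha> \<epsilon> x * h \<epsilon> \<xi> x)"
      using symbol_upto_mult[OF a_sym[OF \<alpha>, rule_format] assms[rule_format]] by simp
    from symbol_mono_powr[OF symbol_transp_list[OF this, of "mi_list \<alpha>"], of m] \<alpha>
    show "symbol_upto n \<Gamma> K (\<lambda>\<epsilon> \<xi> x. A \<epsilon> x * jb \<xi> powr m) (\<lambda>\<epsilon> \<xi> x. transp_list (mi_list \<alpha>) \<xi> (\<lambda>x. a \<alpha> \<epsilon> x * h \<epsilon> \<xi> x) x)"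
      by (simp add: length_mi_list)
  next
    show "\<forall>\<^sub>F (\<epsilon>, \<xi>) in high_freq \<Gamma>. \<forall>x\<in>K. 0 \<le> A \<epsilon> x * jb \<xi> powr m"
      using A_pos_high_freq by eventually_elim (auto intro: less_imp_le)
  qed
qed

end

section \<open>Multiplication by symbols preserves decay in cones\<close>

text \<open>
  After division by the cut-off \<open>\<psi>\<close>, the integral is the convolution at \<open>\<xi>\<close> of the Fourier transforms
  of \<open>\<psi> f\<close> and of \<open>b / \<psi>\<close>. The latter decreases rapidly in its argument \<open>\<eta>\<close>, uniformly up to a power of
  \<open>\<epsilon>\<close> and of \<open>1 + |\<xi>|\<close>. If \<open>|\<eta>| \<le> d |\<xi>|\<close>, then \<open>\<xi> - \<eta>\<close> lies in the cone of decay of the former; otherwise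
  \<open>1 + |\<eta>|\<close> is at least \<open>d (1 + |\<xi>|)\<close> and the decrease in \<open>\<eta>\<close> is also one in \<open>\<xi>\<close>. The exponent of \<open>1 / \<epsilon>\<close> is
  \<open>N + q\<close> for every order \<open>l\<close>.
\<close>

lemma multiplier:
  fixes f :: "'n::finite net" and l :: nat
  assumes K: "compact K"
    and \<psi>: "smooth_on UNIV \<psi>" "\<And>x. x \<in> K \<Longrightarrow> \<psi> x \<noteq> 0"
    and gi: "\<forall>\<^sub>F \<epsilon> in at_right 0. integrable lborel (\<lambda>x. \<psi> x * f \<epsilon> x)"
    and dec: "\<And>l. decay (cone_freq \<Gamma>\<^sub>1) N l (local_fourier \<psi> f)"
    and bdd: "decay (cone_freq UNIV) N 0 (local_fourier \<psi> f)"
    and d: "0 < d" "d \<le> 1" "\<And>\<xi> \<eta>. \<xi> \<in> \<Gamma> \<Longrightarrow> norm \<eta> \<le> d * norm \<xi> \<Longrightarrow> \<xi> - \<eta> \<in> \<Gamma>\<^sub>1"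
    and b: "symbol \<Gamma> K w b" "\<forall>\<^sub>F (\<epsilon>, \<xi>) in high_freq \<Gamma>. csmooth K (b \<epsilon> \<xi>)"
    and w: "\<forall>\<^sub>F (\<epsilon>, \<xi>) in high_freq \<Gamma>. \<forall>x\<in>K. w \<epsilon> \<xi> x \<le> \<epsilon> powr (- q) * jb \<xi> powr M"
  shows "decay (high_freq \<Gamma>) (N + q) l (osc_integral f b)"
proof -
  \<comment> \<open>The weight of \<open>b\<close> costs \<open>M\<close> powers of \<open>1 + |\<xi>|\<close> and the loss \<open>\<theta> = 1\<close> of its derivatives one more.\<close>
  define L where "L = l + nat \<lceil>M\<rceil> + 1"
  have L: "M + 1 - real L \<le> - real l" unfolding L_def by linarith
  \<comment> \<open>\<open>L\<close> powers of \<open>1 + |\<eta>|\<close> are exchanged for powers of \<open>1 + |\<xi>|\<close>; the others make the integral over \<open>\<eta>\<close> finite.\<close>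
  define k where "k = L + 2 * CARD('n)"
  define b' where "b' = (\<lambda>\<epsilon> \<xi> x. b \<epsilon> \<xi> x * inverse (\<psi> x))"
  have sm: "smooth_near K (\<lambda>x. inverse (\<psi> x))"
    by (rule smooth_near_inverse[OF smooth_near_on[OF open_UNIV _ \<psi>(1)] \<psi>(2)]) auto
  have sb': "symbol \<Gamma> K w b'"
    using symbol_upto_mult[OF b(1)[rule_format] symbol_upto_fixed[OF K sm]] by (simp add: b'_def)
  obtain C2 where C2: "\<forall>\<^sub>F \<epsilon> in at_right 0. \<forall>\<zeta>\<in>\<Gamma>\<^sub>1.
      norm (fourier (\<lambda>x. \<psi> x * f \<epsilon> x) \<zeta>) \<le> C2 * \<epsilon> powr (- N) * jb \<zeta> powr (- real L)"
    using dec[of L] unfolding decay_def eventually_cone_freq local_fourier_def by auto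
  obtain C3 where C3: "\<forall>\<^sub>F \<epsilon> in at_right 0. \<forall>\<zeta>. norm (fourier (\<lambda>x. \<psi> x * f \<epsilon> x) \<zeta>) \<le> C3 * \<epsilon> powr (- N)"
    using bdd unfolding decay_def eventually_cone_freq local_fourier_def by auto
  define C1 where "C1 = (1 + real CARD('n)) ^ k * measure lborel K"
  define D where "D = \<bar>C2\<bar> + \<bar>C3\<bar> / d ^ L"
  define W where "W = integral\<^sup>L lborel (weight :: real^'n \<Rightarrow> real)"
  define c where "c = norm ((gauss_const TYPE('n))\<^sup>2)"
  have c: "0 < c" by (simp add: c_def gauss_const_nz)
  have D: "0 \<le> D" "\<bar>C2\<bar> \<le> D" "\<bar>C3\<bar> / d ^ L \<le> D" using d(1) by (simp_all add: D_def)
  have W: "0 \<le> W" unfolding W_def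
    by (rule Bochner_Integration.integral_nonneg) (simp add: less_imp_le[OF weight_pos])
  have "\<forall>\<^sub>F (\<epsilon>, \<xi>) in high_freq \<Gamma>. norm (LINT x|lborel. f \<epsilon> x * b \<epsilon> \<xi> x * wave \<xi> x)
      \<le> (C1 * D * W / c) * \<epsilon> powr (- (N + q)) * jb \<xi> powr (- real l)"
    using symbol_upto_lists[OF sb'[rule_format, of k] zero_less_one] w b(2) eventually_high_freq_eps[OF C2]
      eventually_high_freq_eps[OF C3] eventually_high_freq_eps[OF gi] eventually_high_freq_cone
      symbol0_smooth[OF symbol_symbol0[OF sb']]
  proof (eventually_elim, safe)
    fix \<epsilon> and \<xi> :: "real^'n"
    assume lists: "\<forall>is. length is \<le> k \<longrightarrow> (\<forall>x\<in>K. norm (pderivs is (b' \<epsilon> \<xi>) x) \<le> w \<epsilon> \<xi> x * jb \<xi> powr 1)"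
      and w: "\<forall>x\<in>K. w \<epsilon> \<xi> x \<le> \<epsilon> powr (- q) * jb \<xi> powr M"
      and csmooth: "csmooth K (b \<epsilon> \<xi>)"
      and C2: "\<forall>\<zeta>\<in>\<Gamma>\<^sub>1. norm (fourier (\<lambda>x. \<psi> x * f \<epsilon> x) \<zeta>) \<le> C2 * \<epsilon> powr (- N) * jb \<zeta> powr (- real L)"
      and C3: "\<forall>\<zeta>. norm (fourier (\<lambda>x. \<psi> x * f \<epsilon> x) \<zeta>) \<le> C3 * \<epsilon> powr (- N)"
      and gi: "integrable lborel (\<lambda>x. \<psi> x * f \<epsilon> x)"
      and \<xi>: "\<xi> \<in> \<Gamma>" and \<epsilon>: "0 < \<epsilon>"
      and smb: "smooth_near K (b' \<epsilon> \<xi>)"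
    define g where "g = (\<lambda>x. \<psi> x * f \<epsilon> x)"
    define B where "B = \<epsilon> powr (- q) * jb \<xi> powr (M + 1)"
    have csmooth': "csmooth K (b' \<epsilon> \<xi>)"
      by (rule csmooth_near[OF K smb]) (use csmooth in \<open>simp add: csmooth_def b'_def\<close>)
    have B: "norm (pderivs is (b' \<epsilon> \<xi>) x) \<le> B" if "length is \<le> k" "x \<in> K" for "is" x
    proof -
      have "norm (pderivs is (b' \<epsilon> \<xi>) x) \<le> w \<epsilon> \<xi> x * jb \<xi> powr 1" using lists that by blast
      also have "\<dots> \<le> (\<epsilon> powr (- q) * jb \<xi> powr M) * jb \<xi> powr 1"
        by (rule mult_right_mono[OF bspec[OF w that(2)]]) simp
      also have "\<dots> = B" by (simp add: B_def powr_add)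
      finally show ?thesis .
    qed
    have B0: "0 \<le> B" by (simp add: B_def)
    have H: "jb \<eta> ^ k * norm (fourier (b' \<epsilon> \<xi>) \<eta>) \<le> C1 * B" for \<eta>
      using fourier_decay[OF K csmooth' B0 B] by (simp add: C1_def mult.assoc)
    \<comment> \<open>If \<open>\<eta>\<close> is small, this is \<open>1 + |\<xi>| \<le> (1 + |\<eta>|) (1 + |\<xi> - \<eta>|)\<close> and the decay at \<open>\<xi> - \<eta>\<close>;
      otherwise \<open>1 + |\<xi>| \<le> (1 + |\<eta>|) / d\<close>, and a bound without decay is enough.\<close>
    have G: "jb \<xi> ^ L * norm (fourier g (\<xi> - \<eta>)) \<le> jb \<eta> ^ L * (D * \<epsilon> powr (- N))" for \<eta>
    proof (cases "norm \<eta> \<le> d * norm \<xi>")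
      case True
      have "jb \<eta> * jb (\<xi> - \<eta>) = 1 + norm \<eta> + norm (\<xi> - \<eta>) + norm \<eta> * norm (\<xi> - \<eta>)"
        by (simp add: algebra_simps)
      moreover have "norm \<xi> \<le> norm \<eta> + norm (\<xi> - \<eta>)" using norm_triangle_ineq[of \<eta> "\<xi> - \<eta>"] by simp
      moreover have "0 \<le> norm \<eta> * norm (\<xi> - \<eta>)" by simp
      ultimately have "jb \<xi> \<le> jb \<eta> * jb (\<xi> - \<eta>)" by linarith
      hence "jb \<xi> ^ L \<le> jb \<eta> ^ L * jb (\<xi> - \<eta>) ^ L"
        unfolding power_mult_distrib[symmetric] by (intro power_mono) auto
      hence "jb \<xi> ^ L * norm (fourier g (\<xi> - \<eta>)) \<le> (jb \<eta> ^ L * jb (\<xi> - \<eta>) ^ L) * norm (fourier g (\<xi> - \<eta>))"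
        by (rule mult_right_mono) simp
      also have "\<dots> \<le> (jb \<eta> ^ L * jb (\<xi> - \<eta>) ^ L) * (C2 * \<epsilon> powr (- N) * jb (\<xi> - \<eta>) powr (- real L))"
        unfolding g_def by (intro mult_left_mono bspec[OF C2] d(3)[OF \<xi> True]) auto
      also have "\<dots> = jb \<eta> ^ L * (C2 * \<epsilon> powr (- N))"
        by (simp add: powr_minus powr_realpow)
      also have "\<dots> \<le> jb \<eta> ^ L * (D * \<epsilon> powr (- N))"
        using D by (intro mult_left_mono mult_right_mono) auto
      finally show ?thesis .
    next
      case False
      hence "norm \<xi> \<le> norm \<eta> / d" using d(1) by (simp add: field_simps)
      moreover have "1 \<le> 1 / d" using d(1,2) by simp
      ultimately have "jb \<xi> \<le> jb \<eta> / d" unfolding add_divide_distrib by linarith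
      hence "jb \<xi> ^ L \<le> (jb \<eta> / d) ^ L" by (intro power_mono) auto
      hence "jb \<xi> ^ L * norm (fourier g (\<xi> - \<eta>)) \<le> (jb \<eta> ^ L / d ^ L) * (\<bar>C3\<bar> * \<epsilon> powr (- N))"
        unfolding power_divide
      proof (rule mult_mono)
        have "C3 * \<epsilon> powr (- N) \<le> \<bar>C3\<bar> * \<epsilon> powr (- N)" by (intro mult_right_mono) auto
        thus "norm (fourier g (\<xi> - \<eta>)) \<le> \<bar>C3\<bar> * \<epsilon> powr (- N)"
          using spec[OF C3, of "\<xi> - \<eta>"] unfolding g_def by linarith
      qed (use d in auto)
      also have "\<dots> = jb \<eta> ^ L * (\<bar>C3\<bar> / d ^ L * \<epsilon> powr (- N))" by simp
      also have "\<dots> \<le> jb \<eta> ^ L * (D * \<epsilon> powr (- N))"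
        using D by (intro mult_left_mono mult_right_mono) auto
      finally show ?thesis .
    qed
    define E where "E = C1 * B * (D * \<epsilon> powr (- N)) / jb \<xi> ^ L"
    have int: "norm (fourier (b' \<epsilon> \<xi>) \<eta> * fourier g (\<xi> - \<eta>)) \<le> E * weight \<eta>" for \<eta>
    proof -
      let ?b = "norm (fourier (b' \<epsilon> \<xi>) \<eta>)" and ?g = "norm (fourier g (\<xi> - \<eta>))"
      have "jb \<xi> ^ L * (?b * ?g) = ?b * (jb \<xi> ^ L * ?g)" by simp
      also have "\<dots> \<le> ?b * (jb \<eta> ^ L * (D * \<epsilon> powr (- N)))" by (intro mult_left_mono G) auto
      also have "\<dots> = (?b * jb \<eta> ^ L * (D * \<epsilon> powr (- N))) * 1" by simp
      also have "\<dots> \<le> (?b * jb \<eta> ^ L * (D * \<epsilon> powr (- N))) * (weight \<eta> * jb \<eta> ^ (2 * CARD('n)))"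
        using D(1) by (intro mult_left_mono weight_lower mult_nonneg_nonneg) auto
      also have "\<dots> = (jb \<eta> ^ k * ?b) * ((D * \<epsilon> powr (- N)) * weight \<eta>)"
        by (simp add: k_def power_add)
      also have "\<dots> \<le> (C1 * B) * ((D * \<epsilon> powr (- N)) * weight \<eta>)"
        using D(1) weight_pos[of \<eta>] by (intro mult_right_mono H) auto
      finally have "?b * ?g \<le> E * weight \<eta>"
        by (simp add: E_def field_simps)
      thus ?thesis by (simp add: norm_mult)
    qed
    have gi': "integrable lborel g" using gi by (simp add: g_def)
    have "(\<lambda>\<eta>. fourier (b' \<epsilon> \<xi>) \<eta> * fourier g (\<xi> - \<eta>)) \<in> borel_measurable borel"
      using fourier_measurable[OF csmooth_integrable[OF K csmooth']] measurable_compose[OF _ fourier_measurable[OF gi'], of "\<lambda>\<eta>. \<xi> - \<eta>" borel]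
      by (intro borel_measurable_times) auto
    from integrable_weight_bound(2)[OF this int]
    have "c * norm (fourier (\<lambda>x. g x * b' \<epsilon> \<xi> x) \<xi>) \<le> E * W"
      unfolding fourier_mult[OF K csmooth' gi', symmetric] W_def c_def norm_mult .
    hence "norm (fourier (\<lambda>x. g x * b' \<epsilon> \<xi> x) \<xi>) \<le> E * W / c" using c by (simp add: field_simps)
    moreover have "g x * b' \<epsilon> \<xi> x = f \<epsilon> x * b \<epsilon> \<xi> x" for x
      using \<psi>(2) csmooth by (cases "x \<in> K") (auto simp: g_def b'_def csmooth_def)
    ultimately have "norm (LINT x|lborel. f \<epsilon> x * b \<epsilon> \<xi> x * wave \<xi> x) \<le> E * W / c"
      by (simp add: fourier_wave)
    also have "E = C1 * D * (\<epsilon> powr (- q) * \<epsilon> powr (- N)) * (jb \<xi> powr (M + 1) / jb \<xi> ^ L)"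
      by (simp add: E_def B_def)
    also have "\<epsilon> powr (- q) * \<epsilon> powr (- N) = \<epsilon> powr (- (N + q))" by (simp add: powr_add[symmetric] algebra_simps)
    also have "jb \<xi> powr (M + 1) / jb \<xi> ^ L = jb \<xi> powr (M + 1 - L)"
      using powr_diff[of "jb \<xi>" "M + 1" "real L"] by (simp add: powr_realpow)
    also have "C1 * D * \<epsilon> powr (- (N + q)) * jb \<xi> powr (M + 1 - L) * W / c
        = (C1 * D * W / c * \<epsilon> powr (- (N + q))) * jb \<xi> powr (M + 1 - L)" by simp
    also have "\<dots> \<le> (C1 * D * W / c * \<epsilon> powr (- (N + q))) * jb \<xi> powr (- real l)"
      using D(1) W c by (intro mult_left_mono jb_powr_mono L) (auto simp: C1_def)
    finally show "norm (LINT x|lborel. f \<epsilon> x * b \<epsilon> \<xi> x * wave \<xi> x)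
      \<le> (C1 * D * W / c) * \<epsilon> powr (- (N + q)) * jb \<xi> powr (- real l)" .
  qed
  thus ?thesis unfolding decay_def osc_integral_def by blast
qed

section \<open>Auxiliary cut-off functions and cones\<close>

text \<open>
  The functions \<open>|\<phi>|\<^sup>2\<close>, translated and rescaled, serve as bump functions: where there are no nonzero
  test functions, there is nothing to cut off either.
\<close>

lemma bump_at:
  fixes U V :: "(real^'n::finite) set"
  assumes \<phi>: "test_fun V \<phi>" "\<phi> y \<noteq> 0" and U: "open U" "z \<in> U"
  obtains g \<rho> where "smooth_on UNIV g" "\<And>x. g x = complex_of_real (Re (g x))" "\<And>x. 0 \<le> Re (g x)"
    "g z \<noteq> 0" "\<And>x. g x \<noteq> 0 \<Longrightarrow> x \<in> cball z \<rho>" "cball z \<rho> \<subseteq> U"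
proof -
  obtain \<rho> where \<rho>: "0 < \<rho>" "cball z \<rho> \<subseteq> U" using U open_contains_cball by blast
  have "bounded {x. \<phi> x \<noteq> 0}"
    using \<phi>(1) unfolding test_fun_def by (meson bounded_subset closure_subset compact_imp_bounded)
  then obtain R' where R': "\<And>x. \<phi> x \<noteq> 0 \<Longrightarrow> dist y x \<le> R'"
    unfolding bounded_any_center[where a = y] by auto
  define R where "R = max 1 R'"
  have R: "0 < R" "\<And>x. \<phi> x \<noteq> 0 \<Longrightarrow> dist y x \<le> R" using R' by (auto simp: R_def le_max_iff_disj)
  define s where "s = R / \<rho>"
  have s: "0 < s" using R \<rho> by (simp add: s_def)
  define p where "p = (\<lambda>x. \<phi> ((y - s *\<^sub>R z) + s *\<^sub>R x))"
  have p: "smooth_on UNIV p" unfolding p_def by (rule smooth_on_affine) (use \<phi>(1) in \<open>simp add: test_fun_def\<close>)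
  define g where "g = (\<lambda>x. p x * cnj (p x))"
  have g: "g x = complex_of_real ((norm (p x))\<^sup>2)" for x
    unfolding g_def by (simp only: complex_norm_square)
  show ?thesis
  proof (rule that[of g \<rho>])
    show "smooth_on UNIV g" unfolding g_def
      by (intro smooth_on_mult smooth_on_linear[OF _ _ bounded_linear_cnj] p open_UNIV)
    show "g z \<noteq> 0" using \<phi>(2) by (simp add: g p_def)
    fix x
    show "g x = complex_of_real (Re (g x))" "0 \<le> Re (g x)" by (simp_all add: g)
    assume "g x \<noteq> 0"
    hence "\<phi> ((y - s *\<^sub>R z) + s *\<^sub>R x) \<noteq> 0" by (simp add: g p_def)
    hence "dist y ((y - s *\<^sub>R z) + s *\<^sub>R x) \<le> R" by (rule R)
    moreover have "y - ((y - s *\<^sub>R z) + s *\<^sub>R x) = s *\<^sub>R (z - x)" by (simp add: algebra_simps)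
    ultimately have "s * dist z x \<le> R" using s by (simp add: dist_norm)
    thus "x \<in> cball z \<rho>" using \<rho>(1) R(1) by (simp add: s_def field_simps)
  qed (rule \<rho>(2))
qed

lemma bump_exists:
  fixes U V :: "(real^'n::finite) set"
  assumes \<phi>: "test_fun V \<phi>" "\<phi> y \<noteq> 0" and U: "open U" and K: "compact K" "K \<subseteq> U"
  shows "\<exists>\<psi>. test_fun U \<psi> \<and> (\<forall>x\<in>K. \<psi> x \<noteq> 0)"
proof -
  define Q where "Q = (\<lambda>z p. smooth_on UNIV (fst p) \<and> (\<forall>x. fst p x = complex_of_real (Re (fst p x))) \<and>
      (\<forall>x. 0 \<le> Re (fst p x)) \<and> fst p z \<noteq> 0 \<and> (\<forall>x. fst p x \<noteq> 0 \<longrightarrow> x \<in> cball z (snd p)) \<and> cball z (snd p) \<subseteq> U)"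
  have "\<forall>z\<in>K. \<exists>p. Q z p"
  proof
    fix z assume "z \<in> K"
    hence "z \<in> U" using K(2) by blast
    show "\<exists>p. Q z p"
    proof (rule bump_at[OF \<phi> U \<open>z \<in> U\<close>])
      fix g \<rho> assume "smooth_on UNIV g" "\<And>x. g x = complex_of_real (Re (g x))" "\<And>x. 0 \<le> Re (g x)"
        "g z \<noteq> 0" "\<And>x. g x \<noteq> 0 \<Longrightarrow> x \<in> cball z \<rho>" "cball z \<rho> \<subseteq> U"
      hence "Q z (g, \<rho>)" unfolding Q_def fst_conv snd_conv by blast
      thus "\<exists>p. Q z p" ..
    qed
  qed
  then obtain p where p: "\<And>z. z \<in> K \<Longrightarrow> Q z (p z)" using bchoice[of K Q] by blast
  define g where "g = (\<lambda>z. fst (p z))"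
  define \<rho> where "\<rho> = (\<lambda>z. snd (p z))"
  have g: "\<And>z. z \<in> K \<Longrightarrow> smooth_on UNIV (g z)"
      "\<And>z x. z \<in> K \<Longrightarrow> g z x = complex_of_real (Re (g z x))" "\<And>z x. z \<in> K \<Longrightarrow> 0 \<le> Re (g z x)"
      "\<And>z. z \<in> K \<Longrightarrow> g z z \<noteq> 0" "\<And>z x. z \<in> K \<Longrightarrow> g z x \<noteq> 0 \<Longrightarrow> x \<in> cball z (\<rho> z)"
      "\<And>z. z \<in> K \<Longrightarrow> cball z (\<rho> z) \<subseteq> U"
    using p unfolding Q_def g_def \<rho>_def by blast+
  have op: "open (g z -` (- {0}))" if "z \<in> K" for z
    by (rule continuous_open_vimage) (use smooth_on_continuous_on[OF g(1)[OF that]] in \<open>auto simp: continuous_on_eq_continuous_at\<close>)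
  obtain F where F: "F \<subseteq> K" "finite F" "K \<subseteq> (\<Union>z\<in>F. g z -` (- {0}))"
    by (rule compactE_image[OF K(1) op]) (use g(4) in auto)
  define \<psi> where "\<psi> = (\<lambda>x. \<Sum>z\<in>F. g z x)"
  have sub: "{x. \<psi> x \<noteq> 0} \<subseteq> (\<Union>z\<in>F. cball z (\<rho> z))"
  proof
    fix x assume "x \<in> {x. \<psi> x \<noteq> 0}"
    then obtain z where "z \<in> F" "g z x \<noteq> 0" unfolding \<psi>_def by (auto dest: sum.not_neutral_contains_not_neutral)
    thus "x \<in> (\<Union>z\<in>F. cball z (\<rho> z))" using g(5) F(1) by blast
  qed
  have "compact (\<Union>z\<in>F. cball z (\<rho> z))" using F(2) by (intro compact_UN) auto
  hence cl: "closure {x. \<psi> x \<noteq> 0} \<subseteq> (\<Union>z\<in>F. cball z (\<rho> z))" "bounded (\<Union>z\<in>F. cball z (\<rho> z))"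
    using sub by (auto intro: closure_minimal[THEN subsetD] compact_imp_closed compact_imp_bounded)
  have "test_fun U \<psi>" unfolding test_fun_def
  proof (intro conjI)
    show "smooth_on UNIV \<psi>" unfolding \<psi>_def by (intro smooth_on_sum open_UNIV g) (use F in auto)
    show "compact (closure {x. \<psi> x \<noteq> 0})"
      using cl bounded_subset compact_eq_bounded_closed by blast
    show "closure {x. \<psi> x \<noteq> 0} \<subseteq> U" using cl(1) g(6) F(1) by blast
  qed
  moreover have "\<psi> x \<noteq> 0" if x: "x \<in> K" for x
  proof -
    obtain z where z: "z \<in> F" "g z x \<noteq> 0" using F(3) x by auto
    have "Re (g z x) \<noteq> 0"
    proof
      assume "Re (g z x) = 0"
      hence "g z x = 0" using g(2)[of z x] z(1) F(1) by (auto simp: subset_eq)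
      thus False using z(2) by simp
    qed
    hence "0 < Re (g z x)" using g(3)[of z x] z(1) F(1) by force
    also have "Re (g z x) \<le> (\<Sum>z\<in>F. Re (g z x))"
      by (rule member_le_sum[OF z(1)]) (use g(3) F in auto)
    also have "\<dots> = Re (\<psi> x)" by (simp add: \<psi>_def)
    finally show ?thesis by auto
  qed
  ultimately show ?thesis by blast
qed

text \<open>
  A cut-off that is nowhere zero on the support of \<open>\<phi>\<close> replaces one that is equal to 1 there, because
  symbols supported in that set can be divided by it.
\<close>

lemma cutoff_nonzero_on_support:
  assumes "test_fun U \<phi>" "open U"
  shows "\<exists>\<psi>. test_fun U \<psi> \<and> (\<forall>x\<in>closure {x. \<phi> x \<noteq> 0}. \<psi> x \<noteq> 0)"
proof (cases "\<exists>y. \<phi> y \<noteq> 0")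
  case True
  then obtain y where "\<phi> y \<noteq> 0" by blast
  from bump_exists[OF assms(1) this assms(2), of "closure {x. \<phi> x \<noteq> 0}"] assms(1)
  show ?thesis by (simp add: test_fun_def)
next
  case False
  thus ?thesis using assms(1) by (intro exI[of _ \<phi>]) simp
qed

lemma open_cone_Int: "open_cone A \<Longrightarrow> open_cone B \<Longrightarrow> open_cone (A \<inter> B)"
  by (auto simp: open_cone_def)

text \<open>
  The smaller cone consists of the directions at distance less than \<open>d\<close> from that of \<open>\<xi>\<^sub>1\<close>; a ball of
  radius greater than \<open>2 d\<close> around this direction lies in \<open>\<Gamma>\<close>.
\<close>

lemma open_cone_shrink:
  fixes \<Gamma> :: "(real^'n::finite) set"
  assumes "open_cone \<Gamma>" "\<xi>\<^sub>1 \<in> \<Gamma>"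
  obtains \<Gamma>' d where "open_cone \<Gamma>'" "\<xi>\<^sub>1 \<in> \<Gamma>'" "\<Gamma>' \<subseteq> \<Gamma>" "0 < d" "d \<le> 1"
    "\<And>\<xi> \<eta>. \<xi> \<in> \<Gamma>' \<Longrightarrow> norm \<eta> \<le> d * norm \<xi> \<Longrightarrow> \<xi> - \<eta> \<in> \<Gamma>"
proof -
  have nz: "\<xi>\<^sub>1 \<noteq> 0" using assms by (auto simp: open_cone_def)
  define e where "e = \<xi>\<^sub>1 /\<^sub>R norm \<xi>\<^sub>1"
  have e: "e \<in> \<Gamma>" using assms nz by (auto simp: open_cone_def e_def)
  obtain r where r: "0 < r" "ball e r \<subseteq> \<Gamma>" using assms(1) e open_contains_ball unfolding open_cone_def by blast
  define d where "d = min 1 (r / 3)"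
  have d: "0 < d" "d \<le> 1" "d + d < r" using r by (auto simp: d_def)
  define \<Gamma>' where "\<Gamma>' = {\<xi>. \<xi> \<noteq> 0 \<and> norm (\<xi> /\<^sub>R norm \<xi> - e) < d}"
  have key: "\<xi> - \<eta> \<in> \<Gamma>" if "\<xi> \<in> \<Gamma>'" "norm \<eta> \<le> d * norm \<xi>" for \<xi> \<eta>
  proof -
    have n: "0 < norm \<xi>" "norm (\<xi> /\<^sub>R norm \<xi> - e) < d" using that(1) by (auto simp: \<Gamma>'_def)
    have "norm (\<eta> /\<^sub>R norm \<xi>) \<le> d" using that(2) n(1) by (simp add: field_simps)
    moreover have "norm ((\<xi> - \<eta>) /\<^sub>R norm \<xi> - e) = norm ((\<xi> /\<^sub>R norm \<xi> - e) - \<eta> /\<^sub>R norm \<xi>)"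
      by (simp add: algebra_simps)
    ultimately have "norm ((\<xi> - \<eta>) /\<^sub>R norm \<xi> - e) < r"
      using norm_triangle_ineq4[of "\<xi> /\<^sub>R norm \<xi> - e" "\<eta> /\<^sub>R norm \<xi>"] n(2) d(3) by linarith
    hence "(\<xi> - \<eta>) /\<^sub>R norm \<xi> \<in> \<Gamma>" using r(2) by (auto simp: dist_norm norm_minus_commute)
    hence "norm \<xi> *\<^sub>R ((\<xi> - \<eta>) /\<^sub>R norm \<xi>) \<in> \<Gamma>" using assms(1) n(1) unfolding open_cone_def by blast
    thus ?thesis using n(1) by simp
  qed
  have "open \<Gamma>'"
  proof -
    have "continuous_on (- {0}) (\<lambda>\<xi>::real^'n. norm (\<xi> /\<^sub>R norm \<xi> - e))" by (intro continuous_intros) auto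
    from continuous_open_preimage[OF this, of "{..<d}"]
    have "open (- {0} \<inter> (\<lambda>\<xi>. norm (\<xi> /\<^sub>R norm \<xi> - e)) -` {..<d})" by (simp add: open_Compl)
    moreover have "- {0} \<inter> (\<lambda>\<xi>. norm (\<xi> /\<^sub>R norm \<xi> - e)) -` {..<d} = \<Gamma>'" by (auto simp: \<Gamma>'_def)
    ultimately show ?thesis by simp
  qed
  moreover have "t *\<^sub>R \<xi> \<in> \<Gamma>'" if "\<xi> \<in> \<Gamma>'" "0 < t" for t \<xi>
  proof -
    have "(t *\<^sub>R \<xi>) /\<^sub>R norm (t *\<^sub>R \<xi>) = (inverse t * t) *\<^sub>R (\<xi> /\<^sub>R norm \<xi>)"
      using that(2) by (simp add: mult_ac)
    also have "\<dots> = \<xi> /\<^sub>R norm \<xi>" using that(2) by simp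
    finally have eq: "(t *\<^sub>R \<xi>) /\<^sub>R norm (t *\<^sub>R \<xi>) = \<xi> /\<^sub>R norm \<xi>" .
    show ?thesis using that unfolding \<Gamma>'_def mem_Collect_eq eq by simp
  qed
  ultimately have "open_cone \<Gamma>'" by (auto simp: open_cone_def \<Gamma>'_def)
  moreover have "\<xi>\<^sub>1 \<in> \<Gamma>'" using nz d by (simp add: \<Gamma>'_def e_def)
  moreover have "\<Gamma>' \<subseteq> \<Gamma>" using key[of _ 0] d by auto
  ultimately show ?thesis using that d key by blast
qed

section \<open>Pointwise bounds for moderate and negligible nets\<close>

lemma pderivs_add:
  assumes "open S" "smooth_on S f" "smooth_on S g" "x \<in> S"
  shows "pderivs is (\<lambda>x. f x + g x) x = pderivs is f x + pderivs is g x"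
  using assms(4)
proof (induction "is" arbitrary: x)
  case (Cons i "is")
  have "pderivs (i # is) (\<lambda>x. f x + g x) x = partial_deriv i (\<lambda>x. pderivs is f x + pderivs is g x) x"
    using partial_deriv_cong[OF assms(1) Cons.prems, of "pderivs is (\<lambda>x. f x + g x)"] Cons.IH by simp
  also have "\<dots> = pderivs (i # is) f x + pderivs (i # is) g x"
    using assms Cons.prems by (simp add: partial_deriv_add smooth_on_differentiable[OF smooth_on_pderivs])
  finally show ?case .
qed simp

lemma pderivs_cmult:
  assumes "open S" "smooth_on S f" "x \<in> S"
  shows "pderivs is (\<lambda>x. c * f x) x = c * pderivs is f x"
  using assms(3)
proof (induction "is" arbitrary: x)
  case (Cons i "is")
  have "pderivs (i # is) (\<lambda>x. c * f x) x = partial_deriv i (\<lambda>x. c * pderivs is f x) x"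
    using partial_deriv_cong[OF assms(1) Cons.prems, of "pderivs is (\<lambda>x. c * f x)"] Cons.IH by simp
  also have "\<dots> = c * pderivs (i # is) f x"
    using partial_deriv_linear[OF smooth_on_differentiable[OF smooth_on_pderivs[OF assms(2)] assms(1) Cons.prems] bounded_linear_mult_right]
    by simp
  finally show ?case .
qed simp

lemma pderivs_const0: "pderivs is (\<lambda>_. 0) x = 0"
  by (induction "is" arbitrary: x) (auto intro: partial_deriv_zero[of UNIV])

lemma pderivs_sum_cmult:
  assumes "open S" "\<And>i. i \<in> I \<Longrightarrow> smooth_on S (f i)" "x \<in> S"
  shows "pderivs is (\<lambda>x. \<Sum>i\<in>I. c i * f i x) x = (\<Sum>i\<in>I. c i * pderivs is (f i) x)"
  using assms(2)
proof (induction I rule: infinite_finite_induct)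
  case (insert i I)
  have "pderivs is (\<lambda>x. \<Sum>i\<in>insert i I. c i * f i x) x = pderivs is (\<lambda>x. c i * f i x + (\<Sum>i\<in>I. c i * f i x)) x"
    using insert by simp
  also have "\<dots> = pderivs is (\<lambda>x. c i * f i x) x + pderivs is (\<lambda>x. \<Sum>i\<in>I. c i * f i x) x"
    by (rule pderivs_add[OF assms(1) _ _ assms(3)])
       (auto intro!: smooth_on_mult[OF assms(1)] smooth_on_sum[OF assms(1)] smooth_on_const insert.prems)
  also have "\<dots> = (\<Sum>i\<in>insert i I. c i * pderivs is (f i) x)"
    using insert pderivs_cmult[OF assms(1) _ assms(3), of "f i" "is" "c i"] by simp
  finally show ?case .
qed (simp_all add: pderivs_const0)

text \<open>
  The consequences of moderateness that are used below: derivatives in any order, and pointwise bounds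
  instead of suprema.
\<close>

definition mod_bounds :: "(real^'n::finite) set \<Rightarrow> 'n net \<Rightarrow> bool" where
  "mod_bounds \<Omega> v \<longleftrightarrow> (\<forall>\<epsilon>\<in>{0<..1}. smooth_on \<Omega> (v \<epsilon>)) \<and>
    (\<forall>K is. compact K \<and> K \<subseteq> \<Omega> \<longrightarrow> (\<exists>p\<ge>0. \<forall>\<^sub>F \<epsilon> in at_right 0. \<forall>x\<in>K. norm (pderivs is (v \<epsilon>) x) \<le> \<epsilon> powr (- p)))"

lemma eventually_const_le_inverse: "\<forall>\<^sub>F \<epsilon> in at_right 0. c \<le> 1 / (\<epsilon>::real)"
proof -
  have "\<forall>\<^sub>F \<epsilon> in at_right 0. (max c 1) powr 1 \<le> 1 / \<epsilon>"
    by (rule pos_slow_scale_powr_le[OF pos_slow_scale_const]) auto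
  thus ?thesis by eventually_elim simp
qed

lemma powr_minus1: "0 < \<epsilon> \<Longrightarrow> \<epsilon> powr (p - 1) = 1 / \<epsilon> * \<epsilon> powr p"
  for \<epsilon> :: real by (simp add: powr_diff)

text \<open>
  One power of \<open>\<epsilon>\<close> is given away in order to absorb the constant.
\<close>

lemma bound_of_bigo_SUP:
  assumes \<Omega>: "open \<Omega>" and sm: "\<And>\<epsilon>. \<epsilon> \<in> {0<..1} \<Longrightarrow> smooth_on \<Omega> (v \<epsilon>)"
    and K: "compact K" "K \<subseteq> \<Omega>"
    and O: "(\<lambda>\<epsilon>. SUP x\<in>K. norm (mi_deriv \<alpha> (v \<epsilon>) x)) \<in> O[at_right 0](\<lambda>\<epsilon>. \<epsilon> powr p)"
  shows "\<forall>\<^sub>F \<epsilon> in at_right 0. \<forall>x\<in>K. norm (mi_deriv \<alpha> (v \<epsilon>) x) \<le> \<epsilon> powr (p - 1)"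
proof -
  obtain c where "c > 0" and c: "\<forall>\<^sub>F \<epsilon> in at_right 0. norm (SUP x\<in>K. norm (mi_deriv \<alpha> (v \<epsilon>) x)) \<le> c * norm (\<epsilon> powr p)"
    using landau_o.bigE[OF O] by blast
  show ?thesis using c eventually_const_le_inverse[of c] eventually_unit
  proof (eventually_elim, safe)
    fix \<epsilon> x
    assume S: "norm (SUP x\<in>K. norm (mi_deriv \<alpha> (v \<epsilon>) x)) \<le> c * norm (\<epsilon> powr p)"
      and c: "c \<le> 1 / \<epsilon>" and \<epsilon>: "0 < \<epsilon>" "\<epsilon> \<le> 1" and x: "x \<in> K"
    have "smooth_on \<Omega> (mi_deriv \<alpha> (v \<epsilon>))" unfolding mi_deriv_eq_pderivs by (intro smooth_on_pderivs sm) (use \<epsilon> in auto)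
    hence "continuous_on K (\<lambda>x. norm (mi_deriv \<alpha> (v \<epsilon>) x))"
      using K(2) by (intro continuous_on_norm) (auto intro: continuous_on_subset smooth_on_continuous_on)
    hence "bdd_above ((\<lambda>x. norm (mi_deriv \<alpha> (v \<epsilon>) x)) ` K)"
      by (intro bounded_imp_bdd_above compact_imp_bounded compact_continuous_image K)
    hence "norm (mi_deriv \<alpha> (v \<epsilon>) x) \<le> (SUP x\<in>K. norm (mi_deriv \<alpha> (v \<epsilon>) x))" by (rule cSUP_upper[OF x])
    also have "\<dots> \<le> c * \<epsilon> powr p" using S by simp
    also have "\<dots> \<le> 1 / \<epsilon> * \<epsilon> powr p" by (intro mult_right_mono c) simp
    also have "\<dots> = \<epsilon> powr (p - 1)" using \<epsilon>(1) by (rule powr_minus1[symmetric])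
    finally show "norm (mi_deriv \<alpha> (v \<epsilon>) x) \<le> \<epsilon> powr (p - 1)" .
  qed
qed

lemma mi_deriv_bound_pderivs:
  fixes v :: "'n::finite net"
  assumes \<Omega>: "open \<Omega>" and sm: "\<And>\<epsilon>. \<epsilon> \<in> {0<..1} \<Longrightarrow> smooth_on \<Omega> (v \<epsilon>)" and K: "K \<subseteq> \<Omega>"
    and b: "\<forall>\<^sub>F \<epsilon> in at_right 0. \<forall>x\<in>K. norm (mi_deriv (count (mset is)) (v \<epsilon>) x) \<le> B \<epsilon>"
  shows "\<forall>\<^sub>F \<epsilon> in at_right 0. \<forall>x\<in>K. norm (pderivs is (v \<epsilon>) x) \<le> B \<epsilon>"
  using b eventually_unit
proof (eventually_elim, safe)
  fix \<epsilon> x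
  assume "\<forall>x\<in>K. norm (mi_deriv (count (mset is)) (v \<epsilon>) x) \<le> B \<epsilon>" "0 < \<epsilon>" "\<epsilon> \<le> 1" "x \<in> K"
  thus "norm (pderivs is (v \<epsilon>) x) \<le> B \<epsilon>"
    using pderivs_eq_mi_deriv[OF \<Omega> sm, of \<epsilon> x "is"] K by auto
qed

lemma moderate_imp_mod_bounds:
  assumes \<Omega>: "open \<Omega>" and v: "v \<in> moderate \<Omega>"
  shows "mod_bounds \<Omega> v"
proof -
  have sm: "smooth_on \<Omega> (v \<epsilon>)" if "\<epsilon> \<in> {0<..1}" for \<epsilon> using v that by (simp add: moderate_def)
  have "\<exists>p\<ge>0. \<forall>\<^sub>F \<epsilon> in at_right 0. \<forall>x\<in>K. norm (pderivs is (v \<epsilon>) x) \<le> \<epsilon> powr (- p)"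
    if K: "compact K" "K \<subseteq> \<Omega>" for K "is"
  proof (cases "K = {}")
    case False
    with v K obtain p where p: "0 \<le> p" "(\<lambda>\<epsilon>. SUP x\<in>K. norm (mi_deriv (count (mset is)) (v \<epsilon>) x)) \<in> O[at_right 0](\<lambda>\<epsilon>. \<epsilon> powr (- p))"
      unfolding moderate_def by blast
    have "\<forall>\<^sub>F \<epsilon> in at_right 0. \<forall>x\<in>K. norm (pderivs is (v \<epsilon>) x) \<le> \<epsilon> powr (- p - 1)"
      by (rule mi_deriv_bound_pderivs[OF \<Omega> sm K(2) bound_of_bigo_SUP[OF \<Omega> sm K p(2)]])
    with p(1) show ?thesis by (intro exI[of _ "p + 1"]) simp
  next
    case True
    thus ?thesis by (intro exI[of _ 0]) simp
  qed
  thus ?thesis using sm unfolding mod_bounds_def by blast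
qed

lemma negligible_bound:
  assumes \<Omega>: "open \<Omega>" and v: "v \<in> negligible_nets \<Omega>" and K: "compact K" "K \<subseteq> \<Omega>" and q: "0 \<le> q"
  shows "\<forall>\<^sub>F \<epsilon> in at_right 0. \<forall>x\<in>K. norm (pderivs is (v \<epsilon>) x) \<le> \<epsilon> powr q"
proof (cases "K = {}")
  case False
  have sm: "smooth_on \<Omega> (v \<epsilon>)" if "\<epsilon> \<in> {0<..1}" for \<epsilon> using v that by (simp add: negligible_nets_def)
  have "\<forall>\<alpha>. \<forall>q\<ge>0. (\<lambda>\<epsilon>. SUP x\<in>K. norm (mi_deriv \<alpha> (v \<epsilon>) x)) \<in> O[at_right 0](\<lambda>\<epsilon>. \<epsilon> powr q)"
    using v K False by (simp add: negligible_nets_def)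
  hence "(\<lambda>\<epsilon>. SUP x\<in>K. norm (mi_deriv (count (mset is)) (v \<epsilon>) x)) \<in> O[at_right 0](\<lambda>\<epsilon>. \<epsilon> powr (q + 1))"
    using q by simp
  from mi_deriv_bound_pderivs[OF \<Omega> sm K(2) bound_of_bigo_SUP[OF \<Omega> sm K this]]
  show ?thesis by simp
qed simp

lemma negligible_smooth: "v \<in> negligible_nets \<Omega> \<Longrightarrow> \<epsilon> \<in> {0<..1} \<Longrightarrow> smooth_on \<Omega> (v \<epsilon>)"
  by (simp add: negligible_nets_def)

lemma mod_bounds_smooth: "mod_bounds \<Omega> v \<Longrightarrow> \<epsilon> \<in> {0<..1} \<Longrightarrow> smooth_on \<Omega> (v \<epsilon>)"
  by (simp add: mod_bounds_def)

lemma mod_bounds_bound: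
  assumes "mod_bounds \<Omega> v" "compact K" "K \<subseteq> \<Omega>"
  obtains p where "0 \<le> p" "\<forall>\<^sub>F \<epsilon> in at_right 0. \<forall>x\<in>K. norm (pderivs is (v \<epsilon>) x) \<le> \<epsilon> powr (- p)"
  using assms unfolding mod_bounds_def by blast

lemma mod_bounds_add_negligible:
  assumes \<Omega>: "open \<Omega>" and h: "h \<in> negligible_nets \<Omega>" and v: "mod_bounds \<Omega> v"
  shows "mod_bounds \<Omega> (\<lambda>\<epsilon> x. h \<epsilon> x + v \<epsilon> x)"
  unfolding mod_bounds_def
proof (intro conjI allI impI ballI)
  fix \<epsilon> :: real assume "\<epsilon> \<in> {0<..1}"
  thus "smooth_on \<Omega> (\<lambda>x. h \<epsilon> x + v \<epsilon> x)"
    by (intro smooth_on_add \<Omega> negligible_smooth[OF h] mod_bounds_smooth[OF v])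
next
  fix K "is" assume "compact K \<and> K \<subseteq> \<Omega>"
  hence K: "compact K" "K \<subseteq> \<Omega>" by auto
  obtain p where p: "0 \<le> p" "\<forall>\<^sub>F \<epsilon> in at_right 0. \<forall>x\<in>K. norm (pderivs is (v \<epsilon>) x) \<le> \<epsilon> powr (- p)"
    using mod_bounds_bound[OF v K] by blast
  have "\<forall>\<^sub>F \<epsilon> in at_right 0. \<forall>x\<in>K. norm (pderivs is (\<lambda>x. h \<epsilon> x + v \<epsilon> x) x) \<le> \<epsilon> powr (- (p + 1))"
    using p(2) negligible_bound[OF \<Omega> h K order_refl, of "is"] eventually_unit eventually_const_le_inverse[of 2]
  proof (eventually_elim, safe)
    fix \<epsilon> x
    assume v': "\<forall>x\<in>K. norm (pderivs is (v \<epsilon>) x) \<le> \<epsilon> powr (- p)" and \<epsilon>: "0 < \<epsilon>" "\<epsilon> \<le> 1" "2 \<le> 1 / \<epsilon>" and x: "x \<in> K"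
      and h': "\<forall>x\<in>K. norm (pderivs is (h \<epsilon>) x) \<le> \<epsilon> powr 0"
    have sm: "smooth_on \<Omega> (h \<epsilon>)" "smooth_on \<Omega> (v \<epsilon>)" "x \<in> \<Omega>"
      using negligible_smooth[OF h] mod_bounds_smooth[OF v] \<epsilon> K x by auto
    have "norm (pderivs is (h \<epsilon>) x) \<le> \<epsilon> powr (- p)"
      using bspec[OF h' x] powr_mono'[of "- p" 0 \<epsilon>] \<epsilon> p(1) by linarith
    hence "norm (pderivs is (\<lambda>x. h \<epsilon> x + v \<epsilon> x) x) \<le> 2 * \<epsilon> powr (- p)"
      unfolding pderivs_add[OF \<Omega> sm] using bspec[OF v' x] norm_triangle_ineq[of "pderivs is (h \<epsilon>) x" "pderivs is (v \<epsilon>) x"] by linarith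
    also have "\<dots> \<le> 1 / \<epsilon> * \<epsilon> powr (- p)" by (intro mult_right_mono \<epsilon>) simp
    also have "\<dots> = \<epsilon> powr (- (p + 1))" using powr_minus1[OF \<epsilon>(1), of "- p"] by simp
    finally show "norm (pderivs is (\<lambda>x. h \<epsilon> x + v \<epsilon> x) x) \<le> \<epsilon> powr (- (p + 1))" .
  qed
  thus "\<exists>p\<ge>0. \<forall>\<^sub>F \<epsilon> in at_right 0. \<forall>x\<in>K. norm (pderivs is (\<lambda>x. h \<epsilon> x + v \<epsilon> x) x) \<le> \<epsilon> powr (- p)"
    using p(1) by (intro exI[of _ "p + 1"]) auto
qed

section \<open>The Colombeau quotient\<close>

lemma in_colombeau_class_iff:
  "u \<in> colombeau_class \<Omega> v \<longleftrightarrow> (\<exists>h\<in>negligible_nets \<Omega>. u = (\<lambda>\<epsilon> x. h \<epsilon> x + v \<epsilon> x))"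
  by (auto simp: colombeau_class_def a_r_coset_def' moderate_ring_def)

lemma zero_negligible: "(\<lambda>\<epsilon> x. 0) \<in> negligible_nets (\<Omega> :: (real^'n::finite) set)"
proof -
  have "mi_deriv \<alpha> (\<lambda>x::real^'n. 0) x = 0" for \<alpha> x unfolding mi_deriv_eq_pderivs by (rule pderivs_const0)
  thus ?thesis by (simp add: negligible_nets_def smooth_on_const)
qed

lemma colombeau_class_refl: "v \<in> colombeau_class \<Omega> v"
  unfolding in_colombeau_class_iff by (rule bexI[OF _ zero_negligible]) simp

lemma carrier_colombeau:
  assumes "u \<in> carrier (colombeau \<Omega>)"
  obtains v where "v \<in> moderate \<Omega>" "u = colombeau_class \<Omega> v"
  using assms by (auto simp: colombeau_def FactRing_def A_RCOSETS_def' colombeau_class_def moderate_ring_def)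

text \<open>
  The product of two cosets contains the product of their representatives, so an inverse in the
  quotient is an inverse of the representatives up to a negligible net.
\<close>

lemma Units_colombeau:
  assumes "colombeau_class \<Omega> v \<in> Units (colombeau \<Omega>)"
  obtains w h where "w \<in> moderate \<Omega>" "h \<in> negligible_nets \<Omega>" "(\<lambda>\<epsilon> x. v \<epsilon> x * w \<epsilon> x) = (\<lambda>\<epsilon> x. h \<epsilon> x + 1)"
proof -
  obtain y where y: "y \<in> carrier (colombeau \<Omega>)" "colombeau_class \<Omega> v \<otimes>\<^bsub>colombeau \<Omega>\<^esub> y = \<one>\<^bsub>colombeau \<Omega>\<^esub>"
    using assms unfolding Units_def by blast
  obtain w where w: "w \<in> moderate \<Omega>" "y = colombeau_class \<Omega> w" using carrier_colombeau[OF y(1)] .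
  let ?vw = "\<lambda>\<epsilon> x. v \<epsilon> x * w \<epsilon> x"
  have "?vw \<in> colombeau_class \<Omega> ?vw" by (rule colombeau_class_refl)
  hence "?vw \<in> colombeau_class \<Omega> v \<otimes>\<^bsub>colombeau \<Omega>\<^esub> y"
    unfolding w(2) using colombeau_class_refl[of v \<Omega>] colombeau_class_refl[of w \<Omega>]
    by (simp add: colombeau_def FactRing_def rcoset_mult_def) (force simp: colombeau_class_def moderate_ring_def)
  also have "\<dots> = colombeau_class \<Omega> (\<lambda>\<epsilon> x. 1)"
    unfolding y(2) by (simp add: colombeau_def FactRing_def colombeau_class_def moderate_ring_def)
  finally show ?thesis using that w(1) unfolding in_colombeau_class_iff by blast
qed

text \<open>
  From \<open>v w = 1 + h\<close> with \<open>|h| \<le> 1 / 2\<close> and a moderate \<open>w\<close>, \<open>|v|\<close> is at least \<open>1 / (2 |w|)\<close>.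
\<close>

lemma invertible_lower_bound:
  assumes \<Omega>: "open \<Omega>" and inv: "colombeau_class \<Omega> v \<in> Units (colombeau \<Omega>)" and K: "compact K" "K \<subseteq> \<Omega>"
  shows "\<exists>q\<ge>0. \<forall>\<^sub>F \<epsilon> in at_right 0. \<forall>x\<in>K. \<epsilon> powr q \<le> norm (v \<epsilon> x)"
proof -
  obtain w h where w: "w \<in> moderate \<Omega>" and h: "h \<in> negligible_nets \<Omega>"
    and eq: "(\<lambda>\<epsilon> x. v \<epsilon> x * w \<epsilon> x) = (\<lambda>\<epsilon> x. h \<epsilon> x + 1)"
    using Units_colombeau[OF inv] .
  obtain p where p: "0 \<le> p" "\<forall>\<^sub>F \<epsilon> in at_right 0. \<forall>x\<in>K. norm (pderivs [] (w \<epsilon>) x) \<le> \<epsilon> powr (- p)"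
    using mod_bounds_bound[OF moderate_imp_mod_bounds[OF \<Omega> w] K] by blast
  have "\<forall>\<^sub>F \<epsilon> in at_right 0. \<forall>x\<in>K. \<epsilon> powr (p + 1) \<le> norm (v \<epsilon> x)"
    using p(2) negligible_bound[OF \<Omega> h K zero_le_one, of "[]"] eventually_unit eventually_const_le_inverse[of 2]
  proof (eventually_elim, safe)
    fix \<epsilon> x
    assume w': "\<forall>x\<in>K. norm (pderivs [] (w \<epsilon>) x) \<le> \<epsilon> powr (- p)" and h': "\<forall>x\<in>K. norm (pderivs [] (h \<epsilon>) x) \<le> \<epsilon> powr 1"
      and \<epsilon>: "0 < \<epsilon>" "2 \<le> 1 / \<epsilon>" and x: "x \<in> K"
    have \<epsilon>2: "\<epsilon> \<le> 1 / 2" using \<epsilon> by (simp add: field_simps)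
    have "norm (h \<epsilon> x) \<le> \<epsilon>" using bspec[OF h' x] \<epsilon>(1) by simp
    moreover have "v \<epsilon> x * w \<epsilon> x = h \<epsilon> x + 1" using fun_cong[OF fun_cong[OF eq]] .
    moreover have "1 - norm (h \<epsilon> x) \<le> norm (1 + h \<epsilon> x)" using norm_diff_ineq[of 1 "h \<epsilon> x"] by simp
    ultimately have "1 / 2 \<le> norm (v \<epsilon> x) * norm (w \<epsilon> x)" using \<epsilon>2 unfolding norm_mult[symmetric] by (simp add: add.commute)
    also have "\<dots> \<le> norm (v \<epsilon> x) * \<epsilon> powr (- p)" using bspec[OF w' x] by (intro mult_left_mono) auto
    finally have "1 / 2 * \<epsilon> powr p \<le> (norm (v \<epsilon> x) * \<epsilon> powr (- p)) * \<epsilon> powr p" by (rule mult_right_mono) simp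
    also have "\<dots> = norm (v \<epsilon> x)" using \<epsilon>(1) by (simp add: powr_minus)
    finally have "1 / 2 * \<epsilon> powr p \<le> norm (v \<epsilon> x)" .
    moreover have "\<epsilon> powr (p + 1) \<le> 1 / 2 * \<epsilon> powr p"
      using \<epsilon>2 \<epsilon>(1) by (simp add: powr_add mult.commute)
    ultimately show "\<epsilon> powr (p + 1) \<le> norm (v \<epsilon> x)" by linarith
  qed
  thus ?thesis using p(1) by (intro exI[of _ "p + 1"]) auto
qed

section \<open>Derivatives of monomials\<close>

lemma smooth_on_coord: "smooth_on S (\<lambda>\<eta>::real^'n::finite. complex_of_real (\<eta> $ i))"
proof (rule smooth_onI[where Q = "\<lambda>f. f = (\<lambda>\<eta>. complex_of_real (\<eta> $ i)) \<or> (\<exists>c. f = (\<lambda>_. c))"])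
  have D: "((\<lambda>\<eta>::real^'n. complex_of_real (\<eta> $ i)) has_derivative (\<lambda>v. complex_of_real (v $ i))) (at x)" for x
    by (intro has_derivative_of_real bounded_linear_imp_has_derivative bounded_linear_vec_nth)
  fix f :: "real^'n \<Rightarrow> complex" and j
  assume f: "f = (\<lambda>\<eta>. complex_of_real (\<eta> $ i)) \<or> (\<exists>c. f = (\<lambda>_. c))"
  show "f differentiable_on S"
    using f D by (auto intro!: differentiable_at_imp_differentiable_on intro: differentiableI)
  show "partial_deriv j f = (\<lambda>\<eta>. complex_of_real (\<eta> $ i)) \<or> (\<exists>c. partial_deriv j f = (\<lambda>_. c))"
  proof (cases "f = (\<lambda>\<eta>. complex_of_real (\<eta> $ i))")
    case True
    hence "partial_deriv j f = (\<lambda>_. complex_of_real (axis j 1 $ i))"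
      using partial_deriv_eqI[OF D] by auto
    thus ?thesis by blast
  qed (use f in auto)
qed simp

lemma smooth_on_power: "open S \<Longrightarrow> smooth_on S f \<Longrightarrow> smooth_on S (\<lambda>x. f x ^ k)"
  by (induction k) (auto intro: smooth_on_const smooth_on_mult)

lemma smooth_on_prod:
  assumes "open S" "\<And>i. i \<in> I \<Longrightarrow> smooth_on S (f i)"
  shows "smooth_on S (\<lambda>x. \<Prod>i\<in>I. f i x)"
  using assms(2)
  by (induction I rule: infinite_finite_induct) (auto intro!: smooth_on_const smooth_on_mult[OF assms(1)])

lemma smooth_on_monomial: "open S \<Longrightarrow> smooth_on S (\<lambda>\<eta>. complex_of_real (mi_power \<eta> \<gamma>))"
  unfolding mi_power_def of_real_prod of_real_power by (intro smooth_on_prod smooth_on_power smooth_on_coord)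

lemma mi_power_split: "mi_power \<eta> \<gamma> = (\<eta> $ j) ^ \<gamma> j * (\<Prod>i\<in>UNIV - {j}. (\<eta> $ i) ^ \<gamma> i)"
  unfolding mi_power_def by (rule prod.remove) auto

lemma partial_deriv_monomial:
  "partial_deriv j (\<lambda>\<eta>. complex_of_real (mi_power \<eta> \<gamma>)) \<eta>
    = of_nat (\<gamma> j) * complex_of_real (mi_power \<eta> (\<gamma>(j := \<gamma> j - 1)))"
proof -
  let ?R = "\<Prod>i\<in>UNIV - {j}. (\<eta> $ i) ^ \<gamma> i"
  have line: "mi_power (\<eta> + t *\<^sub>R axis j 1) \<gamma> = (\<eta> $ j + t) ^ \<gamma> j * ?R" for t
    unfolding mi_power_split[of _ _ j] by (intro arg_cong2[where f = "(*)"] prod.cong) (auto simp: axis_def)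
  have "((\<lambda>t. (\<eta> $ j + t) ^ \<gamma> j * ?R) has_real_derivative (real (\<gamma> j) * (\<eta> $ j) ^ (\<gamma> j - 1) * ?R)) (at 0)"
    by (auto intro!: derivative_eq_intros)
  hence "((\<lambda>t. complex_of_real (mi_power (\<eta> + t *\<^sub>R axis j 1) \<gamma>)) has_vector_derivative
      complex_of_real (real (\<gamma> j) * (\<eta> $ j) ^ (\<gamma> j - 1) * ?R)) (at 0)"
    unfolding line by (intro has_vector_derivative_of_real) (simp add: has_real_derivative_iff_has_vector_derivative)
  moreover have "(\<lambda>\<eta>. complex_of_real (mi_power \<eta> \<gamma>)) differentiable (at (\<eta> + 0 *\<^sub>R axis j 1))"
    by (rule smooth_on_differentiable[OF smooth_on_monomial[OF open_UNIV] open_UNIV UNIV_I])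
  from partial_deriv_line[OF this] have "((\<lambda>t. complex_of_real (mi_power (\<eta> + t *\<^sub>R axis j 1) \<gamma>)) has_vector_derivative
      partial_deriv j (\<lambda>\<eta>. complex_of_real (mi_power \<eta> \<gamma>)) \<eta>) (at 0)" by simp
  ultimately have "partial_deriv j (\<lambda>\<eta>. complex_of_real (mi_power \<eta> \<gamma>)) \<eta> = complex_of_real (real (\<gamma> j) * (\<eta> $ j) ^ (\<gamma> j - 1) * ?R)"
    by (rule vector_derivative_unique_at[rotated])
  also have "(\<eta> $ j) ^ (\<gamma> j - 1) * ?R = mi_power \<eta> (\<gamma>(j := \<gamma> j - 1))"
    unfolding mi_power_split[of _ "\<gamma>(j := \<gamma> j - 1)" j] by (intro arg_cong2[where f = "(*)"] prod.cong) auto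
  hence "real (\<gamma> j) * (\<eta> $ j) ^ (\<gamma> j - 1) * ?R = real (\<gamma> j) * mi_power \<eta> (\<gamma>(j := \<gamma> j - 1))" by simp
  finally show ?thesis by simp
qed

text \<open>
  A derivative of a monomial is a multiple of a monomial whose degree has dropped by the number of
  derivatives, or zero.
\<close>

lemma pderivs_monomial:
  "\<exists>c \<gamma>'. (\<forall>\<eta>. pderivs js (\<lambda>\<eta>. complex_of_real (mi_power \<eta> \<gamma>)) \<eta> = c * complex_of_real (mi_power \<eta> \<gamma>'))
    \<and> (c = 0 \<or> mi_abs \<gamma>' + length js = mi_abs \<gamma>)"
proof (induction js)
  case Nil
  show ?case by (rule exI[of _ 1], rule exI[of _ \<gamma>]) simp
next
  case (Cons j js)
  then obtain c \<gamma>' where c: "pderivs js (\<lambda>\<eta>. complex_of_real (mi_power \<eta> \<gamma>)) = (\<lambda>\<eta>. c * complex_of_real (mi_power \<eta> \<gamma>'))"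
    "c = 0 \<or> mi_abs \<gamma>' + length js = mi_abs \<gamma>" by blast
  have "pderivs (j # js) (\<lambda>\<eta>. complex_of_real (mi_power \<eta> \<gamma>)) \<eta>
      = (c * of_nat (\<gamma>' j)) * complex_of_real (mi_power \<eta> (\<gamma>'(j := \<gamma>' j - 1)))" for \<eta>
  proof -
    have "(\<lambda>\<eta>. complex_of_real (mi_power \<eta> \<gamma>')) differentiable (at \<eta>)"
      by (rule smooth_on_differentiable[OF smooth_on_monomial[OF open_UNIV]]) auto
    from partial_deriv_linear[OF this bounded_linear_mult_right, of j c] show ?thesis
      unfolding foldr.simps comp_def c(1) by (simp add: partial_deriv_monomial)
  qed
  moreover have "c * of_nat (\<gamma>' j) = 0 \<or> mi_abs (\<gamma>'(j := \<gamma>' j - 1)) + length (j # js) = mi_abs \<gamma>"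
  proof (cases "c = 0 \<or> \<gamma>' j = 0")
    case False
    have "mi_abs \<gamma>' = \<gamma>' j + (\<Sum>i\<in>UNIV - {j}. \<gamma>' i)" unfolding mi_abs_def by (rule sum.remove) auto
    moreover have "mi_abs (\<gamma>'(j := \<gamma>' j - 1)) = (\<gamma>' j - 1) + (\<Sum>i\<in>UNIV - {j}. \<gamma>' i)"
      unfolding mi_abs_def by (subst sum.remove[of _ j]) auto
    ultimately show ?thesis using False c(2) by auto
  qed auto
  ultimately show ?case by blast
qed

lemma abs_mi_power_le: "\<bar>mi_power \<xi> \<gamma>\<bar> \<le> jb \<xi> powr real (mi_abs \<gamma>)"
proof -
  have "\<bar>mi_power \<xi> \<gamma>\<bar> \<le> norm \<xi> ^ mi_abs \<gamma>"
    using abs_list_power_le[of "mi_list \<gamma>" \<xi>] by (simp add: list_power_mi_list length_mi_list)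
  also have "\<dots> \<le> jb \<xi> ^ mi_abs \<gamma>" by (intro power_mono) auto
  finally show ?thesis by (simp add: powr_realpow)
qed

section \<open>Symbol estimates\<close>

text \<open>
  This is the sum \<open>\<Sum>|\<alpha>| = m. |a\<^sub>\<alpha>|\<close> to which all the coefficients are compared.
\<close>

definition top_size :: "nat \<Rightarrow> ('n::finite multi_index \<Rightarrow> 'n net) \<Rightarrow> real \<Rightarrow> real^'n \<Rightarrow> real" where
  "top_size m a \<epsilon> x = (\<Sum>\<alpha> | mi_abs \<alpha> = m. norm (a \<alpha> \<epsilon> x))"

lemma top_size_nonneg: "0 \<le> top_size m a \<epsilon> x"
  unfolding top_size_def by (rule sum_nonneg) simp

lemma mi_deriv_0: "mi_deriv (\<lambda>_. 0) f = (f :: real^'n::finite \<Rightarrow> complex)"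
proof -
  have e: "concat (map (\<lambda>_. []) xs) = ([] :: 'n list)" for xs :: "'n list" by (induction xs) auto
  show ?thesis unfolding mi_deriv_eq_pderivs mi_list_def replicate_0 e by simp
qed

lemma high_freq_subset:
  assumes "eventually P (high_freq \<Gamma>)" "\<Gamma>' \<subseteq> \<Gamma>"
  shows "eventually P (high_freq \<Gamma>')"
proof -
  obtain r where r: "pos_slow_scale r" "\<forall>\<^sub>F \<epsilon> in at_right 0. \<forall>\<xi>\<in>\<Gamma>. r \<epsilon> \<le> norm \<xi> \<longrightarrow> P (\<epsilon>, \<xi>)"
    using assms(1) unfolding eventually_high_freq small_eps_iff by blast
  from r(2) have "\<forall>\<^sub>F \<epsilon> in at_right 0. \<forall>\<xi>\<in>\<Gamma>'. r \<epsilon> \<le> norm \<xi> \<longrightarrow> P (\<epsilon>, \<xi>)"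
    by eventually_elim (use assms(2) in blast)
  with r(1) show ?thesis by (rule eventually_high_freqI)
qed

text \<open>
  The hypotheses on the operator in the language of the filter \<open>high_freq\<close>.
\<close>

locale operator_data =
  fixes \<Omega> U \<Gamma> :: "(real^'n::finite) set" and m :: nat and a :: "'n multi_index \<Rightarrow> 'n net"
  assumes \<Omega>: "open \<Omega>" and U: "open U" "U \<subseteq> \<Omega>" and \<Gamma>: "open_cone \<Gamma>"
    and coeffs: "\<And>\<alpha>. mi_abs \<alpha> \<le> m \<Longrightarrow> mod_bounds \<Omega> (a \<alpha>)"
    and lower: "\<And>K. compact K \<Longrightarrow> K \<subseteq> U \<Longrightarrow> \<exists>q\<ge>0. \<forall>\<^sub>F \<epsilon> in at_right 0. \<forall>x\<in>K. \<epsilon> powr q \<le> top_size m a \<epsilon> x"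
    and principal: "\<And>K. compact K \<Longrightarrow> K \<subseteq> U \<Longrightarrow> \<exists>s. pos_slow_scale s \<and> (\<forall>\<^sub>F (\<epsilon>, \<xi>) in high_freq \<Gamma>. \<forall>x\<in>K.
      top_size m a \<epsilon> x * jb \<xi> ^ m \<le> s \<epsilon> * norm (principal_symb m a \<epsilon> x \<xi>))"
    and derivs: "\<And>K \<gamma>. compact K \<Longrightarrow> K \<subseteq> U \<Longrightarrow> \<exists>s. pos_slow_scale s \<and> (\<forall>\<^sub>F (\<epsilon>, \<xi>) in high_freq \<Gamma>.
      \<forall>\<beta>. mi_abs \<beta> \<le> m \<longrightarrow> (\<forall>x\<in>K. norm (mi_deriv \<gamma> (a \<beta> \<epsilon>) x) \<le> s \<epsilon> * top_size m a \<epsilon> x))"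
begin

abbreviation "A \<equiv> top_size m a"

lemma symb_split: "symb m a \<epsilon> x \<xi> = principal_symb m a \<epsilon> x \<xi> + (\<Sum>\<alpha> | mi_abs \<alpha> < m. a \<alpha> \<epsilon> x * complex_of_real (mi_power \<xi> \<alpha>))"
proof -
  have e: "{\<alpha> :: 'n multi_index. mi_abs \<alpha> \<le> m} = {\<alpha>. mi_abs \<alpha> = m} \<union> {\<alpha>. mi_abs \<alpha> < m}" by auto
  have "finite {\<alpha> :: 'n multi_index. mi_abs \<alpha> < m}" by (rule finite_subset[OF _ finite_mi_le[of m]]) auto
  thus ?thesis unfolding symb_def principal_symb_def e by (intro sum.union_disjoint finite_mi_eq) auto
qed

text \<open>
  The terms of order less than \<open>m\<close> are at most \<open>n s\<^sub>2 A (1 + |\<xi>|)\<^bsup>m-1\<^esup>\<close>, and this is half of the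
  principal part as soon as \<open>1 + |\<xi>|\<close> exceeds the slow scale net \<open>2 (n + 1) s\<^sub>1 s\<^sub>2\<close>.
\<close>

lemma symb_lower:
  assumes K: "compact K" "K \<subseteq> U"
  shows "\<exists>s. pos_slow_scale s \<and> (\<forall>\<^sub>F (\<epsilon>, \<xi>) in high_freq \<Gamma>. \<forall>x\<in>K. A \<epsilon> x * jb \<xi> ^ m \<le> s \<epsilon> * norm (symb m a \<epsilon> x \<xi>))"
proof -
  obtain s1 where s1: "pos_slow_scale s1" "\<forall>\<^sub>F (\<epsilon>, \<xi>) in high_freq \<Gamma>. \<forall>x\<in>K.
      A \<epsilon> x * jb \<xi> ^ m \<le> s1 \<epsilon> * norm (principal_symb m a \<epsilon> x \<xi>)" using principal[OF K] by blast
  obtain s2 where s2: "pos_slow_scale s2" "\<forall>\<^sub>F (\<epsilon>, \<xi>) in high_freq \<Gamma>.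
      \<forall>\<beta>. mi_abs \<beta> \<le> m \<longrightarrow> (\<forall>x\<in>K. norm (a \<beta> \<epsilon> x) \<le> s2 \<epsilon> * A \<epsilon> x)"
    using derivs[OF K, of "\<lambda>_. 0"] unfolding mi_deriv_0 by blast
  define n where "n = real (card {\<alpha> :: 'n multi_index. mi_abs \<alpha> < m})"
  have slow: "pos_slow_scale (\<lambda>\<epsilon>. (2 * (n + 1)) * (s1 \<epsilon> * s2 \<epsilon>))"
    by (intro pos_slow_scale_mult[of "\<lambda>_. 2 * (n + 1)"] pos_slow_scale_mult s1 s2 pos_slow_scale_const) (simp add: n_def)
  have "\<forall>\<^sub>F (\<epsilon>, \<xi>) in high_freq \<Gamma>. \<forall>x\<in>K. A \<epsilon> x * jb \<xi> ^ m \<le> (2 * s1 \<epsilon>) * norm (symb m a \<epsilon> x \<xi>)"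
    using s1(2) s2(2) eventually_slow_le_jb[OF slow zero_less_one, of \<Gamma>] eventually_high_freq_eps[OF pos_slow_scale_pos[OF s1(1)]]
      eventually_high_freq_eps[OF pos_slow_scale_pos[OF s2(1)]]
  proof (eventually_elim, safe)
    fix \<epsilon> x and \<xi> :: "real^'n"
    assume 1: "\<forall>x\<in>K. A \<epsilon> x * jb \<xi> ^ m \<le> s1 \<epsilon> * norm (principal_symb m a \<epsilon> x \<xi>)"
      and 2: "\<forall>\<beta>. mi_abs \<beta> \<le> m \<longrightarrow> (\<forall>x\<in>K. norm (a \<beta> \<epsilon> x) \<le> s2 \<epsilon> * A \<epsilon> x)"
      and 3: "2 * (n + 1) * (s1 \<epsilon> * s2 \<epsilon>) \<le> jb \<xi> powr 1" and pos: "0 < s1 \<epsilon>" "0 < s2 \<epsilon>" and x: "x \<in> K"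
    let ?low = "\<Sum>\<alpha> | mi_abs \<alpha> < m. a \<alpha> \<epsilon> x * complex_of_real (mi_power \<xi> \<alpha>)"
    have A0: "0 \<le> A \<epsilon> x" by (rule top_size_nonneg)
    have "norm ?low \<le> (\<Sum>\<alpha>::'n multi_index | mi_abs \<alpha> < m. s2 \<epsilon> * A \<epsilon> x * jb \<xi> powr (real m - 1))"
    proof (rule sum_norm_le)
      fix \<alpha> :: "'n multi_index" assume "\<alpha> \<in> {\<alpha>. mi_abs \<alpha> < m}"
      hence \<alpha>: "mi_abs \<alpha> < m" by simp
      have "\<bar>mi_power \<xi> \<alpha>\<bar> \<le> jb \<xi> powr real (mi_abs \<alpha>)" by (rule abs_mi_power_le)
      also have "\<dots> \<le> jb \<xi> powr (real m - 1)" by (rule jb_powr_mono) (use \<alpha> in linarith)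
      finally show "norm (a \<alpha> \<epsilon> x * complex_of_real (mi_power \<xi> \<alpha>)) \<le> s2 \<epsilon> * A \<epsilon> x * jb \<xi> powr (real m - 1)"
        unfolding norm_mult norm_of_real using 2 \<alpha> x pos A0 by (intro mult_mono) auto
    qed
    hence low: "norm ?low \<le> n * (s2 \<epsilon> * A \<epsilon> x * jb \<xi> powr (real m - 1))" by (simp add: n_def)
    have bm: "jb \<xi> powr (real m - 1) * jb \<xi> = jb \<xi> ^ m"
      using powr_add[of "jb \<xi>" "real m - 1" 1] by (simp add: powr_realpow)
    have "2 * (s1 \<epsilon> * norm ?low) \<le> 2 * (s1 \<epsilon> * (n * (s2 \<epsilon> * A \<epsilon> x * jb \<xi> powr (real m - 1))))"
      using low pos by (intro mult_left_mono) auto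
    also have "\<dots> = (2 * n * (s1 \<epsilon> * s2 \<epsilon>)) * (A \<epsilon> x * jb \<xi> powr (real m - 1))" by simp
    also have "\<dots> \<le> jb \<xi> * (A \<epsilon> x * jb \<xi> powr (real m - 1))"
    proof (intro mult_right_mono)
      have "0 \<le> s1 \<epsilon> * s2 \<epsilon>" using pos by simp
      thus "2 * n * (s1 \<epsilon> * s2 \<epsilon>) \<le> jb \<xi>" using 3 by (simp add: algebra_simps)
    qed (use A0 in simp)
    also have "\<dots> = A \<epsilon> x * jb \<xi> ^ m" unfolding bm[symmetric] by simp
    finally have l: "2 * (s1 \<epsilon> * norm ?low) \<le> A \<epsilon> x * jb \<xi> ^ m" .
    have "norm (principal_symb m a \<epsilon> x \<xi>) \<le> norm (symb m a \<epsilon> x \<xi>) + norm ?low"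
      using norm_triangle_ineq4[of "symb m a \<epsilon> x \<xi>" ?low] unfolding symb_split by simp
    hence "s1 \<epsilon> * norm (principal_symb m a \<epsilon> x \<xi>) \<le> s1 \<epsilon> * (norm (symb m a \<epsilon> x \<xi>) + norm ?low)"
      using pos by (intro mult_left_mono) auto
    with bspec[OF 1 x] l show "A \<epsilon> x * jb \<xi> ^ m \<le> 2 * s1 \<epsilon> * norm (symb m a \<epsilon> x \<xi>)"
      by (simp add: distrib_left)
  qed
  moreover have "pos_slow_scale (\<lambda>\<epsilon>. 2 * s1 \<epsilon>)" by (intro pos_slow_scale_mult[of "\<lambda>_. 2"] pos_slow_scale_const s1) simp
  ultimately show ?thesis by blast
qed

lemma symb_lower_powr:
  assumes K: "compact K" "K \<subseteq> U"
  shows "\<exists>q>0. \<forall>\<^sub>F (\<epsilon>, \<xi>) in high_freq \<Gamma>. \<forall>x\<in>K. \<epsilon> powr q * jb \<xi> powr m \<le> norm (symb m a \<epsilon> x \<xi>)"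
proof -
  obtain s where s: "pos_slow_scale s" "\<forall>\<^sub>F (\<epsilon>, \<xi>) in high_freq \<Gamma>. \<forall>x\<in>K. A \<epsilon> x * jb \<xi> ^ m \<le> s \<epsilon> * norm (symb m a \<epsilon> x \<xi>)"
    using symb_lower[OF K] by blast
  obtain q where q: "0 \<le> q" "\<forall>\<^sub>F \<epsilon> in at_right 0. \<forall>x\<in>K. \<epsilon> powr q \<le> A \<epsilon> x" using lower[OF K] by blast
  have "\<forall>\<^sub>F (\<epsilon>, \<xi>) in high_freq \<Gamma>. \<forall>x\<in>K. \<epsilon> powr (q + 1) * jb \<xi> powr m \<le> norm (symb m a \<epsilon> x \<xi>)"
    using s(2) eventually_high_freq_eps[OF q(2)] eventually_high_freq_eps[OF pos_slow_scale_powr_le[OF s(1) zero_le_one]]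
      eventually_high_freq_cone eventually_high_freq_eps[OF pos_slow_scale_pos[OF s(1)]]
  proof (eventually_elim, safe)
    fix \<epsilon> x and \<xi> :: "real^'n"
    assume 1: "\<forall>x\<in>K. A \<epsilon> x * jb \<xi> ^ m \<le> s \<epsilon> * norm (symb m a \<epsilon> x \<xi>)"
      and 2: "\<forall>x\<in>K. \<epsilon> powr q \<le> A \<epsilon> x" and 3: "s \<epsilon> powr 1 \<le> 1 / \<epsilon>" and \<epsilon>: "0 < \<epsilon>" and s: "0 < s \<epsilon>" and x: "x \<in> K"
    have "\<epsilon> powr q * jb \<xi> ^ m \<le> A \<epsilon> x * jb \<xi> ^ m" by (intro mult_right_mono bspec[OF 2 x]) simp
    also have "\<dots> \<le> s \<epsilon> * norm (symb m a \<epsilon> x \<xi>)" using 1 x by blast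
    also have "\<dots> \<le> 1 / \<epsilon> * norm (symb m a \<epsilon> x \<xi>)" using 3 s by (intro mult_right_mono) auto
    finally have "\<epsilon> * (\<epsilon> powr q * jb \<xi> ^ m) \<le> \<epsilon> * (1 / \<epsilon> * norm (symb m a \<epsilon> x \<xi>))"
      by (rule mult_left_mono) (use \<epsilon> in simp)
    thus "\<epsilon> powr (q + 1) * jb \<xi> powr m \<le> norm (symb m a \<epsilon> x \<xi>)"
      using \<epsilon> by (simp add: powr_add powr_realpow mult_ac)
  qed
  thus ?thesis using q(1) by (intro exI[of _ "q + 1"]) auto
qed

text \<open>
  The variable \<open>x\<close> occurs only in the coefficients and \<open>\<xi>\<close> only in the monomials. Each derivative of a
  monomial of degree at most \<open>m\<close> loses as many powers of \<open>1 + |\<xi>|\<close> as derivatives are taken, and the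
  factor \<open>A (1 + |\<xi>|)\<^sup>m\<close> that remains is controlled by the symbol.
\<close>

lemma symb_deriv_upper:
  assumes K: "compact K" "K \<subseteq> U"
  shows "\<exists>s. pos_slow_scale s \<and> (\<forall>\<^sub>F (\<epsilon>, \<xi>) in high_freq \<Gamma>. \<forall>\<beta>. mi_abs \<beta> \<le> m \<longrightarrow> (\<forall>x\<in>K.
    norm (symb_deriv \<alpha> \<beta> (symb m a \<epsilon>) x \<xi>) \<le> s \<epsilon> * norm (symb m a \<epsilon> x \<xi>) * jb \<xi> powr (- real (mi_abs \<beta>))))"
proof -
  obtain s1 where s1: "pos_slow_scale s1" "\<forall>\<^sub>F (\<epsilon>, \<xi>) in high_freq \<Gamma>. \<forall>x\<in>K. A \<epsilon> x * jb \<xi> ^ m \<le> s1 \<epsilon> * norm (symb m a \<epsilon> x \<xi>)"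
    using symb_lower[OF K] by blast
  obtain s2 where s2: "pos_slow_scale s2" "\<forall>\<^sub>F (\<epsilon>, \<xi>) in high_freq \<Gamma>.
      \<forall>\<beta>. mi_abs \<beta> \<le> m \<longrightarrow> (\<forall>x\<in>K. norm (mi_deriv \<alpha> (a \<beta> \<epsilon>) x) \<le> s2 \<epsilon> * A \<epsilon> x)"
    using derivs[OF K, of \<alpha>] by blast
  let ?M = "{\<gamma> :: 'n multi_index. mi_abs \<gamma> \<le> m}"
  let ?mon = "\<lambda>\<gamma> (\<eta>::real^'n). complex_of_real (mi_power \<eta> \<gamma>)"
  have "\<forall>\<beta> \<gamma>. \<exists>c. \<forall>\<xi>. norm (mi_deriv \<beta> (?mon \<gamma>) \<xi>) \<le> c * jb \<xi> powr (real (mi_abs \<gamma>) - real (mi_abs \<beta>))"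
  proof (intro allI)
    fix \<beta> \<gamma>
    obtain c \<gamma>' where c: "\<And>\<eta>. pderivs (mi_list \<beta>) (?mon \<gamma>) \<eta> = c * complex_of_real (mi_power \<eta> \<gamma>')"
      "c = 0 \<or> mi_abs \<gamma>' + mi_abs \<beta> = mi_abs \<gamma>" using pderivs_monomial[of "mi_list \<beta>" \<gamma>] unfolding length_mi_list by blast
    have "norm (mi_deriv \<beta> (?mon \<gamma>) \<xi>) \<le> norm c * jb \<xi> powr (real (mi_abs \<gamma>) - real (mi_abs \<beta>))" for \<xi>
    proof (cases "c = 0")
      case False
      hence e: "real (mi_abs \<gamma>) - real (mi_abs \<beta>) = real (mi_abs \<gamma>')" using c(2) by linarith
      show ?thesis unfolding mi_deriv_eq_pderivs c(1) norm_mult norm_of_real e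
        by (intro mult_left_mono abs_mi_power_le) simp
    qed (simp add: mi_deriv_eq_pderivs c(1))
    thus "\<exists>c. \<forall>\<xi>. norm (mi_deriv \<beta> (?mon \<gamma>) \<xi>) \<le> c * jb \<xi> powr (real (mi_abs \<gamma>) - real (mi_abs \<beta>))" by blast
  qed
  then obtain c where c: "\<And>\<beta> \<gamma> \<xi>. norm (mi_deriv \<beta> (?mon \<gamma>) \<xi>) \<le> c \<beta> \<gamma> * jb \<xi> powr (real (mi_abs \<gamma>) - real (mi_abs \<beta>))"
    by metis
  define C where "C = (\<Sum>\<beta>\<in>?M. \<Sum>\<gamma>\<in>?M. \<bar>c \<beta> \<gamma>\<bar>) + 1"
  have C: "0 < C" unfolding C_def by (intro add_nonneg_pos sum_nonneg) auto
  have "\<forall>\<^sub>F (\<epsilon>, \<xi>) in high_freq \<Gamma>. \<forall>\<beta>. mi_abs \<beta> \<le> m \<longrightarrow> (\<forall>x\<in>K.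
    norm (symb_deriv \<alpha> \<beta> (symb m a \<epsilon>) x \<xi>) \<le> (C * (s2 \<epsilon> * s1 \<epsilon>)) * norm (symb m a \<epsilon> x \<xi>) * jb \<xi> powr (- real (mi_abs \<beta>)))"
    using s1(2) s2(2) eventually_high_freq_cone eventually_high_freq_eps[OF pos_slow_scale_pos[OF s2(1)]]
  proof (eventually_elim, safe)
    fix \<epsilon> x and \<xi> :: "real^'n" and \<beta> :: "'n multi_index"
    assume 1: "\<forall>x\<in>K. A \<epsilon> x * jb \<xi> ^ m \<le> s1 \<epsilon> * norm (symb m a \<epsilon> x \<xi>)"
      and 2: "\<forall>\<beta>. mi_abs \<beta> \<le> m \<longrightarrow> (\<forall>x\<in>K. norm (mi_deriv \<alpha> (a \<beta> \<epsilon>) x) \<le> s2 \<epsilon> * A \<epsilon> x)"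
      and \<epsilon>: "0 < \<epsilon>" "\<epsilon> \<le> 1" and s2: "0 < s2 \<epsilon>" and x: "x \<in> K" and \<beta>: "mi_abs \<beta> \<le> m"
    have A0: "0 \<le> A \<epsilon> x" by (rule top_size_nonneg)
    have inner: "mi_deriv \<beta> (\<lambda>\<eta>. symb m a \<epsilon> y \<eta>) \<xi> = (\<Sum>\<gamma>\<in>?M. mi_deriv \<beta> (?mon \<gamma>) \<xi> * a \<gamma> \<epsilon> y)" for y
      unfolding symb_def mi_deriv_eq_pderivs
      using pderivs_sum_cmult[OF open_UNIV smooth_on_monomial[OF open_UNIV] UNIV_I, of "mi_list \<beta>" "\<lambda>\<gamma>. a \<gamma> \<epsilon> y" "\<lambda>\<gamma>. \<gamma>" ?M \<xi>]
      by (simp add: mult.commute)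
    have "symb_deriv \<alpha> \<beta> (symb m a \<epsilon>) x \<xi> = (\<Sum>\<gamma>\<in>?M. mi_deriv \<beta> (?mon \<gamma>) \<xi> * mi_deriv \<alpha> (a \<gamma> \<epsilon>) x)"
      unfolding symb_deriv_def inner unfolding mi_deriv_eq_pderivs[of \<alpha>]
      by (rule pderivs_sum_cmult[OF \<Omega>]) (use coeffs mod_bounds_smooth \<epsilon> K U x in auto)
    also have "norm \<dots> \<le> (\<Sum>\<gamma>\<in>?M. \<bar>c \<beta> \<gamma>\<bar> * (jb \<xi> powr (real m - real (mi_abs \<beta>)) * (s2 \<epsilon> * A \<epsilon> x)))"
    proof (rule sum_norm_le)
      fix \<gamma> assume "\<gamma> \<in> ?M"
      hence \<gamma>: "mi_abs \<gamma> \<le> m" by simp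
      have "norm (mi_deriv \<beta> (?mon \<gamma>) \<xi>) \<le> c \<beta> \<gamma> * jb \<xi> powr (real (mi_abs \<gamma>) - real (mi_abs \<beta>))" by (rule c)
      also have "\<dots> \<le> \<bar>c \<beta> \<gamma>\<bar> * jb \<xi> powr (real m - real (mi_abs \<beta>))"
        by (intro mult_mono jb_powr_mono) (use \<gamma> in auto)
      finally have "norm (mi_deriv \<beta> (?mon \<gamma>) \<xi>) * norm (mi_deriv \<alpha> (a \<gamma> \<epsilon>) x)
          \<le> (\<bar>c \<beta> \<gamma>\<bar> * jb \<xi> powr (real m - real (mi_abs \<beta>))) * (s2 \<epsilon> * A \<epsilon> x)"
        using 2 \<gamma> x by (intro mult_mono) auto
      thus "norm (mi_deriv \<beta> (?mon \<gamma>) \<xi> * mi_deriv \<alpha> (a \<gamma> \<epsilon>) x) \<le> \<bar>c \<beta> \<gamma>\<bar> * (jb \<xi> powr (real m - real (mi_abs \<beta>)) * (s2 \<epsilon> * A \<epsilon> x))"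
        by (simp add: norm_mult mult_ac)
    qed
    also have "\<dots> = (\<Sum>\<gamma>\<in>?M. \<bar>c \<beta> \<gamma>\<bar>) * (jb \<xi> powr (real m - real (mi_abs \<beta>)) * (s2 \<epsilon> * A \<epsilon> x))"
      by (simp add: sum_distrib_right)
    also have "\<dots> \<le> C * (jb \<xi> powr (real m - real (mi_abs \<beta>)) * (s2 \<epsilon> * A \<epsilon> x))"
    proof (rule mult_right_mono)
      have "(\<Sum>\<gamma>\<in>?M. \<bar>c \<beta> \<gamma>\<bar>) \<le> (\<Sum>\<beta>\<in>?M. \<Sum>\<gamma>\<in>?M. \<bar>c \<beta> \<gamma>\<bar>)"
        by (rule member_le_sum[of \<beta> ?M "\<lambda>\<beta>. \<Sum>\<gamma>\<in>?M. \<bar>c \<beta> \<gamma>\<bar>"]) (use \<beta> finite_mi_le in \<open>auto intro: sum_nonneg\<close>)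
      thus "(\<Sum>\<gamma>\<in>?M. \<bar>c \<beta> \<gamma>\<bar>) \<le> C" by (simp add: C_def)
    qed (use s2 A0 in simp)
    also have "\<dots> = (C * s2 \<epsilon> * jb \<xi> powr (- real (mi_abs \<beta>))) * (A \<epsilon> x * jb \<xi> ^ m)"
      using powr_add[of "jb \<xi>" "real m" "- real (mi_abs \<beta>)"] by (simp add: powr_realpow)
    also have "\<dots> \<le> (C * s2 \<epsilon> * jb \<xi> powr (- real (mi_abs \<beta>))) * (s1 \<epsilon> * norm (symb m a \<epsilon> x \<xi>))"
      using C s2 1 x by (intro mult_left_mono) auto
    finally show "norm (symb_deriv \<alpha> \<beta> (symb m a \<epsilon>) x \<xi>) \<le> (C * (s2 \<epsilon> * s1 \<epsilon>)) * norm (symb m a \<epsilon> x \<xi>) * jb \<xi> powr (- real (mi_abs \<beta>))"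
      by (simp add: mult_ac)
  qed
  moreover have "pos_slow_scale (\<lambda>\<epsilon>. C * (s2 \<epsilon> * s1 \<epsilon>))"
    by (intro pos_slow_scale_mult[of "\<lambda>_. C"] pos_slow_scale_mult pos_slow_scale_const s1 s2 C)
  ultimately show ?thesis by blast
qed

text \<open>
  Slow scale factors turn into the small loss of the symbol classes.
\<close>

lemma elliptic_data:
  assumes K: "compact K" "K \<subseteq> U" and \<Gamma>': "\<Gamma>' \<subseteq> \<Gamma>"
  shows "elliptic_data m a \<Gamma>' K \<Omega> A"
proof
  show "compact K" "open \<Omega>" "K \<subseteq> \<Omega>" using K \<Omega> U by auto
  have smooth: "smooth_on \<Omega> (a \<alpha> \<epsilon>)" if "mi_abs \<alpha> \<le> m" "\<epsilon> \<in> {0<..1}" for \<alpha> \<epsilon>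
    by (rule mod_bounds_smooth[OF coeffs[OF that(1)] that(2)])
  thus "\<And>\<alpha> \<epsilon>. mi_abs \<alpha> \<le> m \<Longrightarrow> \<epsilon> \<in> {0<..1} \<Longrightarrow> smooth_on \<Omega> (a \<alpha> \<epsilon>)" .
  obtain q where "\<forall>\<^sub>F \<epsilon> in at_right 0. \<forall>x\<in>K. \<epsilon> powr q \<le> A \<epsilon> x" using lower[OF K] by blast
  with eventually_unit show "\<forall>\<^sub>F \<epsilon> in at_right 0. \<forall>x\<in>K. 0 < A \<epsilon> x"
  proof (eventually_elim, safe)
    fix \<epsilon> :: real and x assume "0 < \<epsilon>" "\<forall>x\<in>K. \<epsilon> powr q \<le> A \<epsilon> x" "x \<in> K"
    thus "0 < A \<epsilon> x" using less_le_trans[of 0 "\<epsilon> powr q" "A \<epsilon> x"] by simp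
  qed
  show "symbol \<Gamma>' K (\<lambda>\<epsilon> \<xi>. A \<epsilon>) (\<lambda>\<epsilon> \<xi>. a \<alpha> \<epsilon>)" if \<alpha>: "mi_abs \<alpha> \<le> m" for \<alpha>
  proof (intro allI symbol_uptoI_lists)
    show "\<forall>\<^sub>F (\<epsilon>, \<xi>) in high_freq \<Gamma>'. smooth_near K (a \<alpha> \<epsilon>)"
      using eventually_high_freq_cone
    proof (eventually_elim, safe)
      fix \<epsilon> :: real assume "0 < \<epsilon>" "\<epsilon> \<le> 1"
      thus "smooth_near K (a \<alpha> \<epsilon>)" using K U by (intro smooth_near_on[OF \<Omega> _ smooth[OF \<alpha>]]) auto
    qed
    fix "is" :: "'n list" and \<theta> :: real assume \<theta>: "0 < \<theta>"
    obtain s where s: "pos_slow_scale s" "\<forall>\<^sub>F (\<epsilon>, \<xi>) in high_freq \<Gamma>.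
      \<forall>\<beta>. mi_abs \<beta> \<le> m \<longrightarrow> (\<forall>x\<in>K. norm (mi_deriv (count (mset is)) (a \<beta> \<epsilon>) x) \<le> s \<epsilon> * A \<epsilon> x)"
      using derivs[OF K] by blast
    show "\<forall>\<^sub>F (\<epsilon>, \<xi>) in high_freq \<Gamma>'. \<forall>x\<in>K. norm (pderivs is (a \<alpha> \<epsilon>) x) \<le> A \<epsilon> x * jb \<xi> powr \<theta>"
      using high_freq_subset[OF s(2) \<Gamma>'] eventually_slow_le_jb[OF s(1) \<theta>] eventually_high_freq_cone
    proof (eventually_elim, safe)
      fix \<epsilon> x and \<xi> :: "real^'n"
      assume b: "\<forall>\<beta>. mi_abs \<beta> \<le> m \<longrightarrow> (\<forall>x\<in>K. norm (mi_deriv (count (mset is)) (a \<beta> \<epsilon>) x) \<le> s \<epsilon> * A \<epsilon> x)"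
        and s: "s \<epsilon> \<le> jb \<xi> powr \<theta>" and \<epsilon>: "0 < \<epsilon>" "\<epsilon> \<le> 1" and x: "x \<in> K"
      have "norm (pderivs is (a \<alpha> \<epsilon>) x) \<le> s \<epsilon> * A \<epsilon> x"
        using b \<alpha> x pderivs_eq_mi_deriv[OF \<Omega> smooth[OF \<alpha>], of \<epsilon> x "is"] \<epsilon> K U by auto
      also have "\<dots> \<le> jb \<xi> powr \<theta> * A \<epsilon> x" by (intro mult_right_mono s top_size_nonneg)
      finally show "norm (pderivs is (a \<alpha> \<epsilon>) x) \<le> A \<epsilon> x * jb \<xi> powr \<theta>" by (simp add: mult.commute)
    qed
  qed
  fix \<theta> :: real assume \<theta>: "0 < \<theta>"
  obtain s where s: "pos_slow_scale s" "\<forall>\<^sub>F (\<epsilon>, \<xi>) in high_freq \<Gamma>. \<forall>x\<in>K. A \<epsilon> x * jb \<xi> ^ m \<le> s \<epsilon> * norm (symb m a \<epsilon> x \<xi>)"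
    using symb_lower[OF K] by blast
  show "\<forall>\<^sub>F (\<epsilon>, \<xi>) in high_freq \<Gamma>'. \<forall>x\<in>K. A \<epsilon> x * jb \<xi> powr m \<le> norm (symb m a \<epsilon> x \<xi>) * jb \<xi> powr \<theta>"
    using high_freq_subset[OF s(2) \<Gamma>'] eventually_slow_le_jb[OF s(1) \<theta>]
  proof (eventually_elim, safe)
    fix \<epsilon> x and \<xi> :: "real^'n"
    assume 1: "\<forall>x\<in>K. A \<epsilon> x * jb \<xi> ^ m \<le> s \<epsilon> * norm (symb m a \<epsilon> x \<xi>)" and s: "s \<epsilon> \<le> jb \<xi> powr \<theta>" and x: "x \<in> K"
    have "s \<epsilon> * norm (symb m a \<epsilon> x \<xi>) \<le> jb \<xi> powr \<theta> * norm (symb m a \<epsilon> x \<xi>)" by (intro mult_right_mono s) simp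
    with bspec[OF 1 x] show "A \<epsilon> x * jb \<xi> powr m \<le> norm (symb m a \<epsilon> x \<xi>) * jb \<xi> powr \<theta>"
      by (simp add: powr_realpow mult.commute)
  qed
qed

end

section \<open>Microlocal regularity of nets\<close>

lemma test_fun_csmooth:
  assumes "test_fun U \<phi>"
  shows "compact (closure {x. \<phi> x \<noteq> 0})" "csmooth (closure {x. \<phi> x \<noteq> 0}) \<phi>" "closure {x. \<phi> x \<noteq> 0} \<subseteq> U"
  using assms closure_subset[of "{x. \<phi> x \<noteq> 0}"] by (auto simp: test_fun_def csmooth_def)

lemma powr_minus_mono: "0 < \<epsilon> \<Longrightarrow> \<epsilon> \<le> 1 \<Longrightarrow> p \<le> q \<Longrightarrow> \<epsilon> powr (- p) \<le> \<epsilon> powr (- q)"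
  for \<epsilon> :: real by (rule powr_mono') auto

lemma finite_sum_bound:
  fixes f :: "'i \<Rightarrow> 'n::finite net"
  assumes "finite I" "\<And>i. i \<in> I \<Longrightarrow> \<exists>p\<ge>0. \<forall>\<^sub>F \<epsilon> in at_right 0. \<forall>x\<in>K. norm (f i \<epsilon> x) \<le> \<epsilon> powr (- p)"
  shows "\<exists>p\<ge>0. \<forall>\<^sub>F \<epsilon> in at_right 0. \<forall>x\<in>K. (\<Sum>i\<in>I. norm (f i \<epsilon> x)) \<le> \<epsilon> powr (- p)"
  using assms
proof (induction I rule: finite_induct)
  case empty
  show ?case by (rule exI[of _ 0]) simp
next
  case (insert i I)
  obtain p where p: "0 \<le> p" "\<forall>\<^sub>F \<epsilon> in at_right 0. \<forall>x\<in>K. norm (f i \<epsilon> x) \<le> \<epsilon> powr (- p)"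
    using insert.prems by blast
  obtain q where q: "0 \<le> q" "\<forall>\<^sub>F \<epsilon> in at_right 0. \<forall>x\<in>K. (\<Sum>i\<in>I. norm (f i \<epsilon> x)) \<le> \<epsilon> powr (- q)"
    using insert.IH insert.prems by blast
  have "\<forall>\<^sub>F \<epsilon> in at_right 0. \<forall>x\<in>K. (\<Sum>i\<in>insert i I. norm (f i \<epsilon> x)) \<le> \<epsilon> powr (- (p + q + 1))"
    using p(2) q(2) eventually_unit eventually_const_le_inverse[of 2]
  proof (eventually_elim, safe)
    fix \<epsilon> x
    assume 1: "\<forall>x\<in>K. norm (f i \<epsilon> x) \<le> \<epsilon> powr (- p)" and 2: "\<forall>x\<in>K. (\<Sum>i\<in>I. norm (f i \<epsilon> x)) \<le> \<epsilon> powr (- q)"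
      and \<epsilon>: "0 < \<epsilon>" "\<epsilon> \<le> 1" "2 \<le> 1 / \<epsilon>" and x: "x \<in> K"
    have "(\<Sum>i\<in>insert i I. norm (f i \<epsilon> x)) \<le> \<epsilon> powr (- p) + \<epsilon> powr (- q)"
      using insert.hyps bspec[OF 1 x] bspec[OF 2 x] by simp
    also have "\<dots> \<le> 2 * \<epsilon> powr (- (p + q))"
      using powr_minus_mono[OF \<epsilon>(1,2), of p "p + q"] powr_minus_mono[OF \<epsilon>(1,2), of q "p + q"] p(1) q(1) by linarith
    also have "\<dots> \<le> 1 / \<epsilon> * \<epsilon> powr (- (p + q))" by (intro mult_right_mono \<epsilon>) simp
    also have "\<dots> = \<epsilon> powr (- (p + q) - 1)" by (rule powr_minus1[OF \<epsilon>(1), symmetric])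
    finally show "(\<Sum>i\<in>insert i I. norm (f i \<epsilon> x)) \<le> \<epsilon> powr (- (p + q + 1))" by simp
  qed
  thus ?case using p(1) q(1) by (intro exI[of _ "p + q + 1"]) auto
qed

text \<open>
  A bound without decay, for all frequencies.
\<close>

lemma local_fourier_bound:
  assumes \<psi>: "test_fun U \<psi>"
    and f: "\<forall>\<^sub>F \<epsilon> in at_right 0. \<forall>x\<in>closure {x. \<psi> x \<noteq> 0}. norm (f \<epsilon> x) \<le> \<epsilon> powr (- p)"
  shows "decay (cone_freq UNIV) p 0 (local_fourier \<psi> f)"
proof -
  let ?K = "closure {x. \<psi> x \<noteq> 0}"
  note t = test_fun_csmooth[OF \<psi>]
  obtain B where B: "0 \<le> B" "\<And>x. norm (\<psi> x) \<le> B" using csmooth_bounded[OF t(1,2)] by blast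
  have "\<forall>\<^sub>F \<epsilon> in at_right 0. \<forall>\<zeta>\<in>UNIV. norm (local_fourier \<psi> f \<epsilon> \<zeta>) \<le> (measure lborel ?K * B) * \<epsilon> powr (- p) * jb \<zeta> powr (- real 0)"
    using f
  proof (eventually_elim, safe)
    fix \<epsilon> \<zeta> assume f: "\<forall>x\<in>?K. norm (f \<epsilon> x) \<le> \<epsilon> powr (- p)"
    have "norm (fourier (\<lambda>x. \<psi> x * f \<epsilon> x) \<zeta>) \<le> measure lborel ?K * (B * \<epsilon> powr (- p))"
    proof (rule norm_fourier_le[OF t(1)])
      show "norm (\<psi> x * f \<epsilon> x) \<le> B * \<epsilon> powr (- p)" if "x \<in> ?K" for x
        unfolding norm_mult by (intro mult_mono B bspec[OF f that] norm_ge_zero)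
      show "\<psi> x * f \<epsilon> x = 0" if "x \<notin> ?K" for x
        using t(2) that unfolding csmooth_def by (metis mult_zero_left)
      show "0 \<le> B * \<epsilon> powr (- p)" using B(1) by simp
    qed
    thus "norm (local_fourier \<psi> f \<epsilon> \<zeta>) \<le> (measure lborel ?K * B) * \<epsilon> powr (- p) * jb \<zeta> powr (- real 0)"
      by (simp add: mult.assoc local_fourier_def)
  qed
  thus ?thesis unfolding decay_def eventually_cone_freq prod.case by blast
qed

lemma micro_regular_net_iff:
  "micro_regular_net \<Omega> f x\<^sub>1 \<xi>\<^sub>1 \<longleftrightarrow> (\<exists>U \<Gamma>. open U \<and> x\<^sub>1 \<in> U \<and> U \<subseteq> \<Omega> \<and> open_cone \<Gamma> \<and> \<xi>\<^sub>1 \<in> \<Gamma> \<and>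
    (\<forall>\<phi>. test_fun U \<phi> \<longrightarrow> (\<exists>N. \<forall>l. decay (cone_freq \<Gamma>) N l (local_fourier \<phi> f))))"
  unfolding micro_regular_net_def decay_cone_freq_iff local_fourier_def ..

lemma growth_mono:
  assumes "\<forall>\<^sub>F \<epsilon> in at_right 0. \<forall>x\<in>K. norm (f \<epsilon> x) \<le> \<epsilon> powr (- p)" "p \<le> q"
  shows "\<forall>\<^sub>F \<epsilon> in at_right 0. \<forall>x\<in>K. norm (f \<epsilon> x) \<le> \<epsilon> powr (- q)"
  using assms(1) eventually_unit
proof (eventually_elim, safe)
  fix \<epsilon> x assume "\<forall>x\<in>K. norm (f \<epsilon> x) \<le> \<epsilon> powr (- p)" "0 < \<epsilon>" "\<epsilon> \<le> 1" "x \<in> K"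
  thus "norm (f \<epsilon> x) \<le> \<epsilon> powr (- q)" using powr_minus_mono[of \<epsilon> p q] assms(2) by force
qed

text \<open>
  The exponent \<open>N\<close> comes from one fixed cut-off near the support of \<open>\<phi>\<close>; it depends on neither the symbol
  nor the order of decay.
\<close>

lemma multiplier_micro:
  fixes f :: "'n::finite net"
  assumes \<Omega>: "open \<Omega>" and f: "\<And>\<epsilon>. \<epsilon> \<in> {0<..1} \<Longrightarrow> smooth_on \<Omega> (f \<epsilon>)"
    and fb: "\<And>K. compact K \<Longrightarrow> K \<subseteq> \<Omega> \<Longrightarrow> \<exists>p\<ge>0. \<forall>\<^sub>F \<epsilon> in at_right 0. \<forall>x\<in>K. norm (f \<epsilon> x) \<le> \<epsilon> powr (- p)"
    and U: "open U" "U \<subseteq> \<Omega>"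
    and dec: "\<And>\<psi>. test_fun U \<psi> \<Longrightarrow> \<exists>N. \<forall>l. decay (cone_freq \<Gamma>\<^sub>1) N l (local_fourier \<psi> f)"
    and d: "0 < d" "d \<le> 1" "\<And>\<xi> \<eta>. \<xi> \<in> \<Gamma> \<Longrightarrow> norm \<eta> \<le> d * norm \<xi> \<Longrightarrow> \<xi> - \<eta> \<in> \<Gamma>\<^sub>1"
    and \<phi>: "test_fun U \<phi>"
  defines "K \<equiv> closure {x. \<phi> x \<noteq> 0}"
  shows "\<exists>N. \<forall>b w q M l. symbol \<Gamma> K w b \<longrightarrow> (\<forall>\<^sub>F (\<epsilon>, \<xi>) in high_freq \<Gamma>. csmooth K (b \<epsilon> \<xi>)) \<longrightarrow>
    (\<forall>\<^sub>F (\<epsilon>, \<xi>) in high_freq \<Gamma>. \<forall>x\<in>K. w \<epsilon> \<xi> x \<le> \<epsilon> powr (- q) * jb \<xi> powr M) \<longrightarrow>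
    decay (high_freq \<Gamma>) (N + q) l (osc_integral f b)"
proof -
  obtain \<psi> where \<psi>: "test_fun U \<psi>" "\<And>x. x \<in> K \<Longrightarrow> \<psi> x \<noteq> 0"
    using cutoff_nonzero_on_support[OF \<phi> U(1)] unfolding K_def by blast
  note t = test_fun_csmooth[OF \<psi>(1)]
  have K: "compact K" unfolding K_def by (rule test_fun_csmooth[OF \<phi>])
  obtain N0 where N0: "\<And>l. decay (cone_freq \<Gamma>\<^sub>1) N0 l (local_fourier \<psi> f)" using dec[OF \<psi>(1)] by blast
  obtain p where p: "\<forall>\<^sub>F \<epsilon> in at_right 0. \<forall>x\<in>closure {x. \<psi> x \<noteq> 0}. norm (f \<epsilon> x) \<le> \<epsilon> powr (- p)"
    using fb[OF t(1)] t(3) U(2) by blast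
  define N where "N = max N0 p"
  have dec': "decay (cone_freq \<Gamma>\<^sub>1) N l (local_fourier \<psi> f)" for l
    by (rule decay_mono[OF N0 _ eventually_cone_freq_eps]) (simp add: N_def)
  have bdd: "decay (cone_freq UNIV) N 0 (local_fourier \<psi> f)"
    by (rule decay_mono[OF local_fourier_bound[OF \<psi>(1) p] _ eventually_cone_freq_eps]) (simp add: N_def)
  have gi: "\<forall>\<^sub>F \<epsilon> in at_right 0. integrable lborel (\<lambda>x. \<psi> x * f \<epsilon> x)"
    using eventually_unit
  proof eventually_elim
    case (elim \<epsilon>)
    hence "csmooth (closure {x. \<psi> x \<noteq> 0}) (\<lambda>x. f \<epsilon> x * \<psi> x)"
      using t U(2) by (intro csmooth_mult[OF t(1) \<Omega>] f) auto
    from csmooth_integrable[OF t(1) this] show ?case by (simp add: mult.commute)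
  qed
  have sm: "smooth_on UNIV \<psi>" using t(2) by (simp add: csmooth_def)
  show ?thesis
    by (rule exI[of _ N], intro allI impI, rule multiplier[OF K sm \<psi>(2) gi dec' bdd d])
qed

text \<open>
  All derivatives of a negligible net are bounded by 1 for small \<open>\<epsilon>\<close>, so it is a symbol of weight 1, and
  the Fourier transform of its product with a test function decreases rapidly.
\<close>

lemma micro_regular_net_negligible:
  fixes f h :: "'n::finite net"
  assumes \<Omega>: "open \<Omega>" and h: "h \<in> negligible_nets \<Omega>" and f: "\<And>\<epsilon>. \<epsilon> \<in> {0<..1} \<Longrightarrow> smooth_on \<Omega> (f \<epsilon>)"
    and reg: "micro_regular_net \<Omega> (\<lambda>\<epsilon> x. h \<epsilon> x + f \<epsilon> x) x\<^sub>1 \<xi>\<^sub>1"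
  shows "micro_regular_net \<Omega> f x\<^sub>1 \<xi>\<^sub>1"
proof -
  obtain U \<Gamma> where U: "open U" "x\<^sub>1 \<in> U" "U \<subseteq> \<Omega>" "open_cone \<Gamma>" "\<xi>\<^sub>1 \<in> \<Gamma>"
    and dec: "\<And>\<phi>. test_fun U \<phi> \<Longrightarrow> \<exists>N. \<forall>l. decay (cone_freq \<Gamma>) N l (local_fourier \<phi> (\<lambda>\<epsilon> x. h \<epsilon> x + f \<epsilon> x))"
    using reg unfolding micro_regular_net_iff by blast
  have "\<exists>N. \<forall>l. decay (cone_freq \<Gamma>) N l (local_fourier \<phi> f)" if \<phi>: "test_fun U \<phi>" for \<phi>
  proof -
    define K where "K = closure {x. \<phi> x \<noteq> 0}"
    note t = test_fun_csmooth[OF \<phi>, folded K_def]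
    have K: "compact K" "K \<subseteq> \<Omega>" using t U by auto
    obtain N where N: "\<And>l. decay (cone_freq \<Gamma>) N l (local_fourier \<phi> (\<lambda>\<epsilon> x. h \<epsilon> x + f \<epsilon> x))"
      using dec[OF \<phi>] by blast
    have cut: "csmooth K (\<lambda>x. \<phi> x * g x)" if "smooth_on \<Omega> g" for g
      using csmooth_mult[OF K(1) \<Omega> K(2) that t(2)] by (simp add: mult.commute)
    have sh: "symbol \<Gamma> K (\<lambda>_ _ _. 1) (\<lambda>\<epsilon> \<xi>. h \<epsilon>)"
    proof (intro allI symbol_uptoI_lists)
      show "\<forall>\<^sub>F (\<epsilon>, \<xi>) in high_freq \<Gamma>. smooth_near K (h \<epsilon>)"
        using eventually_high_freq_cone
      proof (eventually_elim, safe)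
        fix \<epsilon> :: real assume "0 < \<epsilon>" "\<epsilon> \<le> 1"
        thus "smooth_near K (h \<epsilon>)" by (intro smooth_near_on[OF \<Omega> K(2)] negligible_smooth[OF h]) auto
      qed
      fix "is" :: "'n list" and \<theta> :: real assume \<theta>: "0 < \<theta>"
      show "\<forall>\<^sub>F (\<epsilon>, \<xi>) in high_freq \<Gamma>. \<forall>x\<in>K. norm (pderivs is (h \<epsilon>) x) \<le> 1 * jb \<xi> powr \<theta>"
        using eventually_high_freq_eps[OF negligible_bound[OF \<Omega> h K order_refl, of "is"]] eventually_high_freq_cone
      proof (eventually_elim, safe)
        fix \<epsilon> x and \<xi> :: "real^'n"
        assume 1: "\<forall>x\<in>K. norm (pderivs is (h \<epsilon>) x) \<le> \<epsilon> powr 0" and "0 < \<epsilon>" and x: "x \<in> K"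
        hence "norm (pderivs is (h \<epsilon>) x) \<le> 1" using bspec[OF 1 x] by simp
        also have "1 \<le> jb \<xi> powr \<theta>" using \<theta> by (intro one_le_jb_powr) simp
        finally show "norm (pderivs is (h \<epsilon>) x) \<le> 1 * jb \<xi> powr \<theta>" by simp
      qed
    qed
    have s\<phi>: "symbol \<Gamma> K (\<lambda>_ _ _. 1) (\<lambda>_ _. \<phi>)"
      by (intro allI symbol_upto_fixed[OF K(1)] csmooth_smooth_near t)
    have prod: "symbol_upto k \<Gamma> K (\<lambda>_ _ _. 1) (\<lambda>\<epsilon> \<xi> x. \<phi> x * h \<epsilon> x)" for k
      using symbol_upto_mult[OF s\<phi>[rule_format] sh[rule_format], of k] by simp
    have decay_h: "decay (cone_freq \<Gamma>) (0 + 1) l (local_fourier \<phi> h)" for l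
    proof (rule low_frequencies)
      show "decay (cone_freq UNIV) 0 0 (local_fourier \<phi> h)"
        by (rule local_fourier_bound[OF \<phi>])
           (use negligible_bound[OF \<Omega> h K order_refl, of "[]"] in \<open>simp add: K_def\<close>)
      define C where "C = (1 + real CARD('n)) ^ (l + 1) * measure lborel K"
      have "\<forall>\<^sub>F (\<epsilon>, \<xi>) in high_freq \<Gamma>. norm (local_fourier \<phi> h \<epsilon> \<xi>) \<le> C * \<epsilon> powr (- 0) * jb \<xi> powr (- real l)"
        using symbol_upto_lists[OF prod[of "l + 1"] zero_less_one] eventually_high_freq_cone
      proof (eventually_elim, safe)
        fix \<epsilon> and \<xi> :: "real^'n"
        assume b: "\<forall>is. length is \<le> l + 1 \<longrightarrow> (\<forall>x\<in>K. norm (pderivs is (\<lambda>x. \<phi> x * h \<epsilon> x) x) \<le> 1 * jb \<xi> powr 1)"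
          and \<epsilon>: "0 < \<epsilon>" "\<epsilon> \<le> 1"
        have "jb \<xi> ^ (l + 1) * norm (fourier (\<lambda>x. \<phi> x * h \<epsilon> x) \<xi>)
            \<le> (1 + real CARD('n)) ^ (l + 1) * (measure lborel K * jb \<xi>)"
          using b \<epsilon> by (intro fourier_decay[OF K(1) cut] negligible_smooth[OF h]) auto
        hence "jb \<xi> * (jb \<xi> ^ l * norm (local_fourier \<phi> h \<epsilon> \<xi>)) \<le> jb \<xi> * C"
          by (simp add: C_def mult_ac local_fourier_def)
        hence "jb \<xi> ^ l * norm (local_fourier \<phi> h \<epsilon> \<xi>) \<le> C"
          using mult_le_cancel_left_pos[OF jb_pos(1)] by blast
        thus "norm (local_fourier \<phi> h \<epsilon> \<xi>) \<le> C * \<epsilon> powr (- 0) * jb \<xi> powr (- real l)"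
          using \<epsilon> by (simp add: powr_minus powr_realpow field_simps)
      qed
      thus "decay (high_freq \<Gamma>) 0 l (local_fourier \<phi> h)" unfolding decay_def by blast
    qed
    have tri: "\<forall>\<^sub>F (\<epsilon>, \<xi>) in cone_freq \<Gamma>. norm (local_fourier \<phi> f \<epsilon> \<xi>)
        \<le> norm (local_fourier \<phi> (\<lambda>\<epsilon> x. h \<epsilon> x + f \<epsilon> x) \<epsilon> \<xi>) + norm (local_fourier \<phi> h \<epsilon> \<xi>)"
      using eventually_cone_freq_eps
    proof (eventually_elim, safe)
      fix \<epsilon> :: real and \<xi> :: "real^'n" assume \<epsilon>: "0 < \<epsilon>" "\<epsilon> \<le> 1"
      have i: "integrable lborel (\<lambda>x. \<phi> x * h \<epsilon> x * wave \<xi> x)" "integrable lborel (\<lambda>x. \<phi> x * f \<epsilon> x * wave \<xi> x)"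
        using \<epsilon> by (auto intro!: csmooth_integrable[OF K(1)] csmooth_wave[OF K(1)] cut f negligible_smooth[OF h])
      have "fourier (\<lambda>x. \<phi> x * (h \<epsilon> x + f \<epsilon> x)) \<xi> = (LINT x|lborel. \<phi> x * h \<epsilon> x * wave \<xi> x + \<phi> x * f \<epsilon> x * wave \<xi> x)"
        unfolding fourier_wave by (simp add: algebra_simps)
      also have "\<dots> = fourier (\<lambda>x. \<phi> x * h \<epsilon> x) \<xi> + fourier (\<lambda>x. \<phi> x * f \<epsilon> x) \<xi>"
        unfolding fourier_wave by (rule Bochner_Integration.integral_add[OF i])
      finally have eq: "local_fourier \<phi> f \<epsilon> \<xi> = local_fourier \<phi> (\<lambda>\<epsilon> x. h \<epsilon> x + f \<epsilon> x) \<epsilon> \<xi> - local_fourier \<phi> h \<epsilon> \<xi>"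
        by (simp add: local_fourier_def)
      show "norm (local_fourier \<phi> f \<epsilon> \<xi>)
          \<le> norm (local_fourier \<phi> (\<lambda>\<epsilon> x. h \<epsilon> x + f \<epsilon> x) \<epsilon> \<xi>) + norm (local_fourier \<phi> h \<epsilon> \<xi>)"
        unfolding eq by (rule norm_triangle_ineq4)
    qed
    have "decay (cone_freq \<Gamma>) (max N 1) l (local_fourier \<phi> f)" for l
      by (rule decay_triangle[OF decay_mono[OF N _ eventually_cone_freq_eps]
            decay_mono[OF decay_h _ eventually_cone_freq_eps] tri]) auto
    thus ?thesis by blast
  qed
  thus ?thesis using U unfolding micro_regular_net_iff by blast
qed

context operator_data
begin

lemma mod_bound0:
  assumes "mod_bounds \<Omega> v" "compact K" "K \<subseteq> \<Omega>"
  shows "\<exists>p\<ge>0. \<forall>\<^sub>F \<epsilon> in at_right 0. \<forall>x\<in>K. norm (v \<epsilon> x) \<le> \<epsilon> powr (- p)"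
  using mod_bounds_bound[OF assms, of "[]"] by auto

lemma A_upper:
  assumes K: "compact K" "K \<subseteq> \<Omega>"
  shows "\<exists>p\<ge>0. \<forall>\<^sub>F \<epsilon> in at_right 0. \<forall>x\<in>K. A \<epsilon> x \<le> \<epsilon> powr (- p)"
  unfolding top_size_def
proof (rule finite_sum_bound[OF finite_mi_eq])
  fix \<alpha> :: "'n multi_index" assume "\<alpha> \<in> {\<alpha>. mi_abs \<alpha> = m}"
  hence "mod_bounds \<Omega> (a \<alpha>)" using coeffs by simp
  from mod_bounds_bound[OF this K, of "[]"]
  show "\<exists>p\<ge>0. \<forall>\<^sub>F \<epsilon> in at_right 0. \<forall>x\<in>K. norm (a \<alpha> \<epsilon> x) \<le> \<epsilon> powr (- p)" by auto
qed

lemma diff_op_bound: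
  assumes v: "mod_bounds \<Omega> v" and K: "compact K" "K \<subseteq> \<Omega>"
  shows "\<exists>p\<ge>0. \<forall>\<^sub>F \<epsilon> in at_right 0. \<forall>x\<in>K. norm (diff_op_net m a v \<epsilon> x) \<le> \<epsilon> powr (- p)"
proof -
  have "\<exists>p\<ge>0. \<forall>\<^sub>F \<epsilon> in at_right 0. \<forall>x\<in>K. (\<Sum>\<alpha> | mi_abs \<alpha> \<le> m. norm (a \<alpha> \<epsilon> x * D_deriv \<alpha> (v \<epsilon>) x)) \<le> \<epsilon> powr (- p)"
  proof (rule finite_sum_bound[OF finite_mi_le])
    fix \<alpha> :: "'n multi_index" assume "\<alpha> \<in> {\<alpha>. mi_abs \<alpha> \<le> m}"
    hence \<alpha>: "mod_bounds \<Omega> (a \<alpha>)" using coeffs by simp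
    obtain p where p: "0 \<le> p" "\<forall>\<^sub>F \<epsilon> in at_right 0. \<forall>x\<in>K. norm (pderivs [] (a \<alpha> \<epsilon>) x) \<le> \<epsilon> powr (- p)"
      using mod_bounds_bound[OF \<alpha> K] by blast
    obtain q where q: "0 \<le> q" "\<forall>\<^sub>F \<epsilon> in at_right 0. \<forall>x\<in>K. norm (pderivs (mi_list \<alpha>) (v \<epsilon>) x) \<le> \<epsilon> powr (- q)"
      using mod_bounds_bound[OF v K] by blast
    have "\<forall>\<^sub>F \<epsilon> in at_right 0. \<forall>x\<in>K. norm (a \<alpha> \<epsilon> x * D_deriv \<alpha> (v \<epsilon>) x) \<le> \<epsilon> powr (- (p + q))"
      using p(2) q(2)
    proof (eventually_elim, safe)
      fix \<epsilon> x
      assume 1: "\<forall>x\<in>K. norm (pderivs [] (a \<alpha> \<epsilon>) x) \<le> \<epsilon> powr (- p)"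
        and 2: "\<forall>x\<in>K. norm (pderivs (mi_list \<alpha>) (v \<epsilon>) x) \<le> \<epsilon> powr (- q)" and x: "x \<in> K"
      have "norm (a \<alpha> \<epsilon> x) * norm (pderivs (mi_list \<alpha>) (v \<epsilon>) x) \<le> \<epsilon> powr (- p) * \<epsilon> powr (- q)"
        using bspec[OF 1 x] bspec[OF 2 x] by (intro mult_mono) auto
      thus "norm (a \<alpha> \<epsilon> x * D_deriv \<alpha> (v \<epsilon>) x) \<le> \<epsilon> powr (- (p + q))"
        by (simp add: D_deriv_pderivs norm_mult norm_power flip: powr_add)
    qed
    thus "\<exists>p\<ge>0. \<forall>\<^sub>F \<epsilon> in at_right 0. \<forall>x\<in>K. norm (a \<alpha> \<epsilon> x * D_deriv \<alpha> (v \<epsilon>) x) \<le> \<epsilon> powr (- p)"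
      using p(1) q(1) by (intro exI[of _ "p + q"]) auto
  qed
  then obtain p where p: "0 \<le> p" "\<forall>\<^sub>F \<epsilon> in at_right 0. \<forall>x\<in>K. (\<Sum>\<alpha> | mi_abs \<alpha> \<le> m. norm (a \<alpha> \<epsilon> x * D_deriv \<alpha> (v \<epsilon>) x)) \<le> \<epsilon> powr (- p)" by blast
  from p(2) have "\<forall>\<^sub>F \<epsilon> in at_right 0. \<forall>x\<in>K. norm (diff_op_net m a v \<epsilon> x) \<le> \<epsilon> powr (- p)"
    unfolding diff_op_net_def by eventually_elim (blast intro: order_trans[OF norm_sum])
  thus ?thesis using p(1) by blast
qed

lemma diff_op_smooth:
  assumes v: "mod_bounds \<Omega> v" and \<epsilon>: "\<epsilon> \<in> {0<..1}"
  shows "smooth_on \<Omega> (diff_op_net m a v \<epsilon>)"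
  unfolding diff_op_net_def[abs_def] D_deriv_pderivs
  by (intro smooth_on_sum[OF \<Omega>] smooth_on_mult[OF \<Omega>] smooth_on_const smooth_on_pderivs mod_bounds_smooth[OF v \<epsilon>])
     (use mod_bounds_smooth[OF coeffs] \<epsilon> in auto)

text \<open>
  The data common to both inclusions: a neighbourhood and a cone inside \<open>U\<close> and \<open>\<Gamma>\<close> in which integrals of
  \<open>f\<close> against symbols decay.
\<close>

lemma micro_setup:
  fixes f :: "'n net"
  assumes pt: "x\<^sub>1 \<in> U" "\<xi>\<^sub>1 \<in> \<Gamma>" and reg: "micro_regular_net \<Omega> f x\<^sub>1 \<xi>\<^sub>1"
    and f: "\<And>\<epsilon>. \<epsilon> \<in> {0<..1} \<Longrightarrow> smooth_on \<Omega> (f \<epsilon>)"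
    and fb: "\<And>K. compact K \<Longrightarrow> K \<subseteq> \<Omega> \<Longrightarrow> \<exists>p\<ge>0. \<forall>\<^sub>F \<epsilon> in at_right 0. \<forall>x\<in>K. norm (f \<epsilon> x) \<le> \<epsilon> powr (- p)"
  obtains V \<Gamma>' where "open V" "x\<^sub>1 \<in> V" "V \<subseteq> U" "open_cone \<Gamma>'" "\<xi>\<^sub>1 \<in> \<Gamma>'" "\<Gamma>' \<subseteq> \<Gamma>"
    "\<And>\<phi>. test_fun V \<phi> \<Longrightarrow> \<exists>N. \<forall>b w q M l. symbol \<Gamma>' (closure {x. \<phi> x \<noteq> 0}) w b \<longrightarrow>
      (\<forall>\<^sub>F (\<epsilon>, \<xi>) in high_freq \<Gamma>'. csmooth (closure {x. \<phi> x \<noteq> 0}) (b \<epsilon> \<xi>)) \<longrightarrow>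
      (\<forall>\<^sub>F (\<epsilon>, \<xi>) in high_freq \<Gamma>'. \<forall>x\<in>closure {x. \<phi> x \<noteq> 0}. w \<epsilon> \<xi> x \<le> \<epsilon> powr (- q) * jb \<xi> powr M) \<longrightarrow>
      decay (high_freq \<Gamma>') (N + q) l (osc_integral f b)"
proof -
  obtain U1 \<Gamma>1 where U1: "open U1" "x\<^sub>1 \<in> U1" "U1 \<subseteq> \<Omega>" and \<Gamma>1: "open_cone \<Gamma>1" "\<xi>\<^sub>1 \<in> \<Gamma>1"
    and dec: "\<And>\<phi>. test_fun U1 \<phi> \<Longrightarrow> \<exists>N. \<forall>l. decay (cone_freq \<Gamma>1) N l (local_fourier \<phi> f)"
    using reg unfolding micro_regular_net_iff by blast
  obtain \<Gamma>2 d where \<Gamma>2: "open_cone \<Gamma>2" "\<xi>\<^sub>1 \<in> \<Gamma>2" "\<Gamma>2 \<subseteq> \<Gamma>1 \<inter> \<Gamma>" and d: "0 < d" "d \<le> 1"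
    "\<And>\<xi> \<eta>. \<xi> \<in> \<Gamma>2 \<Longrightarrow> norm \<eta> \<le> d * norm \<xi> \<Longrightarrow> \<xi> - \<eta> \<in> \<Gamma>1 \<inter> \<Gamma>"
    using open_cone_shrink[OF open_cone_Int[OF \<Gamma>1(1) \<Gamma>], of \<xi>\<^sub>1] \<Gamma>1(2) pt(2) by blast
  have d': "\<xi> - \<eta> \<in> \<Gamma>1" if "\<xi> \<in> \<Gamma>2" "norm \<eta> \<le> d * norm \<xi>" for \<xi> \<eta> using d(3)[OF that] by blast
  have testV: "test_fun U1 \<phi>" if "test_fun (U1 \<inter> U) \<phi>" for \<phi> using that by (auto simp: test_fun_def)
  show ?thesis
  proof (rule that[of "U1 \<inter> U" \<Gamma>2])
    show "open (U1 \<inter> U)" "x\<^sub>1 \<in> U1 \<inter> U" "U1 \<inter> U \<subseteq> U" "open_cone \<Gamma>2" "\<xi>\<^sub>1 \<in> \<Gamma>2" "\<Gamma>2 \<subseteq> \<Gamma>"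
      using U1 U pt \<Gamma>2 by auto
  qed (rule multiplier_micro[OF \<Omega> f fb U1(1,3) dec d(1,2) d' testV])
qed

text \<open>
  It is enough to consider high frequencies.
\<close>

lemma micro_regular_netI:
  fixes g :: "'n net"
  assumes V: "open V" "x\<^sub>1 \<in> V" "V \<subseteq> U" and \<Gamma>': "open_cone \<Gamma>'" "\<xi>\<^sub>1 \<in> \<Gamma>'"
    and gb: "\<And>K. compact K \<Longrightarrow> K \<subseteq> \<Omega> \<Longrightarrow> \<exists>p\<ge>0. \<forall>\<^sub>F \<epsilon> in at_right 0. \<forall>x\<in>K. norm (g \<epsilon> x) \<le> \<epsilon> powr (- p)"
    and hf: "\<And>\<phi>. test_fun V \<phi> \<Longrightarrow> \<exists>N. \<forall>l. decay (high_freq \<Gamma>') N l (local_fourier \<phi> g)"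
  shows "micro_regular_net \<Omega> g x\<^sub>1 \<xi>\<^sub>1"
proof -
  have "\<exists>N. \<forall>l. decay (cone_freq \<Gamma>') N l (local_fourier \<phi> g)" if \<phi>: "test_fun V \<phi>" for \<phi>
  proof -
    obtain N where N: "\<And>l. decay (high_freq \<Gamma>') N l (local_fourier \<phi> g)" using hf[OF \<phi>] by blast
    obtain p where p: "\<forall>\<^sub>F \<epsilon> in at_right 0. \<forall>x\<in>closure {x. \<phi> x \<noteq> 0}. norm (g \<epsilon> x) \<le> \<epsilon> powr (- p)"
      using gb test_fun_csmooth[OF \<phi>] V(3) U(2) by (meson order_trans)
    have "decay (cone_freq \<Gamma>') (max N p + 1) l (local_fourier \<phi> g)" for l
      by (rule low_frequencies[OF decay_mono[OF local_fourier_bound[OF \<phi> p] _ eventually_cone_freq_eps]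
            decay_mono[OF N _ eventually_high_freq_unit]]) auto
    thus ?thesis by blast
  qed
  thus ?thesis using V U \<Gamma>' unfolding micro_regular_net_iff by blast
qed

text \<open>
  Here \<open>WF\<^sub>g(u)\<close> is seen to be contained in \<open>WF\<^sub>g(P u)\<close> over \<open>U \<times> \<Gamma>\<close>: the iteration starts from the test
  function \<open>\<phi>\<close>, and all the integrals of \<open>P v\<close> that it produces decay with the same power of \<open>\<epsilon>\<close>.
\<close>

theorem micro_hypoelliptic:
  assumes v: "mod_bounds \<Omega> v" and pt: "x\<^sub>1 \<in> U" "\<xi>\<^sub>1 \<in> \<Gamma>"
    and reg: "micro_regular_net \<Omega> (diff_op_net m a v) x\<^sub>1 \<xi>\<^sub>1"
  shows "micro_regular_net \<Omega> v x\<^sub>1 \<xi>\<^sub>1"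
proof (rule micro_setup[OF pt reg diff_op_smooth[OF v] diff_op_bound[OF v]])
  fix V \<Gamma>2
  assume V: "open V" "x\<^sub>1 \<in> V" "V \<subseteq> U" and \<Gamma>2: "open_cone \<Gamma>2" "\<xi>\<^sub>1 \<in> \<Gamma>2" "\<Gamma>2 \<subseteq> \<Gamma>"
    and mult: "\<And>\<phi>. test_fun V \<phi> \<Longrightarrow> \<exists>N. \<forall>b w q M l. symbol \<Gamma>2 (closure {x. \<phi> x \<noteq> 0}) w b \<longrightarrow>
      (\<forall>\<^sub>F (\<epsilon>, \<xi>) in high_freq \<Gamma>2. csmooth (closure {x. \<phi> x \<noteq> 0}) (b \<epsilon> \<xi>)) \<longrightarrow>
      (\<forall>\<^sub>F (\<epsilon>, \<xi>) in high_freq \<Gamma>2. \<forall>x\<in>closure {x. \<phi> x \<noteq> 0}. w \<epsilon> \<xi> x \<le> \<epsilon> powr (- q) * jb \<xi> powr M) \<longrightarrow>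
      decay (high_freq \<Gamma>2) (N + q) l (osc_integral (diff_op_net m a v) b)"
  show ?thesis
  proof (rule micro_regular_netI[OF V \<Gamma>2(1,2) mod_bound0[OF v]])
    fix \<phi> assume \<phi>: "test_fun V \<phi>"
    define K where "K = closure {x. \<phi> x \<noteq> 0}"
    note t = test_fun_csmooth[OF \<phi>, folded K_def]
    have K: "compact K" "K \<subseteq> U" "K \<subseteq> \<Omega>" using t V U by auto
    interpret E: elliptic_data m a \<Gamma>2 K \<Omega> A by (rule elliptic_data[OF K(1,2) \<Gamma>2(3)])
    obtain N where N: "\<And>b w q M l. symbol \<Gamma>2 K w b \<Longrightarrow> \<forall>\<^sub>F (\<epsilon>, \<xi>) in high_freq \<Gamma>2. csmooth K (b \<epsilon> \<xi>) \<Longrightarrow>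
      \<forall>\<^sub>F (\<epsilon>, \<xi>) in high_freq \<Gamma>2. \<forall>x\<in>K. w \<epsilon> \<xi> x \<le> \<epsilon> powr (- q) * jb \<xi> powr M \<Longrightarrow>
      decay (high_freq \<Gamma>2) (N + q) l (osc_integral (diff_op_net m a v) b)"
      using mult[OF \<phi>] unfolding K_def by blast
    obtain q where q: "\<forall>\<^sub>F \<epsilon> in at_right 0. \<forall>x\<in>K. \<epsilon> powr q \<le> A \<epsilon> x" using lower[OF K(1,2)] by blast
    obtain p where p: "\<forall>\<^sub>F \<epsilon> in at_right 0. \<forall>x\<in>K. norm (v \<epsilon> x) \<le> \<epsilon> powr (- p)"
      using mod_bound0[OF v K(1,3)] by blast
    \<comment> \<open>\<open>N + q\<close> serves the integrals of \<open>P v\<close>, where \<open>q\<close> comes from the weight \<open>1 / A\<close> of \<open>h / P\<close>; \<open>p\<close> serves the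
      last remainder, which is estimated by the supremum of \<open>v\<close>.\<close>
    define N' where "N' = max (N + q) p"
    have vb: "\<forall>\<^sub>F \<epsilon> in at_right 0. \<forall>x\<in>K. norm (v \<epsilon> x) \<le> \<epsilon> powr (- N')"
      by (rule growth_mono[OF p]) (simp add: N'_def)
    have mult': "decay (high_freq \<Gamma>2) N' l (osc_integral (diff_op_net m a v) (E.quot h))"
      if h: "symbol \<Gamma>2 K (\<lambda>_ \<xi> _. jb \<xi> powr t) h" "\<forall>\<^sub>F (\<epsilon>, \<xi>) in high_freq \<Gamma>2. csmooth K (h \<epsilon> \<xi>)" for h t l
    proof -
      have "\<forall>\<^sub>F (\<epsilon>, \<xi>) in high_freq \<Gamma>2. \<forall>x\<in>K. 1 / A \<epsilon> x * jb \<xi> powr (t - m) \<le> \<epsilon> powr (- q) * jb \<xi> powr (t - m)"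
        using eventually_high_freq_eps[OF q] eventually_high_freq_cone
      proof (eventually_elim, safe)
        fix \<epsilon> x and \<xi> :: "real^'n"
        assume 1: "\<forall>x\<in>K. \<epsilon> powr q \<le> A \<epsilon> x" and \<epsilon>: "0 < \<epsilon>" and x: "x \<in> K"
        have q0: "0 < \<epsilon> powr q" using \<epsilon> by simp
        have "0 < A \<epsilon> x" by (rule less_le_trans[OF q0 bspec[OF 1 x]])
        hence "1 / A \<epsilon> x \<le> 1 / \<epsilon> powr q"
          by (intro divide_left_mono bspec[OF 1 x] mult_pos_pos q0) auto
        thus "1 / A \<epsilon> x * jb \<xi> powr (t - m) \<le> \<epsilon> powr (- q) * jb \<xi> powr (t - m)"
          by (intro mult_right_mono) (auto simp: powr_minus_divide)
      qed
      from N[OF E.symbol_quot[OF h(1)] E.csmooth_quot[OF h(2)] this, of l] show ?thesis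
        by (rule decay_mono[OF _ _ eventually_high_freq_unit]) (simp add: N'_def)
    qed
    have s\<phi>: "symbol \<Gamma>2 K (\<lambda>_ \<xi> _. jb \<xi> powr 0) (\<lambda>_ _. \<phi>)"
      using symbol_upto_fixed[OF K(1) csmooth_smooth_near[OF t(2)], of _ \<Gamma>2] by simp
    have c\<phi>: "\<forall>\<^sub>F (\<epsilon>, \<xi>) in high_freq \<Gamma>2. csmooth K \<phi>" using t(2) by (simp add: case_prod_unfold)
    \<comment> \<open>\<open>\<phi>\<close> has order 0 in \<open>\<xi>\<close>; \<open>l\<close> steps reach order \<open>-l\<close>, and one more makes up for the loss \<open>\<theta> = 1\<close>.\<close>
    have "decay (high_freq \<Gamma>2) N' l (osc_integral v (\<lambda>_ _. \<phi>))" for l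
      by (rule E.parametrix_iterate[OF mod_bounds_smooth[OF v] vb mult' s\<phi> c\<phi>, where k = "l + 1"]) auto
    hence "decay (high_freq \<Gamma>2) N' l (local_fourier \<phi> v)" for l
      by (rule decay_cong) (simp add: local_fourier_eq_osc case_prod_unfold)
    thus "\<exists>N. \<forall>l. decay (high_freq \<Gamma>2) N l (local_fourier \<phi> v)" by blast
  qed
qed

text \<open>
  The opposite inclusion. On the support of \<open>\<phi>\<close>, all derivatives of
  \<open>L \<phi>\<close> have the common weight \<open>A (1 + |\<xi>|)\<^sup>m\<close>, and \<open>A\<close> is bounded by a power of \<open>1 / \<epsilon>\<close>.
\<close>

theorem micro_regular_diff_op:
  assumes v: "mod_bounds \<Omega> v" and pt: "x\<^sub>1 \<in> U" "\<xi>\<^sub>1 \<in> \<Gamma>"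
    and reg: "micro_regular_net \<Omega> v x\<^sub>1 \<xi>\<^sub>1"
  shows "micro_regular_net \<Omega> (diff_op_net m a v) x\<^sub>1 \<xi>\<^sub>1"
proof (rule micro_setup[OF pt reg mod_bounds_smooth[OF v] mod_bound0[OF v]])
  fix V \<Gamma>2
  assume V: "open V" "x\<^sub>1 \<in> V" "V \<subseteq> U" and \<Gamma>2: "open_cone \<Gamma>2" "\<xi>\<^sub>1 \<in> \<Gamma>2" "\<Gamma>2 \<subseteq> \<Gamma>"
    and mult: "\<And>\<phi>. test_fun V \<phi> \<Longrightarrow> \<exists>N. \<forall>b w q M l. symbol \<Gamma>2 (closure {x. \<phi> x \<noteq> 0}) w b \<longrightarrow>
      (\<forall>\<^sub>F (\<epsilon>, \<xi>) in high_freq \<Gamma>2. csmooth (closure {x. \<phi> x \<noteq> 0}) (b \<epsilon> \<xi>)) \<longrightarrow>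
      (\<forall>\<^sub>F (\<epsilon>, \<xi>) in high_freq \<Gamma>2. \<forall>x\<in>closure {x. \<phi> x \<noteq> 0}. w \<epsilon> \<xi> x \<le> \<epsilon> powr (- q) * jb \<xi> powr M) \<longrightarrow>
      decay (high_freq \<Gamma>2) (N + q) l (osc_integral v b)"
  show ?thesis
  proof (rule micro_regular_netI[OF V \<Gamma>2(1,2) diff_op_bound[OF v]])
    fix \<phi> assume \<phi>: "test_fun V \<phi>"
    define K where "K = closure {x. \<phi> x \<noteq> 0}"
    note t = test_fun_csmooth[OF \<phi>, folded K_def]
    have K: "compact K" "K \<subseteq> U" "K \<subseteq> \<Omega>" using t V U by auto
    interpret E: elliptic_data m a \<Gamma>2 K \<Omega> A by (rule elliptic_data[OF K(1,2) \<Gamma>2(3)])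
    let ?b = "\<lambda>\<epsilon> \<xi>. transp_op m a \<epsilon> \<xi> \<phi>"
    obtain q where q: "\<forall>\<^sub>F \<epsilon> in at_right 0. \<forall>x\<in>K. A \<epsilon> x \<le> \<epsilon> powr (- q)" using A_upper[OF K(1,3)] by blast
    have s\<phi>: "symbol \<Gamma>2 K (\<lambda>_ _ _. 1) (\<lambda>_ _. \<phi>)"
      using symbol_upto_fixed[OF K(1) csmooth_smooth_near[OF t(2)], of _ \<Gamma>2] by simp
    have ct: "csmooth K (?b \<epsilon> \<xi>)" if "\<epsilon> \<in> {0<..1}" for \<epsilon> \<xi>
      by (rule csmooth_transp_op[OF K(1) \<Omega> K(3) E.a_smooth t(2)]) (use that in auto)
    have cev: "\<forall>\<^sub>F (\<epsilon>, \<xi>) in high_freq \<Gamma>2. csmooth K (?b \<epsilon> \<xi>)"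
      using eventually_high_freq_cone by eventually_elim (use ct in auto)
    have w: "\<forall>\<^sub>F (\<epsilon>, \<xi>) in high_freq \<Gamma>2. \<forall>x\<in>K. A \<epsilon> x * jb \<xi> powr m \<le> \<epsilon> powr (- q) * jb \<xi> powr m"
      using eventually_high_freq_eps[OF q] by eventually_elim (auto intro!: mult_right_mono)
    obtain N where N: "\<And>l. decay (high_freq \<Gamma>2) (N + q) l (osc_integral v ?b)"
      using mult[OF \<phi>, folded K_def] E.symbol_transp_op[OF s\<phi>] cev w by blast
    have "\<forall>\<^sub>F (\<epsilon>, \<xi>) in high_freq \<Gamma>2. local_fourier \<phi> (diff_op_net m a v) \<epsilon> \<xi> = osc_integral v ?b \<epsilon> \<xi>"
      using eventually_high_freq_cone
    proof (eventually_elim, safe)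
      fix \<epsilon> :: real and \<xi> :: "real^'n" assume "0 < \<epsilon>" "\<epsilon> \<le> 1"
      hence e: "\<epsilon> \<in> {0<..1}" by simp
      show "local_fourier \<phi> (diff_op_net m a v) \<epsilon> \<xi> = osc_integral v ?b \<epsilon> \<xi>"
        using integral_transp_op[where v = v and a = a and \<epsilon> = \<epsilon>, OF K(1) \<Omega> K(3) mod_bounds_smooth[OF v e] E.a_smooth[OF _ e] t(2)]
        by (simp add: local_fourier_eq_osc osc_integral_def)
    qed
    hence "decay (high_freq \<Gamma>2) (N + q) l (local_fourier \<phi> (diff_op_net m a v))" for l
      by (rule decay_cong[OF N])
    thus "\<exists>N. \<forall>l. decay (high_freq \<Gamma>2) N l (local_fourier \<phi> (diff_op_net m a v))" by blast
  qed
qed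

text \<open>
  Representatives of \<open>P u\<close> differ from some \<open>P v\<close>, with \<open>v\<close> a representative of \<open>u\<close>, by negligible nets.
\<close>

lemma micro_regular_diff_op_iff:
  assumes u: "u \<in> carrier (colombeau \<Omega>)" and pt: "x\<^sub>1 \<in> U" "\<xi>\<^sub>1 \<in> \<Gamma>"
  shows "micro_regular \<Omega> (diff_op \<Omega> m a u) x\<^sub>1 \<xi>\<^sub>1 \<longleftrightarrow> micro_regular \<Omega> u x\<^sub>1 \<xi>\<^sub>1"
proof -
  obtain v0 where v0: "v0 \<in> moderate \<Omega>" "u = colombeau_class \<Omega> v0" using carrier_colombeau[OF u] .
  have pm: "mod_bounds \<Omega> v" if "v \<in> u" for v
    using that v0 mod_bounds_add_negligible[OF \<Omega> _ moderate_imp_mod_bounds[OF \<Omega> v0(1)]]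
    by (auto simp: in_colombeau_class_iff)
  show ?thesis
  proof
    assume "micro_regular \<Omega> u x\<^sub>1 \<xi>\<^sub>1"
    then obtain v where v: "v \<in> u" "micro_regular_net \<Omega> v x\<^sub>1 \<xi>\<^sub>1" by (auto simp: micro_regular_def)
    have "diff_op_net m a v \<in> diff_op \<Omega> m a u"
      unfolding diff_op_def using v(1) colombeau_class_refl by blast
    thus "micro_regular \<Omega> (diff_op \<Omega> m a u) x\<^sub>1 \<xi>\<^sub>1"
      using micro_regular_diff_op[OF pm[OF v(1)] pt v(2)] unfolding micro_regular_def by blast
  next
    assume "micro_regular \<Omega> (diff_op \<Omega> m a u) x\<^sub>1 \<xi>\<^sub>1"
    then obtain v h where v: "v \<in> u" and h: "h \<in> negligible_nets \<Omega>"
      and reg: "micro_regular_net \<Omega> (\<lambda>\<epsilon> x. h \<epsilon> x + diff_op_net m a v \<epsilon> x) x\<^sub>1 \<xi>\<^sub>1"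
      by (auto simp: micro_regular_def diff_op_def in_colombeau_class_iff)
    have "micro_regular_net \<Omega> (diff_op_net m a v) x\<^sub>1 \<xi>\<^sub>1"
      by (rule micro_regular_net_negligible[OF \<Omega> h diff_op_smooth[OF pm[OF v]] reg])
    from micro_hypoelliptic[OF pm[OF v] pt this] v show "micro_regular \<Omega> u x\<^sub>1 \<xi>\<^sub>1"
      unfolding micro_regular_def by blast
  qed
qed

end

lemma powr_le_sum_norm_of_sum_square:
  fixes f :: "'i \<Rightarrow> complex"
  assumes I: "finite I" and \<epsilon>: "0 < \<epsilon>" and le: "\<epsilon> powr q \<le> (\<Sum>i\<in>I. (norm (f i))\<^sup>2)"
  shows "\<epsilon> powr (q / 2) \<le> (\<Sum>i\<in>I. norm (f i))"
proof -
  let ?S = "\<Sum>i\<in>I. norm (f i)"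
  have "(\<epsilon> powr (q / 2))\<^sup>2 = \<epsilon> powr q" using \<epsilon> by (simp add: power2_eq_square flip: powr_add)
  also have "\<dots> \<le> (\<Sum>i\<in>I. (norm (f i))\<^sup>2)" by (rule le)
  also have "\<dots> \<le> (\<Sum>i\<in>I. norm (f i) * ?S)"
  proof (rule sum_mono)
    fix i assume "i \<in> I"
    hence "norm (f i) \<le> ?S" by (rule member_le_sum) (use I in auto)
    thus "(norm (f i))\<^sup>2 \<le> norm (f i) * ?S" unfolding power2_eq_square by (rule mult_left_mono) simp
  qed
  also have "\<dots> = ?S\<^sup>2" by (simp add: power2_eq_square sum_distrib_right)
  finally show ?thesis by (rule power2_le_imp_le) (simp add: sum_nonneg)
qed

theorem proposition4p5:
  fixes \<Omega> U \<Gamma> :: "(real^'n::finite) set"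
    and m :: nat
    and a :: "'n multi_index \<Rightarrow> 'n net"
    and x\<^sub>0 \<xi>\<^sub>0 :: "real^'n"
  assumes "open \<Omega>"
    and coeffs: "\<And>\<alpha>. mi_abs \<alpha> \<le> m \<Longrightarrow> a \<alpha> \<in> moderate \<Omega>"
    and point: "x\<^sub>0 \<in> \<Omega>" "\<xi>\<^sub>0 \<noteq> 0"
    and nbhd: "open U" "U \<subseteq> \<Omega>" "x\<^sub>0 \<in> U" "open_cone \<Gamma>" "\<xi>\<^sub>0 \<in> \<Gamma>"
    and invertible: "colombeau_class U
        (\<lambda>\<epsilon> x. complex_of_real (\<Sum>\<alpha> | mi_abs \<alpha> = m. (norm (a \<alpha> \<epsilon> x))\<^sup>2)) \<in> Units (colombeau U)"
    and a: "\<And>K. compact K \<Longrightarrow> K \<subseteq> U \<Longrightarrow>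
        \<exists>s r. pos_slow_scale s \<and> pos_slow_scale r \<and>
          (\<exists>\<epsilon>\<^sub>0\<in>{0<..1}. \<forall>\<epsilon>\<in>{0<..<\<epsilon>\<^sub>0}. \<forall>x\<in>K. \<forall>\<xi>\<in>\<Gamma>. r \<epsilon> \<le> norm \<xi> \<longrightarrow>
            norm (principal_symb m a \<epsilon> x \<xi>) \<ge>
              1 / s \<epsilon> * (\<Sum>\<alpha> | mi_abs \<alpha> = m. norm (a \<alpha> \<epsilon> x)) * (1 + norm \<xi>) ^ m)"
    and b: "\<And>K \<gamma>. compact K \<Longrightarrow> K \<subseteq> U \<Longrightarrow>
        \<exists>s r. pos_slow_scale s \<and> pos_slow_scale r \<and>
          (\<exists>\<epsilon>\<^sub>0\<in>{0<..1}. \<forall>\<beta>. mi_abs \<beta> \<le> m \<longrightarrow>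
            (\<forall>\<epsilon>\<in>{0<..<\<epsilon>\<^sub>0}. \<forall>x\<in>K. \<forall>\<xi>\<in>\<Gamma>. r \<epsilon> \<le> norm \<xi> \<longrightarrow>
              norm (mi_deriv \<gamma> (a \<beta> \<epsilon>) x) \<le> s \<epsilon> * (\<Sum>\<alpha> | mi_abs \<alpha> = m. norm (a \<alpha> \<epsilon> x))))"
  shows "(\<exists>m\<^sub>0 \<delta> \<rho> :: real. 0 \<le> \<delta> \<and> \<delta> < \<rho> \<and> \<rho> \<le> 1 \<and>
      (\<forall>K. compact K \<and> K \<subseteq> U \<longrightarrow>
        (\<exists>q>0. \<exists>r. pos_slow_scale r \<and>
          (\<exists>\<epsilon>\<^sub>0\<in>{0<..1}. \<forall>\<epsilon>\<in>{0<..<\<epsilon>\<^sub>0}. \<forall>x\<in>K. \<forall>\<xi>\<in>\<Gamma>. r \<epsilon> \<le> norm \<xi> \<longrightarrow>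
            norm (symb m a \<epsilon> x \<xi>) \<ge> \<epsilon> powr q * (1 + norm \<xi>) powr m\<^sub>0)) \<and>
        (\<forall>\<alpha>. \<exists>s r. pos_slow_scale s \<and> pos_slow_scale r \<and>
          (\<exists>\<epsilon>\<^sub>0\<in>{0<..1}. \<forall>\<beta>. mi_abs \<beta> \<le> m \<longrightarrow>
            (\<forall>\<epsilon>\<in>{0<..<\<epsilon>\<^sub>0}. \<forall>x\<in>K. \<forall>\<xi>\<in>\<Gamma>. r \<epsilon> \<le> norm \<xi> \<longrightarrow>
              norm (symb_deriv \<alpha> \<beta> (symb m a \<epsilon>) x \<xi>) \<le>
                s \<epsilon> * norm (symb m a \<epsilon> x \<xi>) *
                  (1 + norm \<xi>) powr (\<delta> * real (mi_abs \<alpha>) - \<rho> * real (mi_abs \<beta>)))))))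
    \<and> (\<forall>u\<in>carrier (colombeau \<Omega>).
        (U \<times> \<Gamma>) \<inter> WF_g \<Omega> u = (U \<times> \<Gamma>) \<inter> WF_g \<Omega> (diff_op \<Omega> m a u))"
proof -
  interpret operator_data \<Omega> U \<Gamma> m a
  proof
    show "open \<Omega>" "open U" "U \<subseteq> \<Omega>" "open_cone \<Gamma>" using assms(1) nbhd by auto
    show "mod_bounds \<Omega> (a \<alpha>)" if "mi_abs \<alpha> \<le> m" for \<alpha>
      by (rule moderate_imp_mod_bounds[OF assms(1) coeffs[OF that]])
  next
    fix K assume K: "compact K" "K \<subseteq> U"
    obtain q where q: "q \<ge> 0" "\<forall>\<^sub>F \<epsilon> in at_right 0. \<forall>x\<in>K.
        \<epsilon> powr q \<le> norm (complex_of_real (\<Sum>\<alpha> | mi_abs \<alpha> = m. (norm (a \<alpha> \<epsilon> x))\<^sup>2))"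
      using invertible_lower_bound[OF nbhd(1) invertible K] by blast
    have "\<forall>\<^sub>F \<epsilon> in at_right 0. \<forall>x\<in>K. \<epsilon> powr (q / 2) \<le> top_size m a \<epsilon> x"
      using q(2) eventually_unit
    proof (eventually_elim, safe)
      fix \<epsilon> x
      assume 1: "\<forall>x\<in>K. \<epsilon> powr q \<le> norm (complex_of_real (\<Sum>\<alpha> | mi_abs \<alpha> = m. (norm (a \<alpha> \<epsilon> x))\<^sup>2))"
        and \<epsilon>: "0 < \<epsilon>" and x: "x \<in> K"
      have "\<epsilon> powr q \<le> (\<Sum>\<alpha> | mi_abs \<alpha> = m. (norm (a \<alpha> \<epsilon> x))\<^sup>2)"
        using bspec[OF 1 x] unfolding norm_of_real by (simp add: sum_nonneg)
      thus "\<epsilon> powr (q / 2) \<le> top_size m a \<epsilon> x"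
        unfolding top_size_def by (rule powr_le_sum_norm_of_sum_square[OF finite_mi_eq \<epsilon>])
    qed
    thus "\<exists>q\<ge>0. \<forall>\<^sub>F \<epsilon> in at_right 0. \<forall>x\<in>K. \<epsilon> powr q \<le> top_size m a \<epsilon> x"
      using q(1) by (intro exI[of _ "q / 2"] conjI) simp_all
  next
    fix K assume K: "compact K" "K \<subseteq> U"
    obtain s r e where s: "pos_slow_scale s" "pos_slow_scale r" "e \<in> {0<..1}"
      and low: "\<forall>\<epsilon>\<in>{0<..<e}. \<forall>x\<in>K. \<forall>\<xi>\<in>\<Gamma>. r \<epsilon> \<le> norm \<xi> \<longrightarrow>
        norm (principal_symb m a \<epsilon> x \<xi>) \<ge> 1 / s \<epsilon> * (\<Sum>\<alpha> | mi_abs \<alpha> = m. norm (a \<alpha> \<epsilon> x)) * (1 + norm \<xi>) ^ m"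
      using a[OF K] by blast
    have "\<forall>\<^sub>F (\<epsilon>, \<xi>) in high_freq \<Gamma>. \<forall>x\<in>K. top_size m a \<epsilon> x * jb \<xi> ^ m \<le> s \<epsilon> * norm (principal_symb m a \<epsilon> x \<xi>)"
      unfolding eventually_high_freq prod.case
    proof (rule exI[of _ r], intro conjI s(2) bexI[OF _ s(3)] ballI impI)
      fix \<epsilon> \<xi> x assume \<epsilon>: "\<epsilon> \<in> {0<..<e}" and "\<xi> \<in> \<Gamma>" "r \<epsilon> \<le> norm \<xi>" "x \<in> K"
      hence "1 / s \<epsilon> * top_size m a \<epsilon> x * jb \<xi> ^ m \<le> norm (principal_symb m a \<epsilon> x \<xi>)"
        using low unfolding top_size_def by blast
      moreover have "0 < s \<epsilon>" using s(1,3) \<epsilon> by (auto simp: pos_slow_scale_iff)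
      ultimately show "top_size m a \<epsilon> x * jb \<xi> ^ m \<le> s \<epsilon> * norm (principal_symb m a \<epsilon> x \<xi>)"
        by (simp add: pos_divide_le_eq mult.commute)
    qed
    with s(1) show "\<exists>s. pos_slow_scale s \<and> (\<forall>\<^sub>F (\<epsilon>, \<xi>) in high_freq \<Gamma>. \<forall>x\<in>K.
        top_size m a \<epsilon> x * jb \<xi> ^ m \<le> s \<epsilon> * norm (principal_symb m a \<epsilon> x \<xi>))" by blast
  next
    fix K and \<gamma> :: "'n multi_index" assume K: "compact K" "K \<subseteq> U"
    obtain s r e where s: "pos_slow_scale s" "pos_slow_scale r" "e \<in> {0<..1}"
      and up: "\<forall>\<beta>. mi_abs \<beta> \<le> m \<longrightarrow> (\<forall>\<epsilon>\<in>{0<..<e}. \<forall>x\<in>K. \<forall>\<xi>\<in>\<Gamma>. r \<epsilon> \<le> norm \<xi> \<longrightarrow>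
        norm (mi_deriv \<gamma> (a \<beta> \<epsilon>) x) \<le> s \<epsilon> * (\<Sum>\<alpha> | mi_abs \<alpha> = m. norm (a \<alpha> \<epsilon> x)))"
      using b[OF K, of \<gamma>] by blast
    have "\<forall>\<^sub>F (\<epsilon>, \<xi>) in high_freq \<Gamma>. \<forall>\<beta>. mi_abs \<beta> \<le> m \<longrightarrow> (\<forall>x\<in>K. norm (mi_deriv \<gamma> (a \<beta> \<epsilon>) x) \<le> s \<epsilon> * top_size m a \<epsilon> x)"
      unfolding eventually_high_freq prod.case top_size_def
      by (rule exI[of _ r], intro conjI s(2) bexI[OF _ s(3)]) (use up in blast)
    with s(1) show "\<exists>s. pos_slow_scale s \<and> (\<forall>\<^sub>F (\<epsilon>, \<xi>) in high_freq \<Gamma>. \<forall>\<beta>. mi_abs \<beta> \<le> m \<longrightarrow>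
        (\<forall>x\<in>K. norm (mi_deriv \<gamma> (a \<beta> \<epsilon>) x) \<le> s \<epsilon> * top_size m a \<epsilon> x))" by blast
  qed
  have part1: "\<exists>q>0. \<exists>r. pos_slow_scale r \<and>
          (\<exists>\<epsilon>\<^sub>0\<in>{0<..1}. \<forall>\<epsilon>\<in>{0<..<\<epsilon>\<^sub>0}. \<forall>x\<in>K. \<forall>\<xi>\<in>\<Gamma>. r \<epsilon> \<le> norm \<xi> \<longrightarrow>
            norm (symb m a \<epsilon> x \<xi>) \<ge> \<epsilon> powr q * (1 + norm \<xi>) powr real m)"
    if K: "compact K" "K \<subseteq> U" for K
  proof -
    obtain q where q: "q > 0" "\<forall>\<^sub>F (\<epsilon>, \<xi>) in high_freq \<Gamma>. \<forall>x\<in>K. \<epsilon> powr q * jb \<xi> powr m \<le> norm (symb m a \<epsilon> x \<xi>)"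
      using symb_lower_powr[OF K] by blast
    then obtain r e where "pos_slow_scale r" "e \<in> {0<..1}" "\<forall>\<epsilon>\<in>{0<..<e}. \<forall>\<xi>\<in>\<Gamma>. r \<epsilon> \<le> norm \<xi> \<longrightarrow>
        (\<forall>x\<in>K. \<epsilon> powr q * jb \<xi> powr m \<le> norm (symb m a \<epsilon> x \<xi>))"
      unfolding eventually_high_freq prod.case by blast
    with q(1) show ?thesis by blast
  qed
  have part2: "\<exists>s r. pos_slow_scale s \<and> pos_slow_scale r \<and>
          (\<exists>\<epsilon>\<^sub>0\<in>{0<..1}. \<forall>\<beta>. mi_abs \<beta> \<le> m \<longrightarrow>
            (\<forall>\<epsilon>\<in>{0<..<\<epsilon>\<^sub>0}. \<forall>x\<in>K. \<forall>\<xi>\<in>\<Gamma>. r \<epsilon> \<le> norm \<xi> \<longrightarrow>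
              norm (symb_deriv \<alpha> \<beta> (symb m a \<epsilon>) x \<xi>) \<le>
                s \<epsilon> * norm (symb m a \<epsilon> x \<xi>) * (1 + norm \<xi>) powr (0 * real (mi_abs \<alpha>) - 1 * real (mi_abs \<beta>))))"
    if K: "compact K" "K \<subseteq> U" for K \<alpha>
  proof -
    obtain s where s: "pos_slow_scale s" "\<forall>\<^sub>F (\<epsilon>, \<xi>) in high_freq \<Gamma>. \<forall>\<beta>. mi_abs \<beta> \<le> m \<longrightarrow> (\<forall>x\<in>K.
      norm (symb_deriv \<alpha> \<beta> (symb m a \<epsilon>) x \<xi>) \<le> s \<epsilon> * norm (symb m a \<epsilon> x \<xi>) * jb \<xi> powr (- real (mi_abs \<beta>)))"
      using symb_deriv_upper[OF K] by blast
    then obtain r e where r: "pos_slow_scale r" "e \<in> {0<..1}" "\<forall>\<epsilon>\<in>{0<..<e}. \<forall>\<xi>\<in>\<Gamma>. r \<epsilon> \<le> norm \<xi> \<longrightarrow>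
        (\<forall>\<beta>. mi_abs \<beta> \<le> m \<longrightarrow> (\<forall>x\<in>K.
          norm (symb_deriv \<alpha> \<beta> (symb m a \<epsilon>) x \<xi>) \<le> s \<epsilon> * norm (symb m a \<epsilon> x \<xi>) * jb \<xi> powr (- real (mi_abs \<beta>))))"
      unfolding eventually_high_freq prod.case by blast
    have e: "0 * real (mi_abs \<alpha>) - 1 * real (mi_abs \<beta>) = - real (mi_abs \<beta>)" for \<beta> :: "'n multi_index" by simp
    show ?thesis unfolding e
      by (rule exI[of _ s], rule exI[of _ r], intro conjI s(1) r(1) bexI[OF _ r(2)]) (use r(3) in blast)
  qed
  have WF: "\<forall>u\<in>carrier (colombeau \<Omega>). (U \<times> \<Gamma>) \<inter> WF_g \<Omega> u = (U \<times> \<Gamma>) \<inter> WF_g \<Omega> (diff_op \<Omega> m a u)"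
    using micro_regular_diff_op_iff by (auto simp: WF_g_def)
  show ?thesis
    by (rule conjI[OF _ WF], rule exI[of _ "real m"], rule exI[of _ 0], rule exI[of _ 1],
        intro conjI allI impI part1 part2) auto
qed

end
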